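(* Let $u_0\in H^1(\mathcal O)$. Then for every $p\ge2$, $$\sup_{\tau\in(0,1),\,N\ge2}\ \sup_{m\ge0}\mathbb E\big[\|u^{\tau,N}(t_m,\cdot)\|^p_{L^\infty}\big]<\infty\quad\text{and}\quad\sup_{\tau\in(0,1),\,N\ge2}\ \sup_{m\ge0}\mathbb E\big[\|U^{\tau,N}_{t_m}\|^p_{w^{1,2}_N}\big]<\infty.$$
   Context: Let $\mathcal O=(0,\pi)$, $\phi_0\equiv\pi^{-1/2}$, $\phi_j(x)=\sqrt{2/\pi}\cos(jx)$ ($j\ge1$). Assume $f(x)=a_0x^3+a_1x^2+a_2x+a_3$ with $a_0>0$, $a_i\in\mathbb R$, and $\sup_{x\in\mathbb R}(-f'(x))<1$. Let $\{\beta_j\}_{j\ge1}$ be independent standard Brownian motions, $\sigma\in\mathbb R$. Numerical scheme: for $N\ge2$, $h=\pi/N$, $x_i=(i-\frac12)h$. On $\mathbb R^N$ use $\langle\vec u,\vec v\rangle_{l^2_N}=h\sum_iu_iv_i$, $\|\vec u\|_{l^p_N}=(h\sum_i|u_i|^p)^{1/p}$, $\|\vec u\|_{l^\infty_N}=\max_i|u_i|$. $A_N=\frac{N^2}{\pi^2}M$ where $M$ is the $N\times N$ tridiagonal matrix with diagonal $(-1,-2,\dots,-2,-1)$ and off-diagonal entries $1$. $\phi_{N,j}=(\phi_j(x_1),\dots,\phi_j(x_N))^\top$, $j=0,\dots,N-1$, is an $l^2_N$-orthonormal eigenbasis with $-A_N\phi_{N,j}=\lambda_{N,j}\phi_{N,j}$,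 $\lambda_{N,j}=\frac{4N^2}{\pi^2}\sin^2(\frac{j\pi}{2N})$. $(-A_N)^{1/2}\vec v=\sum_j\lambda_{N,j}^{1/2}\langle\vec v,\phi_{N,j}\rangle_{l^2_N}\phi_{N,j}$ and $\|\vec v\|_{w^{1,2}_N}=(\|\vec v\|^2_{l^2_N}+\|(-A_N)^{1/2}\vec v\|^2_{l^2_N})^{1/2}$. $F_N(\vec v)=(f(v_1),\dots,f(v_N))^\top$, and for a time step $\tau\in(0,1)$, $\tilde F_N(\vec v)=F_N(\vec v)/(1+\tau\|\vec v\|^{12}_{w^{1,2}_N})$. Let $t_m=m\tau$ and $\lfloor t\rfloor=t_m$ for $t\in[t_m,t_{m+1})$, $u_0^N=(u_0(x_1),\dots,u_0(x_N))^\top$. The fully discrete (strongly tamed exponential Euler / finite difference) approximation is $$U^{\tau,N}_t=e^{-A_N^2t}u_0^N+\int_0^tA_Ne^{-A_N^2(t-\lfloor s\rfloor)}\tilde F_N(U^{\tau,N}_{\lfloor s\rfloor})ds+\sigma\sum_{j=1}^{N-1}\int_0^te^{-A_N^2(t-\lfloor s\rfloor)}\phi_{N,j}\,d\beta_j(s),$$ equivalently $U^{\tau,N}_{t_{m+1}}=e^{-A_N^2\tau}U^{\tau,N}_{t_m}+\tau A_Ne^{-A_N^2\tau}\tilde F_N(U^{\tau,N}_{t_m})+\sigma e^{-A_N^2\tau}\sum_{j=1}^{N-1}(\beta_j(t_{m+1})-\beta_j(t_m))\phi_{N,j}$. $P_N$ is piecewise linear interpolation ($P_N\vec v=v_1$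 on $[0,x_1]$, linear between $x_i,x_{i+1}$, $=v_N$ on $[x_N,\pi]$), and $u^{\tau,N}(t,\cdot)=P_NU^{\tau,N}_t$. *)

theory Defs
  imports "HOL-Probability.Probability"
begin

definition indep_std_BMs :: "'a measure \<Rightarrow> (nat \<Rightarrow> real \<Rightarrow> 'a \<Rightarrow> real) \<Rightarrow> bool" where
  "indep_std_BMs M \<beta> \<longleftrightarrow>
     prob_space M \<and>
     (\<forall>j\<ge>1. \<forall>t\<ge>0. \<beta> j t \<in> borel_measurable M) \<and>
     (\<forall>j\<ge>1. \<forall>\<omega>\<in>space M. \<beta> j 0 \<omega> = 0) \<and>
     (\<forall>j\<ge>1. \<forall>\<omega>\<in>space M. continuous_on {0..} (\<lambda>t. \<beta> j t \<omega>)) \<and>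
     (\<forall>J (s::nat \<Rightarrow> real) k. finite J \<longrightarrow> J \<subseteq> {1..} \<longrightarrow> 0 \<le> s 0 \<longrightarrow>
        (\<forall>i<k. s i < s (Suc i)) \<longrightarrow>
        prob_space.indep_vars M (\<lambda>_. borel)
           (\<lambda>(j, i) \<omega>. \<beta> j (s (Suc i)) \<omega> - \<beta> j (s i) \<omega>) (J \<times> {..<k}) \<and>
        (\<forall>j\<in>J. \<forall>i<k. distributed M lborel (\<lambda>\<omega>. \<beta> j (s (Suc i)) \<omega> - \<beta> j (s i) \<omega>)
             (\<lambda>x. ennreal (normal_density 0 (sqrt (s (Suc i) - s i)) x))))"

text \<open>u is (the continuous representative of) an H^1(0,pi) function: absolutely continuous
 on [0,pi] with derivative g in L^2(0,pi).\<close>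

definition H1_interval :: "(real \<Rightarrow> real) \<Rightarrow> bool" where
  "H1_interval u \<longleftrightarrow> (\<exists>g. g integrable_on {0..pi} \<and> (\<lambda>x. (g x)\<^sup>2) integrable_on {0..pi} \<and>
      (\<forall>x\<in>{0..pi}. u x = u 0 + integral {0..x} g))"

section \<open>Spatial discretisation; vectors in R^N are functions nat => real indexed by 1..N\<close>

definition hN :: "nat \<Rightarrow> real" where "hN N = pi / real N"

definition xN :: "nat \<Rightarrow> nat \<Rightarrow> real" where "xN N i = (real i - 1/2) * hN N"

definition phi :: "nat \<Rightarrow> real \<Rightarrow> real" where
  "phi j x = (if j = 0 then 1 / sqrt pi else sqrt (2 / pi) * cos (real j * x))"

definition phiN :: "nat \<Rightarrow> nat \<Rightarrow> nat \<Rightarrow> real" where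
  "phiN N j = (\<lambda>i. phi j (xN N i))"

definition lamN :: "nat \<Rightarrow> nat \<Rightarrow> real" where
  "lamN N j = 4 * (real N)\<^sup>2 / pi\<^sup>2 * (sin (real j * pi / (2 * real N)))\<^sup>2"

definition inner_l2N :: "nat \<Rightarrow> (nat \<Rightarrow> real) \<Rightarrow> (nat \<Rightarrow> real) \<Rightarrow> real" where
  "inner_l2N N u v = hN N * (\<Sum>i=1..N. u i * v i)"

definition norm_l2N :: "nat \<Rightarrow> (nat \<Rightarrow> real) \<Rightarrow> real" where
  "norm_l2N N v = sqrt (hN N * (\<Sum>i=1..N. (v i)\<^sup>2))"

definition matvec :: "nat \<Rightarrow> (nat \<Rightarrow> nat \<Rightarrow> real) \<Rightarrow> (nat \<Rightarrow> real) \<Rightarrow> nat \<Rightarrow> real" where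
  "matvec N B v = (\<lambda>i. \<Sum>k=1..N. B i k * v k)"

definition matmul :: "nat \<Rightarrow> (nat \<Rightarrow> nat \<Rightarrow> real) \<Rightarrow> (nat \<Rightarrow> nat \<Rightarrow> real) \<Rightarrow> nat \<Rightarrow> nat \<Rightarrow> real" where
  "matmul N B C = (\<lambda>i l. \<Sum>k=1..N. B i k * C k l)"

definition matid :: "nat \<Rightarrow> nat \<Rightarrow> real" where
  "matid = (\<lambda>i k. if i = k then 1 else 0)"

fun matpow :: "nat \<Rightarrow> (nat \<Rightarrow> nat \<Rightarrow> real) \<Rightarrow> nat \<Rightarrow> nat \<Rightarrow> nat \<Rightarrow> real" where
  "matpow N B 0 = matid"
| "matpow N B (Suc k) = matmul N B (matpow N B k)"

definition expmv :: "nat \<Rightarrow> (nat \<Rightarrow> nat \<Rightarrow> real) \<Rightarrow> (nat \<Rightarrow> real) \<Rightarrow> nat \<Rightarrow> real" where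
  "expmv N B v = (\<lambda>i. \<Sum>k. matvec N (matpow N B k) v i / fact k)"

definition AN :: "nat \<Rightarrow> nat \<Rightarrow> nat \<Rightarrow> real" where
  "AN N i k = (real N)\<^sup>2 / pi\<^sup>2 *
     (if i = k then (if i = 1 \<or> i = N then -1 else -2)
      else if i = Suc k \<or> k = Suc i then 1 else 0)"

definition heatN :: "nat \<Rightarrow> real \<Rightarrow> (nat \<Rightarrow> real) \<Rightarrow> nat \<Rightarrow> real" where
  "heatN N t v = expmv N (\<lambda>i k. - t * matmul N (AN N) (AN N) i k) v"

definition sqrtAN :: "nat \<Rightarrow> (nat \<Rightarrow> real) \<Rightarrow> nat \<Rightarrow> real" where
  "sqrtAN N v = (\<lambda>i. \<Sum>j<N. sqrt (lamN N j) * inner_l2N N v (phiN N j) * phiN N j i)"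

definition norm_w12N :: "nat \<Rightarrow> (nat \<Rightarrow> real) \<Rightarrow> real" where
  "norm_w12N N v = sqrt ((norm_l2N N v)\<^sup>2 + (norm_l2N N (sqrtAN N v))\<^sup>2)"

definition FtildeN :: "(real \<Rightarrow> real) \<Rightarrow> real \<Rightarrow> nat \<Rightarrow> (nat \<Rightarrow> real) \<Rightarrow> nat \<Rightarrow> real" where
  "FtildeN f \<tau> N v = (\<lambda>i. f (v i) / (1 + \<tau> * norm_w12N N v ^ 12))"

fun Uscheme :: "(real \<Rightarrow> real) \<Rightarrow> real \<Rightarrow> (nat \<Rightarrow> real \<Rightarrow> 'a \<Rightarrow> real) \<Rightarrow> (real \<Rightarrow> real)
    \<Rightarrow> real \<Rightarrow> nat \<Rightarrow> nat \<Rightarrow> 'a \<Rightarrow> nat \<Rightarrow> real" where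
  "Uscheme f \<sigma> \<beta> u0 \<tau> N 0 \<omega> = (\<lambda>i. u0 (xN N i))"
| "Uscheme f \<sigma> \<beta> u0 \<tau> N (Suc m) \<omega> =
     (let U = Uscheme f \<sigma> \<beta> u0 \<tau> N m \<omega>;
          dW = (\<lambda>i. \<Sum>j=1..N-1. (\<beta> j (real (Suc m) * \<tau>) \<omega> - \<beta> j (real m * \<tau>) \<omega>) * phiN N j i)
      in (\<lambda>i. heatN N \<tau> U i
              + \<tau> * matvec N (AN N) (heatN N \<tau> (FtildeN f \<tau> N U)) i
              + \<sigma> * heatN N \<tau> dW i))"

definition PN :: "nat \<Rightarrow> (nat \<Rightarrow> real) \<Rightarrow> real \<Rightarrow> real" where
  "PN N v x = (if x \<le> xN N 1 then v 1
              else if x \<ge> xN N N then v N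
              else (let i = nat \<lfloor>x / hN N + 1/2\<rfloor> in
                    v i + (x - xN N i) / hN N * (v (Suc i) - v i)))"

definition Linf_norm :: "(real \<Rightarrow> real) \<Rightarrow> real" where
  "Linf_norm g = Sup ((\<lambda>x. \<bar>g x\<bar>) ` {0..pi})"

end

theory Submission
  imports Defs
begin

text \<open>
  Write \<open>U = Y + Z\<close>, where \<open>Z\<close> is the discrete convolution of the initial value and the noise with the
  semigroup \<open>E = exp (- \<tau> A\<^sup>2)\<close>, and \<open>Y\<close> solves \<open>Y' = E (Y + \<tau> A F)\<close>, \<open>Y\<^sub>0 = 0\<close>, with tamed nonlinearity
  \<open>F\<close>; then \<open>Y\<close> has mean zero. Put \<open>n\<^sub>k = \<Sum>\<^sub>j \<lambda>\<^sub>j\<^sup>k y\<^sub>j\<^sup>2\<close> and \<open>G = 1 + \<parallel>Z\<parallel>\<^sup>2\<close> (norm of \<open>w\<^sup>1\<^sup>,\<^sup>2\<close>).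

  The inequality \<open>1 + x \<le> exp x\<close> makes \<open>E\<close> behave like an implicit Euler step, so \<open>n\<^sub>0 + \<tau> n\<^sub>2\<close> is a
  Lyapunov function: the cubic dissipates \<open>n\<^sub>0\<^sup>2\<close>, which absorbs all products of \<open>Y\<close> and \<open>Z\<close>, and
  the commutation errors are of size \<open>\<tau>\<^sup>3\<^sup>/\<^sup>2 \<parallel>\<nabla>F\<parallel>\<^sup>2\<close>, bounded by \<open>\<tau>\<close> thanks to
  \<open>\<tau>\<^sup>1\<^sup>/\<^sup>2 r\<^sup>6 \<le> 1 + \<tau> r\<^sup>1\<^sup>2\<close>. Hence it contracts at rate \<open>1 - \<tau>/64\<close> up to \<open>\<tau> C G\<^sup>4\<close>. With this
  bound, \<open>n\<^sub>1 + \<tau> n\<^sub>3\<close> contracts in the same way up to \<open>\<tau> C (G + n\<^sub>0)\<^sup>7\<close>, because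
  \<open>n\<^sub>1\<^sup>3 \<le> n\<^sub>0\<^sup>2 n\<^sub>3\<close>. Convexity of \<open>x\<^sup>q\<close> transfers both recursions to moments, uniformly in time, and
  the modes of \<open>Z\<close> are Gaussian with variance at most \<open>1/\<lambda>\<^sub>j\<^sup>2\<close>.
\<close>

section \<open>Spectral calculus of the discrete Neumann Laplacian\<close>

lemma hN_pos: "0 < N \<Longrightarrow> 0 < hN N"
  by (simp add: hN_def)

text \<open>The factor \<open>2 * sin (\<theta>/2)\<close> turns each half-shifted cosine into a
  difference of sines at consecutive integer multiples of \<open>\<theta>\<close>, so the sum
  telescopes.\<close>

lemma sum_cos_half_shift:
  "2 * sin (\<theta>/2) * (\<Sum>i=1..n. cos ((real i - 1/2) * \<theta>)) = sin (real n * \<theta>)"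
proof (induction n)
  case (Suc n)
  have "2 * sin (\<theta>/2) * cos ((real (Suc n) - 1/2) * \<theta>) = sin (real (Suc n) * \<theta>) - sin (real n * \<theta>)"
    by (simp add: sin_diff_sin field_simps)
  with Suc show ?case by (simp add: algebra_simps)
qed simp

lemma sum_cos_multiples:
  "2 * sin (\<theta>/2) * (\<Sum>j=1..n. cos (real j * \<theta>)) = sin ((real n + 1/2) * \<theta>) - sin (\<theta>/2)"
proof (induction n)
  case (Suc n)
  have "((real (Suc n) + 1/2) * \<theta> - (real n + 1/2) * \<theta>) / 2 = \<theta> / 2"
    "((real (Suc n) + 1/2) * \<theta> + (real n + 1/2) * \<theta>) / 2 = real (Suc n) * \<theta>"
    by (simp_all add: algebra_simps)
  hence "2 * sin (\<theta>/2) * cos (real (Suc n) * \<theta>) = sin ((real (Suc n) + 1/2) * \<theta>) - sin ((real n + 1/2) * \<theta>)"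
    by (simp only: sin_diff_sin)
  with Suc show ?case by (simp add: algebra_simps)
qed simp

text \<open>A zero would force \<open>a = 2 * N * k\<close>, impossible for a nonzero
  \<open>a\<close> of modulus below \<open>2 * N\<close>. This permits dividing the telescoped sums
  by the sine.\<close>

lemma sin_half_grid_nonzero:
  fixes a :: int
  assumes "0 < N" "a \<noteq> 0" "\<bar>a\<bar> < 2 * int N"
  shows "sin (of_int a * hN N / 2) \<noteq> 0"
proof
  assume "sin (of_int a * hN N / 2) = 0"
  then obtain k :: int where "of_int a * hN N / 2 = of_int k * pi"
    by (auto simp: sin_zero_iff_int2)
  hence "real_of_int a = of_int (2 * int N * k)"
    using assms(1) by (simp add: hN_def field_simps)
  hence "a = 2 * int N * k" by linarith
  with assms(2,3) show False
    by (metis abs_mult dvd_imp_le_int dvd_triv_left abs_of_nonneg of_nat_0_le_iff mult_nonneg_nonneg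
        zero_le_numeral leD)
qed

lemma sum_cos_grid:
  fixes a :: int
  assumes "0 < N" "\<bar>a\<bar> < 2 * int N"
  shows "(\<Sum>i=1..N. cos (of_int a * xN N i)) = (if a = 0 then real N else 0)"
proof (cases "a = 0")
  case False
  have "2 * sin (of_int a * hN N / 2) * (\<Sum>i=1..N. cos ((real i - 1/2) * (of_int a * hN N))) = 0"
    using assms(1) by (simp only: sum_cos_half_shift) (simp add: hN_def mult.commute)
  then show ?thesis
    using sin_half_grid_nonzero[OF assms(1) False assms(2)] False by (simp add: xN_def mult_ac)
qed simp

text \<open>Stopping at \<open>N - 1\<close> makes the last argument \<open>a * pi - ?t / 2\<close>,
  whose sine is again a multiple of \<open>sin (?t / 2)\<close>. What remains depends on the parity
  of \<open>a\<close> only.\<close>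

lemma sum_cos_freq:
  fixes a :: int
  assumes "0 < N" "a \<noteq> 0" "\<bar>a\<bar> < 2 * int N"
  shows "2 * (\<Sum>j=1..N-1. cos (real j * (of_int a * hN N))) = - cos (of_int a * pi) - 1"
proof -
  let ?t = "of_int a * hN N"
  have "(real (N-1) + 1/2) * ?t = of_int a * pi - ?t / 2"
    using assms(1) by (simp add: hN_def field_simps of_nat_diff)
  hence "sin ((real (N-1) + 1/2) * ?t) = - (cos (of_int a * pi) * sin (?t / 2))"
    by (simp add: sin_diff mult.commute[of _ pi])
  with sum_cos_multiples[of ?t "N-1"]
  have "sin (?t / 2) * (2 * (\<Sum>j=1..N-1. cos (real j * ?t))) = sin (?t/2) * (- cos (of_int a * pi) - 1)"
    by (simp add: algebra_simps)
  with sin_half_grid_nonzero[OF assms] show ?thesis by simp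
qed

lemma cos_times_cos_int:
  "cos (real j * x) * cos (real l * x)
    = (cos (of_int (int j - int l) * x) + cos (of_int (int j + int l) * x)) / 2"
  by (simp add: cos_times_cos algebra_simps)

text \<open>Product-to-sum leaves the frequencies \<open>j - l\<close> and \<open>j + l\<close>,
  both of modulus below \<open>2 * N\<close>. The second vanishes only for \<open>j = l = 0\<close>,
  which accounts for the separate normalisation of mode 0.\<close>

lemma phiN_orthonormal:
  assumes "j < N" "l < N"
  shows "inner_l2N N (phiN N j) (phiN N l) = (if j = l then 1 else 0)"
proof -
  have N: "0 < N" using assms by simp
  have S: "(\<Sum>i=1..N. cos (real j * xN N i) * cos (real l * xN N i))
      = ((if j = l then real N else 0) + (if j = 0 \<and> l = 0 then real N else 0)) / 2"
  proof -
    have "(\<Sum>i=1..N. cos (real j * xN N i) * cos (real l * xN N i))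
      = ((\<Sum>i=1..N. cos (of_int (int j - int l) * xN N i)) + (\<Sum>i=1..N. cos (of_int (int j + int l) * xN N i))) / 2"
      by (simp only: cos_times_cos_int sum.distrib sum_divide_distrib[symmetric])
    also have "\<dots> = ((if int j - int l = 0 then real N else 0) + (if int j + int l = 0 then real N else 0)) / 2"
      using assms N by (subst (1 2) sum_cos_grid) auto
    finally show ?thesis by auto
  qed
  define c where "c = (\<lambda>j::nat. if j = 0 then 1 / sqrt pi else sqrt (2 / pi))"
  have ph: "phi j x = c j * cos (real j * x)" for j x by (simp add: phi_def c_def)
  have "inner_l2N N (phiN N j) (phiN N l)
      = hN N * (c j * c l * (\<Sum>i=1..N. cos (real j * xN N i) * cos (real l * xN N i)))"
    by (simp add: inner_l2N_def phiN_def ph sum_distrib_left mult_ac)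
  also have "\<dots> = (if j = l then 1 else 0)"
    unfolding S using N by (auto simp: c_def hN_def real_sqrt_mult[symmetric] real_sqrt_divide[symmetric])
  finally show ?thesis .
qed

text \<open>The frequency sums are evaluated at \<open>x_i - x_k\<close> and
  \<open>x_i + x_k\<close>, multiples of the mesh width by integers of opposite parity. Off the
  diagonal their cosine terms cancel and the remaining constant cancels the contribution of mode
  0.\<close>

lemma phiN_complete:
  assumes "i \<in> {1..N}" "k \<in> {1..N}"
  shows "(\<Sum>j<N. phiN N j i * phiN N j k) = (if i = k then 1 / hN N else 0)"
proof -
  have N: "0 < N" using assms by simp
  have e: "{..<N} = insert 0 {1..N-1}" using N by auto
  have d: "phi j x * phi j y = (cos (real j * (x - y)) + cos (real j * (x + y))) / pi" if "j \<in> {1..N-1}" for j x y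
    using that by (simp add: phi_def cos_times_cos algebra_simps real_sqrt_mult[symmetric])
      (simp add: field_simps cos_add cos_diff)
  have x1: "xN N i - xN N k = of_int (int i - int k) * hN N"
    and x2: "xN N i + xN N k = of_int (int i + int k - 1) * hN N"
    by (simp_all add: xN_def algebra_simps)
  have s2: "2 * (\<Sum>j=1..N-1. cos (real j * (xN N i + xN N k))) = - cos (of_int (int i + int k - 1) * pi) - 1"
    unfolding x2 using assms by (intro sum_cos_freq[OF N]) auto
  have s1: "2 * (\<Sum>j=1..N-1. cos (real j * (xN N i - xN N k)))
      = (if i = k then 2 * (real N - 1) else - cos (of_int (int i - int k) * pi) - 1)"
  proof (cases "i = k")
    case True then show ?thesis using N by (simp add: of_nat_diff)
  next
    case False
    then show ?thesis unfolding x1 using assms by (subst sum_cos_freq[OF N]) auto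
  qed
  \<comment> \<open>The two integers differ by the odd number \<open>2 * k - 1\<close>, hence the
    change of sign.\<close>
  have "cos (of_int (int i + int k - 1) * pi) = cos (of_int (int i - int k) * pi + of_int (2 * int k - 1) * pi)"
    by (rule arg_cong[of _ _ cos]) (simp add: algebra_simps)
  also have "\<dots> = - cos (of_int (int i - int k) * pi)"
    by (subst cos_add) (simp add: sin_zero_iff_int2 cos_diff algebra_simps flip: of_int_mult)
  finally have c: "cos (of_int (int i + int k - 1) * pi) = - cos (of_int (int i - int k) * pi)" .
  have "(\<Sum>j<N. phiN N j i * phiN N j k) = 1 / pi +
     ((\<Sum>j=1..N-1. cos (real j * (xN N i - xN N k))) + (\<Sum>j=1..N-1. cos (real j * (xN N i + xN N k)))) / pi"
    unfolding e phiN_def by (subst sum.insert) (simp_all add: phi_def[of 0] d sum.distrib flip: sum_divide_distrib)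
  also have "\<dots> = (if i = k then 1 / hN N else 0)"
    using s1 s2 c N by (auto simp: hN_def field_simps)
  finally show ?thesis .
qed

definition coefN :: "nat \<Rightarrow> (nat \<Rightarrow> real) \<Rightarrow> nat \<Rightarrow> real" where
  "coefN N v j = inner_l2N N v (phiN N j)"

lemma coefN_expand:
  assumes "i \<in> {1..N}"
  shows "v i = (\<Sum>j<N. coefN N v j * phiN N j i)"
proof -
  have "(\<Sum>j<N. coefN N v j * phiN N j i) = (\<Sum>j<N. \<Sum>k=1..N. hN N * v k * (phiN N j k * phiN N j i))"
    by (simp add: coefN_def inner_l2N_def sum_distrib_left sum_distrib_right mult_ac)
  also have "\<dots> = (\<Sum>k=1..N. hN N * v k * (\<Sum>j<N. phiN N j k * phiN N j i))"
    by (subst sum.swap) (simp add: sum_distrib_left)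
  also have "\<dots> = (\<Sum>k=1..N. if k = i then v i else 0)"
    using assms hN_pos[of N] by (intro sum.cong refl) (auto simp: phiN_complete)
  finally show ?thesis using assms by simp
qed

lemma coefN_cong: "(\<And>i. i \<in> {1..N} \<Longrightarrow> u i = v i) \<Longrightarrow> coefN N u j = coefN N v j"
  by (simp add: coefN_def inner_l2N_def)

lemma inner_sum_left:
  "inner_l2N N (\<lambda>i. \<Sum>j\<in>J. c j * w j i) v = (\<Sum>j\<in>J. c j * inner_l2N N (w j) v)"
  unfolding inner_l2N_def
  by (simp add: sum_distrib_left sum_distrib_right mult_ac) (rule sum.swap)

text \<open>The index set is left free because the noise increment is synthesised from the modes
  \<open>1..N-1\<close> only.\<close>

lemma coefN_synth:
  assumes "l < N" "J \<subseteq> {..<N}"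
  shows "coefN N (\<lambda>i. \<Sum>j\<in>J. c j * phiN N j i) l = (if l \<in> J then c l else 0)"
proof -
  have J: "finite J" using assms(2) finite_subset by blast
  have "coefN N (\<lambda>i. \<Sum>j\<in>J. c j * phiN N j i) l = (\<Sum>j\<in>J. c j * (if j = l then 1 else 0))"
    unfolding coefN_def inner_sum_left using assms by (intro sum.cong refl) (simp add: phiN_orthonormal subset_eq)
  also have "\<dots> = (\<Sum>j\<in>J. if j = l then c l else 0)"
    by (intro sum.cong) auto
  finally show ?thesis using J by simp
qed

lemma inner_commute: "inner_l2N N u v = inner_l2N N v u"
  by (simp add: inner_l2N_def mult.commute)

lemma inner_cong_left:
  "(\<And>i. i \<in> {1..N} \<Longrightarrow> u i = u' i) \<Longrightarrow> inner_l2N N u v = inner_l2N N u' v"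
  by (simp add: inner_l2N_def)

lemma parseval: "inner_l2N N u v = (\<Sum>j<N. coefN N u j * coefN N v j)"
proof -
  have "inner_l2N N u v = inner_l2N N (\<lambda>i. \<Sum>j<N. coefN N u j * phiN N j i) v"
    by (rule inner_cong_left) (rule coefN_expand)
  also have "\<dots> = (\<Sum>j<N. coefN N u j * coefN N v j)"
    unfolding inner_sum_left coefN_def by (simp add: inner_commute)
  finally show ?thesis .
qed

lemma coefN_linear:
  "coefN N (\<lambda>i. u i + v i) j = coefN N u j + coefN N v j"
  "coefN N (\<lambda>i. u i - v i) j = coefN N u j - coefN N v j"
  "coefN N (\<lambda>i. c * u i) j = c * coefN N u j"
  by (simp_all add: coefN_def inner_l2N_def algebra_simps sum.distrib sum_subtractf sum_distrib_left)

lemma norm_l2N_sq: "(norm_l2N N v)\<^sup>2 = (\<Sum>j<N. (coefN N v j)\<^sup>2)"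
proof -
  have "0 \<le> hN N * (\<Sum>i=1..N. (v i)\<^sup>2)"
    by (intro mult_nonneg_nonneg sum_nonneg) (auto simp: hN_def)
  hence "(norm_l2N N v)\<^sup>2 = inner_l2N N v v"
    unfolding norm_l2N_def inner_l2N_def by (simp add: power2_eq_square)
  then show ?thesis by (simp add: parseval power2_eq_square)
qed

lemma lamN_nonneg: "0 \<le> lamN N j"
  by (simp add: lamN_def)

lemma norm_w12N_sq: "(norm_w12N N v)\<^sup>2 = (\<Sum>j<N. (1 + lamN N j) * (coefN N v j)\<^sup>2)"
proof -
  have c: "coefN N (sqrtAN N v) j = sqrt (lamN N j) * coefN N v j" if "j < N" for j
    unfolding sqrtAN_def coefN_def[symmetric] using that by (subst coefN_synth) auto
  show ?thesis
    unfolding norm_w12N_def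
    by (subst real_sqrt_pow2)
      (auto simp: norm_l2N_sq c power_mult_distrib lamN_nonneg algebra_simps sum.distrib intro!: add_nonneg_nonneg sum_nonneg)
qed

text \<open>Jordan's inequality for the sine on \<open>[0, pi/2]\<close>, a consequence of
  concavity, gives quadratic growth of the eigenvalues uniformly in \<open>N\<close>.\<close>

lemma lamN_ge: assumes "j < N" shows "4 / pi\<^sup>2 * (real j)\<^sup>2 \<le> lamN N j"
proof -
  let ?x = "real j * pi / (2 * real N)"
  have N: "0 < real N" using assms by simp
  have x: "0 \<le> ?x" "?x \<le> pi / 2" using assms by (auto simp: field_simps)
  have "2 / pi * ?x \<le> sin ?x"
  proof -
    have "concave_on {0..pi} sin"
      by (rule f''_le0_imp_concave[where f'=cos and f''="\<lambda>x. - sin x"])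
         (auto intro!: derivative_eq_intros sin_ge_zero)
    hence "(1 - 2 * ?x / pi) * sin 0 + (2 * ?x / pi) * sin (pi/2)
        \<le> sin ((1 - 2 * ?x / pi) *\<^sub>R 0 + (2 * ?x / pi) *\<^sub>R (pi/2))"
      using x by (intro concave_onD) (auto simp: divide_simps assms)
    then show ?thesis by (simp add: mult.commute)
  qed
  hence "(2 / pi * ?x)\<^sup>2 \<le> (sin ?x)\<^sup>2" using x by (intro power_mono) auto
  hence "4 * (real N)\<^sup>2 / pi\<^sup>2 * (2 / pi * ?x)\<^sup>2 \<le> lamN N j"
    unfolding lamN_def by (intro mult_left_mono) auto
  moreover have "4 * (real N)\<^sup>2 / pi\<^sup>2 * (2 / pi * ?x)\<^sup>2 = 4 / pi\<^sup>2 * (real j)\<^sup>2"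
    using N by (simp add: power2_eq_square field_simps)
  ultimately show ?thesis by (simp only:)
qed

section \<open>Action of the matrix, its powers and its exponential on eigenvectors\<close>

lemma matvec_sum:
  "matvec N B (\<lambda>k. \<Sum>j\<in>J. c j * w j k) i = (\<Sum>j\<in>J. c j * matvec N B (w j) i)"
  unfolding matvec_def
  by (simp add: sum_distrib_left mult_ac) (rule sum.swap)

lemma matvec_cong:
  "(\<And>k. k \<in> {1..N} \<Longrightarrow> u k = v k) \<Longrightarrow> matvec N B u i = matvec N B v i"
  by (simp add: matvec_def)

text \<open>Forward minus backward difference, where a difference that would leave the grid is
  dropped: the Neumann condition in the form suited to reflection and to summation by parts.\<close>

lemma matvec_AN:
  assumes "2 \<le> N" "i \<in> {1..N}"
  shows "matvec N (AN N) v i = (real N)\<^sup>2 / pi\<^sup>2 *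
     ((if i < N then v (Suc i) - v i else 0) - (if 1 < i then v i - v (i - 1) else 0))"
proof -
  let ?c = "(real N)\<^sup>2 / pi\<^sup>2"
  have "matvec N (AN N) v i = (\<Sum>k=1..N. ?c * ((if k = i then (if i < N then - v i else 0) + (if 1 < i then - v i else 0) else 0)
       + (if k = Suc i then v (Suc i) else 0) + (if k = i - 1 then v (i - 1) else 0)))"
    unfolding matvec_def using assms by (intro sum.cong refl) (auto simp: AN_def)
  also have "\<dots> = ?c * ((\<Sum>k=1..N. (if k = i then (if i < N then - v i else 0) + (if 1 < i then - v i else 0) else 0))
       + (\<Sum>k=1..N. (if k = Suc i then v (Suc i) else 0)) + (\<Sum>k=1..N. (if k = i - 1 then v (i - 1) else 0)))"
    by (simp only: sum_distrib_left[symmetric] sum.distrib)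
  also have "\<dots> = ?c * ((if i < N then v (Suc i) - v i else 0) - (if 1 < i then v i - v (i - 1) else 0))"
    using assms by (auto simp: sum.delta)
  finally show ?thesis .
qed

text \<open>The end points lie half a mesh width inside the interval, and the cosines are even about
  0 and \<open>pi\<close>. The reflected ghost values therefore equal the boundary values, the
  dropped differences are zero, and the interior identity holds in every row.\<close>

lemma AN_phiN:
  assumes N: "2 \<le> N" and i: "i \<in> {1..N}"
  shows "matvec N (AN N) (phiN N j) i = - lamN N j * phiN N j i"
proof -
  let ?h = "hN N" and ?x = "xN N i"
  define c where "c = (if j = 0 then 1 / sqrt pi else sqrt (2 / pi))"
  have ph: "phi j x = c * cos (real j * x)" for x by (simp add: phi_def c_def)
  have hN: "real N * ?h = pi" using N by (simp add: hN_def)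
  have up: "(if i < N then phiN N j (Suc i) - phiN N j i else 0) = c * (cos (real j * (?x + ?h)) - cos (real j * ?x))"
  proof (cases "i < N")
    case True then show ?thesis by (simp add: phiN_def ph xN_def algebra_simps)
  next
    case False
    hence x: "?x = pi - ?h / 2" using i hN by (simp add: xN_def algebra_simps)
    have "cos (real j * (?x + ?h)) = cos (real j * pi + real j * (?h / 2))" unfolding x by (rule arg_cong[of _ _ cos]) (simp add: algebra_simps)
    also have "\<dots> = cos (real j * pi - real j * (?h / 2))"
      by (simp add: cos_add cos_diff)
    finally show ?thesis using False unfolding x by (simp add: algebra_simps)
  qed
  have dn: "(if 1 < i then phiN N j i - phiN N j (i-1) else 0) = c * (cos (real j * ?x) - cos (real j * (?x - ?h)))"
  proof (cases "1 < i")
    case True then show ?thesis by (simp add: phiN_def ph xN_def algebra_simps of_nat_diff)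
  next
    case False
    hence x: "?x = ?h / 2" using i by (simp add: xN_def)
    have "cos (real j * (?h/2 - ?h)) = cos (- (real j * (?h / 2)))" by (rule arg_cong[of _ _ cos]) (simp add: algebra_simps)
    with False show ?thesis unfolding x by simp
  qed
  have "cos (real j * (?x + ?h)) - cos (real j * ?x) - (cos (real j * ?x) - cos (real j * (?x - ?h)))
      = - 4 * (sin (real j * ?h / 2))\<^sup>2 * cos (real j * ?x)"
  proof -
    have "cos (real j * ?h) = 1 - 2 * (sin (real j * ?h / 2))\<^sup>2"
      using cos_double_sin[of "real j * ?h / 2"] by simp
    then show ?thesis by (simp add: distrib_left right_diff_distrib cos_add cos_diff)
  qed
  hence e: "(c * (cos (real j * (?x + ?h)) - cos (real j * ?x)) - c * (cos (real j * ?x) - cos (real j * (?x - ?h))))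
      = - 4 * (sin (real j * ?h / 2))\<^sup>2 * (c * cos (real j * ?x))"
    by (metis (no_types, opaque_lifting) mult.left_commute right_diff_distrib)
  have l: "lamN N j = (real N)\<^sup>2 / pi\<^sup>2 * (4 * (sin (real j * ?h / 2))\<^sup>2)"
    using N by (simp add: lamN_def hN_def mult_ac)
  show ?thesis
    unfolding matvec_AN[OF N i] up dn e l by (simp add: phiN_def ph)
qed

lemma AN_spectral:
  assumes N: "2 \<le> N" and i: "i \<in> {1..N}"
  shows "matvec N (AN N) v i = (\<Sum>j<N. - lamN N j * coefN N v j * phiN N j i)"
proof -
  have "matvec N (AN N) v i = matvec N (AN N) (\<lambda>k. \<Sum>j<N. coefN N v j * phiN N j k) i"
    by (rule matvec_cong) (rule coefN_expand)
  also have "\<dots> = (\<Sum>j<N. coefN N v j * matvec N (AN N) (phiN N j) i)" by (rule matvec_sum)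
  finally show ?thesis by (simp add: AN_phiN[OF N i] mult_ac)
qed

lemma coefN_AN:
  assumes N: "2 \<le> N" and j: "j < N"
  shows "coefN N (matvec N (AN N) v) j = - lamN N j * coefN N v j"
proof -
  have "coefN N (matvec N (AN N) v) j = coefN N (\<lambda>i. \<Sum>j<N. (- lamN N j * coefN N v j) * phiN N j i) j"
    using AN_spectral[OF N] by (intro coefN_cong)
  then show ?thesis using j by (simp only: coefN_synth[OF j subset_refl]) simp
qed

lemma matvec_matmul: "matvec N (matmul N B C) v i = matvec N B (matvec N C v) i"
  unfolding matvec_def matmul_def
  by (simp add: sum_distrib_left sum_distrib_right mult_ac) (rule sum.swap)

lemma matvec_scale: "matvec N (\<lambda>i k. c * B i k) v i = c * matvec N B v i"
  by (simp add: matvec_def sum_distrib_left mult_ac)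

lemma matpow_phiN:
  assumes N: "2 \<le> N"
  shows "i \<in> {1..N} \<Longrightarrow> matvec N (matpow N (\<lambda>i k. - t * matmul N (AN N) (AN N) i k) n) (phiN N j) i
     = (- t * (lamN N j)\<^sup>2) ^ n * phiN N j i"
proof (induction n arbitrary: i)
  case 0
  have "(\<Sum>k=1..N. matid i k * phiN N j k) = (\<Sum>k=1..N. if k = i then phiN N j i else 0)"
    by (intro sum.cong) (auto simp: matid_def)
  then show ?case using 0 by (simp add: matvec_def)
next
  case (Suc n)
  let ?B = "\<lambda>i k. - t * matmul N (AN N) (AN N) i k"
  let ?c = "(- t * (lamN N j)\<^sup>2) ^ n"
  have lin: "matvec N B (\<lambda>k. c * w k) i = c * matvec N B w i" for B c w i
    by (simp add: matvec_def sum_distrib_left mult_ac)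
  have "matvec N (matpow N ?B (Suc n)) (phiN N j) i = matvec N ?B (matvec N (matpow N ?B n) (phiN N j)) i"
    by (simp add: matvec_matmul)
  also have "\<dots> = matvec N ?B (\<lambda>k. ?c * phiN N j k) i"
    by (rule matvec_cong) (rule Suc.IH)
  also have "\<dots> = ?c * (- t * matvec N (AN N) (matvec N (AN N) (phiN N j)) i)"
    by (subst lin[of ?B]) (simp only: matvec_scale matvec_matmul)
  also have "matvec N (AN N) (matvec N (AN N) (phiN N j)) i = matvec N (AN N) (\<lambda>k. - lamN N j * phiN N j k) i"
    by (rule matvec_cong) (rule AN_phiN[OF N])
  also have "\<dots> = (lamN N j)\<^sup>2 * phiN N j i"
    by (simp only: lin AN_phiN[OF N Suc.prems]) (simp add: power2_eq_square)
  finally show ?case by simp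
qed

text \<open>Applied to an eigenvector, the matrix power series becomes the scalar exponential
  series; expanding \<open>v\<close> leaves a finite sum of such series.\<close>

lemma heatN_spectral:
  assumes N: "2 \<le> N" and i: "i \<in> {1..N}"
  shows "heatN N t v i = (\<Sum>j<N. exp (- t * (lamN N j)\<^sup>2) * coefN N v j * phiN N j i)"
proof -
  let ?B = "\<lambda>i k. - t * matmul N (AN N) (AN N) i k"
  have "matvec N (matpow N ?B n) v i = (\<Sum>j<N. coefN N v j * ((- t * (lamN N j)\<^sup>2) ^ n * phiN N j i))" for n
  proof -
    have "matvec N (matpow N ?B n) v i = matvec N (matpow N ?B n) (\<lambda>k. \<Sum>j<N. coefN N v j * phiN N j k) i"
      by (rule matvec_cong) (rule coefN_expand)
    then show ?thesis by (simp only: matvec_sum matpow_phiN[OF N i])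
  qed
  hence e: "matvec N (matpow N ?B n) v i / fact n
      = (\<Sum>j<N. coefN N v j * phiN N j i * ((- t * (lamN N j)\<^sup>2) ^ n /\<^sub>R fact n))" for n
    by (simp add: sum_divide_distrib field_simps)
  have "(\<lambda>n. matvec N (matpow N ?B n) v i / fact n) sums (\<Sum>j<N. coefN N v j * phiN N j i * exp (- t * (lamN N j)\<^sup>2))"
    unfolding e by (intro sums_sum sums_mult exp_converges)
  then show ?thesis
    unfolding heatN_def expmv_def by (simp add: sums_iff mult_ac)
qed

lemma coefN_heatN:
  assumes N: "2 \<le> N" and j: "j < N"
  shows "coefN N (heatN N t v) j = exp (- t * (lamN N j)\<^sup>2) * coefN N v j"
proof -
  have "coefN N (heatN N t v) j = coefN N (\<lambda>i. \<Sum>j<N. (exp (- t * (lamN N j)\<^sup>2) * coefN N v j) * phiN N j i) j"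
    using heatN_spectral[OF N] by (intro coefN_cong)
  then show ?thesis using j by (simp only: coefN_synth[OF j subset_refl]) simp
qed

text \<open>In the eigenbasis the step is diagonal apart from the nonlinearity, and mode 0 receives
  no noise.\<close>

lemma coefN_Uscheme_Suc:
  assumes N: "2 \<le> N" and j: "j < N"
  shows "coefN N (Uscheme f \<sigma> \<beta> u0 \<tau> N (Suc m) \<omega>) j = exp (- \<tau> * (lamN N j)\<^sup>2) *
     (coefN N (Uscheme f \<sigma> \<beta> u0 \<tau> N m \<omega>) j
      - \<tau> * lamN N j * coefN N (FtildeN f \<tau> N (Uscheme f \<sigma> \<beta> u0 \<tau> N m \<omega>)) j
      + \<sigma> * (if 1 \<le> j then \<beta> j (real (Suc m) * \<tau>) \<omega> - \<beta> j (real m * \<tau>) \<omega> else 0))"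
proof -
  have J: "{1..N-1} \<subseteq> {..<N}" using N by auto
  have j': "j \<le> N - 1" using j by simp
  show ?thesis
    using j j' by (simp add: Let_def coefN_linear coefN_heatN[OF N j] coefN_AN[OF N j] coefN_synth[OF j J] del: of_nat_Suc One_nat_def)
      (simp add: algebra_simps)
qed

section \<open>Discrete gradient and Dirichlet form\<close>

definition diffN :: "nat \<Rightarrow> (nat \<Rightarrow> real) \<Rightarrow> nat \<Rightarrow> real" where
  "diffN N v i = (v (Suc i) - v i) / hN N"

text \<open>Summation by parts. After shifting the backward differences by one index both sums run
  over the \<open>N - 1\<close> edges, and no boundary terms arise.\<close>

lemma dirichlet_form:
  assumes N: "2 \<le> N"
  shows "(\<Sum>j<N. lamN N j * coefN N u j * coefN N v j) = hN N * (\<Sum>i=1..<N. diffN N u i * diffN N v i)"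
proof -
  have "(\<Sum>j<N. lamN N j * coefN N u j * coefN N v j) = - (\<Sum>j<N. coefN N (matvec N (AN N) u) j * coefN N v j)"
    by (simp add: coefN_AN[OF N] sum_negf)
  also have "\<dots> = - inner_l2N N (matvec N (AN N) u) v" by (simp add: parseval)
  also have "\<dots> = hN N * (\<Sum>i=1..<N. diffN N u i * diffN N v i)"
  proof -
    let ?d = "\<lambda>i. u (Suc i) - u i"
    have c: "(real N)\<^sup>2 / pi\<^sup>2 = 1 / (hN N)\<^sup>2" by (simp add: hN_def power_divide)
    have "(\<Sum>i=1..N. matvec N (AN N) u i * v i)
       = (\<Sum>i=1..N. 1 / (hN N)\<^sup>2 * ((if i < N then ?d i * v i else 0) - (if 1 < i then (u i - u (i - 1)) * v i else 0)))"
      by (intro sum.cong refl, subst matvec_AN[OF N]) (auto simp: c algebra_simps)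
    also have "\<dots> = 1 / (hN N)\<^sup>2 * ((\<Sum>i=1..N. if i < N then ?d i * v i else 0)
        - (\<Sum>i=1..N. if 1 < i then (u i - u (i - 1)) * v i else 0))"
      by (simp only: sum_distrib_left[symmetric] sum_subtractf)
    also have "(\<Sum>i=1..N. if i < N then ?d i * v i else 0) = (\<Sum>i=1..<N. ?d i * v i)"
      by (subst sum.inter_filter[symmetric]) (auto intro!: sum.cong)
    also have "(\<Sum>i=1..N. if 1 < i then (u i - u (i - 1)) * v i else 0) = (\<Sum>i=1..<N. ?d i * v (Suc i))"
    proof -
      have "(\<Sum>i=1..N. if 1 < i then (u i - u (i - 1)) * v i else 0) = (\<Sum>i=Suc 1..<Suc N. (u i - u (i - 1)) * v i)"
        by (subst sum.inter_filter[symmetric], simp) (rule sum.cong, auto)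
      also have "\<dots> = (\<Sum>i=1..<N. ?d i * v (Suc i))"
        by (subst sum.shift_bounds_Suc_ivl) simp
      finally show ?thesis .
    qed
    also have "1 / (hN N)\<^sup>2 * ((\<Sum>i=1..<N. ?d i * v i) - (\<Sum>i=1..<N. ?d i * v (Suc i)))
        = - (\<Sum>i=1..<N. diffN N u i * diffN N v i)"
      unfolding sum_subtractf[symmetric] sum_distrib_left sum_negf[symmetric]
      by (intro sum.cong refl) (simp add: diffN_def power2_eq_square divide_simps, simp add: algebra_simps)
    finally show ?thesis by (simp add: inner_l2N_def)
  qed
  finally show ?thesis .
qed

section \<open>Discrete Sobolev inequalities\<close>

text \<open>The squared \<open>l2\<close> norm of the power \<open>k / 2\<close> of
  \<open>-A\<close> applied to \<open>v\<close>. Since \<open>0 ^ 0 = 1\<close>, mode 0 counts for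
  \<open>k = 0\<close> and for no other \<open>k\<close>.\<close>

definition sobN :: "nat \<Rightarrow> nat \<Rightarrow> (nat \<Rightarrow> real) \<Rightarrow> real" where
  "sobN k N v = (\<Sum>j<N. lamN N j ^ k * (coefN N v j)\<^sup>2)"

lemma sobN_nonneg: "0 \<le> sobN k N v"
  unfolding sobN_def by (intro sum_nonneg) (simp add: lamN_nonneg)

lemma sobN_0: "sobN 0 N v = hN N * (\<Sum>i=1..N. (v i)\<^sup>2)"
  using parseval[of N v v] by (simp add: sobN_def inner_l2N_def power2_eq_square)

lemma sobN_1: "2 \<le> N \<Longrightarrow> sobN 1 N v = hN N * (\<Sum>i=1..<N. (diffN N v i)\<^sup>2)"
  using dirichlet_form[of N v v] by (simp add: sobN_def power2_eq_square mult.assoc)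

lemma norm_w12N_sobN: "(norm_w12N N v)\<^sup>2 = sobN 0 N v + sobN 1 N v"
  by (simp add: norm_w12N_sq sobN_def algebra_simps sum.distrib)

text \<open>Cauchy-Schwarz over the modes, with the middle weight written as the geometric mean of
  its neighbours.\<close>

lemma sobN_interpolation: "(sobN (Suc k) N v)\<^sup>2 \<le> sobN k N v * sobN (Suc (Suc k)) N v"
proof -
  let ?a = "\<lambda>k j. sqrt (lamN N j) ^ k * coefN N v j"
  have sq: "(?a k j)\<^sup>2 = lamN N j ^ k * (coefN N v j)\<^sup>2" for k j
    by (simp add: power_mult_distrib power_even_eq[symmetric] lamN_nonneg)
      (metis lamN_nonneg mult.commute power_mult real_sqrt_pow2)
  have "?a k j * ?a (Suc (Suc k)) j = (?a (Suc k) j)\<^sup>2" for j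
    by (simp add: power2_eq_square)
  hence "(\<Sum>j<N. ?a k j * ?a (Suc (Suc k)) j) = sobN (Suc k) N v"
    unfolding sobN_def sq by simp
  then show ?thesis
    using Cauchy_Schwarz_ineq_sum[of "?a k" "?a (Suc (Suc k))" "{..<N}"] unfolding sq sobN_def by simp
qed

lemma lamN_ge_quarter: assumes "0 < j" "j < N" shows "1/4 \<le> lamN N j"
proof -
  have "pi\<^sup>2 \<le> 4\<^sup>2" using pi_less_4 by (intro power_mono) auto
  hence "1/4 \<le> 4 / pi\<^sup>2" by (simp add: field_simps)
  also have "\<dots> * 1 \<le> 4 / pi\<^sup>2 * (real j)\<^sup>2" using assms by (intro mult_left_mono) auto
  also have "\<dots> \<le> lamN N j" by (rule lamN_ge[OF assms(2)])
  finally show ?thesis by simp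
qed

text \<open>Without mode 0 all eigenvalues are at least 1/4, so each extra power of the eigenvalue
  costs at most the factor 4.\<close>

lemma sobN_poincare: assumes "coefN N v 0 = 0" shows "sobN k N v \<le> 4 * sobN (Suc k) N v"
  unfolding sobN_def sum_distrib_left
proof (rule sum_mono)
  fix j assume j: "j \<in> {..<N}"
  show "lamN N j ^ k * (coefN N v j)\<^sup>2 \<le> 4 * (lamN N j ^ Suc k * (coefN N v j)\<^sup>2)"
  proof (cases "j = 0")
    case False
    hence "1 \<le> 4 * lamN N j" using lamN_ge_quarter[of j N] j by simp
    hence "1 * (lamN N j ^ k * (coefN N v j)\<^sup>2) \<le> 4 * lamN N j * (lamN N j ^ k * (coefN N v j)\<^sup>2)"
      by (intro mult_right_mono) (auto simp: lamN_nonneg)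
    then show ?thesis by (simp add: mult_ac)
  qed (simp add: assms)
qed

text \<open>Telescoping between the two points; keeping all increments makes the bound independent
  of the points.\<close>

lemma abs_diff_le_variation:
  fixes w :: "nat \<Rightarrow> real"
  assumes "i \<in> {1..N}" "k \<in> {1..N}"
  shows "\<bar>w i - w k\<bar> \<le> (\<Sum>l=1..<N. \<bar>w (Suc l) - w l\<bar>)"
proof -
  have *: "\<bar>w i - w k\<bar> \<le> (\<Sum>l=1..<N. \<bar>w (Suc l) - w l\<bar>)" if "1 \<le> k" "k \<le> i" "i \<le> N" for i k
  proof -
    have "w i - w k = (\<Sum>l=k..<i. w (Suc l) - w l)" using that by (simp add: sum_Suc_diff')
    also have "\<bar>\<dots>\<bar> \<le> (\<Sum>l=k..<i. \<bar>w (Suc l) - w l\<bar>)" by (rule sum_abs)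
    also have "\<dots> \<le> (\<Sum>l=1..<N. \<bar>w (Suc l) - w l\<bar>)" using that by (intro sum_mono2) auto
    finally show ?thesis .
  qed
  show ?thesis
    using *[of k i] *[of i k] assms by (cases "k \<le> i") (auto simp: abs_minus_commute)
qed

lemma weighted_cauchy_schwarz:
  fixes a b :: "nat \<Rightarrow> real"
  assumes "0 \<le> h"
  shows "(h * (\<Sum>i\<in>I. a i * b i))\<^sup>2 \<le> (h * (\<Sum>i\<in>I. (a i)\<^sup>2)) * (h * (\<Sum>i\<in>I. (b i)\<^sup>2))"
  using mult_left_mono[OF Cauchy_Schwarz_ineq_sum[of a b I], of "h\<^sup>2"]
  by (simp add: power_mult_distrib power2_eq_square mult_ac)

lemma hN_sum_const: "0 < N \<Longrightarrow> hN N * (\<Sum>i=1..N. c) = pi * c"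
  by (simp add: hN_def)

text \<open>A discrete Agmon inequality. The square at \<open>i\<close> exceeds the square at any
  other point by at most the total variation \<open>T\<close> of the squares. Averaging over the
  grid gives the first term, and Cauchy-Schwarz on \<open>T\<close> gives the geometric
  mean.\<close>

lemma grid_sup_bound:
  assumes N: "2 \<le> N" and i: "i \<in> {1..N}"
  shows "(v i)\<^sup>2 \<le> sobN 0 N v / pi + 2 * sqrt (sobN 0 N v * sobN 1 N v)"
proof -
  have h: "0 < hN N" using N by (simp add: hN_pos)
  define T where "T = (\<Sum>l=1..<N. \<bar>(v (Suc l))\<^sup>2 - (v l)\<^sup>2\<bar>)"
  have "hN N * (\<Sum>k=1..N. (v i)\<^sup>2) \<le> hN N * (\<Sum>k=1..N. (v k)\<^sup>2 + T)"
    using h abs_diff_le_variation[OF i, of _ "\<lambda>l. (v l)\<^sup>2"] unfolding T_def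
    by (intro mult_left_mono sum_mono) (force simp: abs_le_iff)+
  hence "pi * (v i)\<^sup>2 \<le> sobN 0 N v + pi * T"
    using N by (simp only: sum.distrib distrib_left hN_sum_const sobN_0)
  hence 1: "(v i)\<^sup>2 \<le> sobN 0 N v / pi + T" by (simp add: field_simps)
  have T: "T = hN N * (\<Sum>l=1..<N. \<bar>diffN N v l\<bar> * \<bar>v (Suc l) + v l\<bar>)"
    unfolding T_def sum_distrib_left using h
    by (intro sum.cong refl) (simp add: diffN_def abs_mult[symmetric] power2_eq_square square_diff_square_factored abs_divide mult.commute)
  have "T\<^sup>2 \<le> (hN N * (\<Sum>l=1..<N. \<bar>diffN N v l\<bar>\<^sup>2)) * (hN N * (\<Sum>l=1..<N. \<bar>v (Suc l) + v l\<bar>\<^sup>2))"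
    unfolding T using h by (intro weighted_cauchy_schwarz) simp
  also have "\<dots> \<le> sobN 1 N v * (4 * sobN 0 N v)"
  proof (rule mult_mono)
    have "\<bar>v (Suc l) + v l\<bar>\<^sup>2 \<le> 2 * (v (Suc l))\<^sup>2 + 2 * (v l)\<^sup>2" for l
      using sum_squares_bound[of "v (Suc l)" "v l"] by (simp add: power2_sum)
    hence "(\<Sum>l=1..<N. \<bar>v (Suc l) + v l\<bar>\<^sup>2) \<le> (\<Sum>l=1..<N. 2 * (v (Suc l))\<^sup>2 + 2 * (v l)\<^sup>2)"
      by (intro sum_mono)
    also have "\<dots> = 2 * (\<Sum>l=Suc 1..<Suc N. (v l)\<^sup>2) + 2 * (\<Sum>l=1..<N. (v l)\<^sup>2)"
      by (simp only: sum.distrib sum_distrib_left sum.shift_bounds_Suc_ivl)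
    also have "\<dots> \<le> 2 * (\<Sum>l=1..N. (v l)\<^sup>2) + 2 * (\<Sum>l=1..N. (v l)\<^sup>2)"
      by (intro add_mono mult_left_mono sum_mono2) auto
    finally show "hN N * (\<Sum>l=1..<N. \<bar>v (Suc l) + v l\<bar>\<^sup>2) \<le> 4 * sobN 0 N v"
      unfolding sobN_0 using h by (simp add: mult.left_commute)
  qed (use h in \<open>auto simp: sobN_1[OF N, simplified] sum_nonneg sobN_nonneg[unfolded sobN_1[OF N]]\<close>)
  also have "\<dots> = (2 * sqrt (sobN 0 N v * sobN 1 N v))\<^sup>2"
    by (simp add: power_mult_distrib sobN_nonneg)
  finally have "T \<le> 2 * sqrt (sobN 0 N v * sobN 1 N v)"
    by (rule power2_le_imp_le) (simp add: sobN_nonneg)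
  with 1 show ?thesis by simp
qed

lemma grid_sup_le_w12:
  assumes "2 \<le> N" "i \<in> {1..N}"
  shows "(v i)\<^sup>2 \<le> 2 * (sobN 0 N v + sobN 1 N v)"
proof -
  have "2 * sqrt (sobN 0 N v * sobN 1 N v) \<le> sobN 0 N v + sobN 1 N v"
    using arith_geo_mean_sqrt[OF sobN_nonneg sobN_nonneg] by (simp add: field_simps)
  moreover have "sobN 0 N v / pi \<le> sobN 0 N v"
    using pi_gt3 mult_left_mono[of 1 pi "sobN 0 N v"] by (simp add: sobN_nonneg field_simps)
  ultimately have "sobN 0 N v / pi + 2 * sqrt (sobN 0 N v * sobN 1 N v) \<le> sobN 0 N v + (sobN 0 N v + sobN 1 N v)"
    by (rule add_mono[rotated])
  with grid_sup_bound[OF assms, of v] have "(v i)\<^sup>2 \<le> sobN 0 N v + (sobN 0 N v + sobN 1 N v)"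
    by (rule order_trans)
  then show ?thesis using sobN_nonneg[of 1 N v] by simp
qed

text \<open>The Poincare inequality absorbs the lower-order Agmon term into the geometric mean. The
  product form makes the fourth power of the maximum only linear in \<open>sobN 1\<close>, as needed
  for the gradient estimate.\<close>

lemma grid_sup_mean_zero:
  assumes "2 \<le> N" "i \<in> {1..N}" "coefN N v 0 = 0"
  shows "(v i)\<^sup>2 \<le> 4 * sqrt (sobN 0 N v * sobN 1 N v)"
proof -
  have "sobN 0 N v = sqrt (sobN 0 N v * sobN 0 N v)" by (simp add: sobN_nonneg)
  also have "\<dots> \<le> sqrt (sobN 0 N v * (4 * sobN 1 N v))"
    using sobN_poincare[OF assms(3), of 0] by (intro real_sqrt_le_mono mult_left_mono) (auto simp: sobN_nonneg)
  also have "\<dots> = 2 * sqrt (sobN 0 N v * sobN 1 N v)" by (simp add: real_sqrt_mult)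
  finally have "sobN 0 N v \<le> 2 * sqrt (sobN 0 N v * sobN 1 N v)" .
  moreover have "sobN 0 N v / pi \<le> sobN 0 N v"
    using pi_gt3 mult_left_mono[of 1 pi "sobN 0 N v"] by (simp add: sobN_nonneg field_simps)
  ultimately have "sobN 0 N v / pi \<le> 2 * sqrt (sobN 0 N v * sobN 1 N v)" by (rule order_trans[rotated])
  then show ?thesis using grid_sup_bound[OF assms(1,2), of v] by linarith
qed

text \<open>For equal signs, \<open>\<bar>s - t\<bar>\<close> is at most
  \<open>\<bar>s\<bar> + \<bar>t\<bar>\<close>; for opposite signs, the difference of the signed
  squares has modulus \<open>s * s + t * t\<close>.\<close>

lemma square_diff_le_signed_square:
  fixes s t :: real
  shows "(s - t)\<^sup>2 \<le> 2 * \<bar>s * \<bar>s\<bar> - t * \<bar>t\<bar>\<bar>"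
proof -
  consider "0 \<le> s" "0 \<le> t" | "s < 0" "t < 0" | "0 \<le> s" "t < 0" | "s < 0" "0 \<le> t" by linarith
  then show ?thesis
  proof cases
    case 1
    have "\<bar>s - t\<bar> * \<bar>s - t\<bar> \<le> \<bar>s - t\<bar> * (2 * (s + t))" using 1 by (intro mult_left_mono) auto
    also have "\<dots> = 2 * \<bar>s * s - t * t\<bar>" using 1 by (simp add: square_diff_square_factored abs_mult)
    finally show ?thesis using 1 by (simp add: power2_eq_square)
  next
    case 2
    have "\<bar>s - t\<bar> * \<bar>s - t\<bar> \<le> \<bar>s - t\<bar> * (2 * (- s - t))" using 2 by (intro mult_left_mono) auto
    also have "\<dots> = 2 * \<bar>t * t - s * s\<bar>" using 2 by (simp add: square_diff_square_factored abs_mult abs_minus_commute)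
    finally show ?thesis using 2 by (simp add: power2_eq_square abs_minus_commute)
  next
    case 3
    have "0 \<le> (s + t)\<^sup>2" by simp
    with 3 show ?thesis by (simp add: power2_eq_square algebra_simps)
  next
    case 4
    have "0 \<le> (s + t)\<^sup>2" by simp
    with 4 show ?thesis by (simp add: power2_eq_square algebra_simps abs_if)
  qed
qed

text \<open>Discrete counterpart of differentiating \<open>v * \<bar>v\<bar>\<close>. Twice the
  difference splits symmetrically into \<open>(s - t) * (\<bar>s\<bar> + \<bar>t\<bar>)\<close> and
  \<open>(s + t) * (\<bar>s\<bar> - \<bar>t\<bar>)\<close>, and both have the same bound.\<close>

lemma signed_square_diff:
  fixes s t :: real
  shows "(s * \<bar>s\<bar> - t * \<bar>t\<bar>)\<^sup>2 \<le> 2 * (s\<^sup>2 + t\<^sup>2) * (s - t)\<^sup>2"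
proof -
  have "\<bar>s * \<bar>s\<bar> - t * \<bar>t\<bar>\<bar> \<le> (\<bar>s\<bar> + \<bar>t\<bar>) * \<bar>s - t\<bar>"
  proof -
    have "\<bar>(s - t) * (\<bar>s\<bar> + \<bar>t\<bar>)\<bar> = (\<bar>s\<bar> + \<bar>t\<bar>) * \<bar>s - t\<bar>"
      by (simp add: abs_mult)
    moreover have "\<bar>(s + t) * (\<bar>s\<bar> - \<bar>t\<bar>)\<bar> \<le> (\<bar>s\<bar> + \<bar>t\<bar>) * \<bar>s - t\<bar>"
      unfolding abs_mult by (intro mult_mono) auto
    moreover have "2 * (s * \<bar>s\<bar> - t * \<bar>t\<bar>) = (s - t) * (\<bar>s\<bar> + \<bar>t\<bar>) + (s + t) * (\<bar>s\<bar> - \<bar>t\<bar>)"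
      by (simp add: algebra_simps)
    ultimately have "\<bar>2 * (s * \<bar>s\<bar> - t * \<bar>t\<bar>)\<bar> \<le> (\<bar>s\<bar> + \<bar>t\<bar>) * \<bar>s - t\<bar> + (\<bar>s\<bar> + \<bar>t\<bar>) * \<bar>s - t\<bar>"
      using abs_triangle_ineq[of "(s - t) * (\<bar>s\<bar> + \<bar>t\<bar>)" "(s + t) * (\<bar>s\<bar> - \<bar>t\<bar>)"] by (simp only:)
    then show ?thesis unfolding abs_mult by (simp add: mult.commute)
  qed
  hence "(s * \<bar>s\<bar> - t * \<bar>t\<bar>)\<^sup>2 \<le> ((\<bar>s\<bar> + \<bar>t\<bar>) * \<bar>s - t\<bar>)\<^sup>2"
    by (intro abs_le_square_iff[THEN iffD1]) simp
  also have "\<dots> = (\<bar>s\<bar> + \<bar>t\<bar>)\<^sup>2 * (s - t)\<^sup>2" by (simp add: power_mult_distrib)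
  also have "\<dots> \<le> (2 * (s\<^sup>2 + t\<^sup>2)) * (s - t)\<^sup>2"
    using sum_squares_bound[of "\<bar>s\<bar>" "\<bar>t\<bar>"] by (intro mult_right_mono) (auto simp: power2_sum)
  finally show ?thesis .
qed

lemma coefN_zero_mean: "0 < N \<Longrightarrow> coefN N v 0 = 0 \<longleftrightarrow> (\<Sum>i=1..N. v i) = 0"
  by (simp add: coefN_def inner_l2N_def phiN_def phi_def hN_def flip: sum_divide_distrib)

text \<open>The mean-zero grid function need not vanish at a grid point; comparing differences of
  \<open>v\<close> with differences of the signed square \<open>v \<bar>v\<bar>\<close> avoids looking for a zero. This quartic lower
  bound is what beats the terms \<open>G * \<parallel>\<nabla>Y\<parallel>\<^sup>2\<close> without any Gronwall factor.\<close>

lemma quartic_poincare: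
  assumes N: "2 \<le> N" and mean: "coefN N v 0 = 0"
  shows "(sobN 0 N v)\<^sup>2 \<le> 128 * (hN N * (\<Sum>i=1..<N. ((v i)\<^sup>2 + (v (Suc i))\<^sup>2) * (diffN N v i)\<^sup>2))"
proof -
  let ?h = "hN N" and ?w = "\<lambda>i. v i * \<bar>v i\<bar>"
  have h: "0 < ?h" using N by (simp add: hN_pos)
  have hn: "?h * real N = pi" using N by (simp add: hN_def)
  define T where "T = (\<Sum>l=1..<N. \<bar>?w (Suc l) - ?w l\<bar>)"
  have s0: "(\<Sum>i=1..N. v i) = 0" using coefN_zero_mean[of N v] mean N by simp
  \<comment> \<open>The mean-zero condition removes the cross term, so the norm is recovered from
    differences over all pairs of points.\<close>
  have "(\<Sum>i=1..N. \<Sum>k=1..N. (v i - v k)\<^sup>2) = 2 * real N * (\<Sum>i=1..N. (v i)\<^sup>2)"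
  proof -
    have "(\<Sum>i=1..N. \<Sum>k=1..N. (v i - v k)\<^sup>2)
        = (\<Sum>i=1..N. (real N * (v i)\<^sup>2 + (\<Sum>k=1..N. (v k)\<^sup>2)) - 2 * v i * (\<Sum>k=1..N. v k))"
      by (intro sum.cong refl) (simp add: power2_diff sum.distrib sum_subtractf sum_distrib_left)
    also have "\<dots> = 2 * real N * (\<Sum>i=1..N. (v i)\<^sup>2)"
      unfolding s0 by (simp add: sum.distrib sum_distrib_left[symmetric])
    finally show ?thesis .
  qed
  moreover have "(\<Sum>i=1..N. \<Sum>k=1..N. (v i - v k)\<^sup>2) \<le> (\<Sum>i=1..N. \<Sum>k=1..N. 2 * T)"
  proof (intro sum_mono)
    fix i k assume ik: "i \<in> {1..N}" "k \<in> {1..N}"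
    have "2 * \<bar>?w i - ?w k\<bar> \<le> 2 * T"
      unfolding T_def using abs_diff_le_variation[OF ik, of ?w] by (rule mult_left_mono) simp
    with square_diff_le_signed_square show "(v i - v k)\<^sup>2 \<le> 2 * T" by (rule order_trans)
  qed
  ultimately have "2 * real N * (\<Sum>i=1..N. (v i)\<^sup>2) \<le> real N * (real N * (2 * T))" by simp
  hence "(\<Sum>i=1..N. (v i)\<^sup>2) \<le> real N * T" using N by simp
  hence "sobN 0 N v \<le> ?h * (real N * T)" unfolding sobN_0 using h by (intro mult_left_mono) auto
  also have "\<dots> = pi * T" using hn by (simp add: mult.assoc[symmetric])
  finally have n0: "sobN 0 N v \<le> pi * T" .
  have T: "T = ?h * (\<Sum>l=1..<N. 1 * \<bar>diffN N ?w l\<bar>)"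
    unfolding T_def sum_distrib_left using h by (intro sum.cong refl) (simp add: diffN_def)
  have "T\<^sup>2 \<le> (?h * (\<Sum>l=1..<N. 1\<^sup>2)) * (?h * (\<Sum>l=1..<N. \<bar>diffN N ?w l\<bar>\<^sup>2))"
    unfolding T using h by (intro weighted_cauchy_schwarz) simp
  also have "\<dots> \<le> pi * (2 * (?h * (\<Sum>i=1..<N. ((v i)\<^sup>2 + (v (Suc i))\<^sup>2) * (diffN N v i)\<^sup>2)))"
  proof (rule mult_mono)
    have "?h * real (N - 1) \<le> ?h * real N" using h by (intro mult_left_mono) auto
    then show "?h * (\<Sum>l=1..<N. 1\<^sup>2) \<le> pi" using hn by simp
    have "(\<Sum>l=1..<N. \<bar>diffN N ?w l\<bar>\<^sup>2) \<le> (\<Sum>i=1..<N. 2 * (((v i)\<^sup>2 + (v (Suc i))\<^sup>2) * (diffN N v i)\<^sup>2))"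
    proof (intro sum_mono)
      fix l
      have "\<bar>diffN N ?w l\<bar>\<^sup>2 = (?w (Suc l) - ?w l)\<^sup>2 / ?h\<^sup>2" by (simp add: diffN_def power_divide)
      also have "\<dots> \<le> (2 * ((v (Suc l))\<^sup>2 + (v l)\<^sup>2) * (v (Suc l) - v l)\<^sup>2) / ?h\<^sup>2"
        by (intro divide_right_mono signed_square_diff) simp
      finally show "\<bar>diffN N ?w l\<bar>\<^sup>2 \<le> 2 * (((v l)\<^sup>2 + (v (Suc l))\<^sup>2) * (diffN N v l)\<^sup>2)"
        by (simp add: diffN_def power_divide algebra_simps)
    qed
    then show "?h * (\<Sum>l=1..<N. \<bar>diffN N ?w l\<bar>\<^sup>2) \<le> 2 * (?h * (\<Sum>i=1..<N. ((v i)\<^sup>2 + (v (Suc i))\<^sup>2) * (diffN N v i)\<^sup>2))"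
      using h by (simp add: sum_distrib_left[symmetric] mult.left_commute)
  qed (use h in \<open>auto intro!: mult_nonneg_nonneg sum_nonneg\<close>)
  finally have T2: "T\<^sup>2 \<le> pi * (2 * (?h * (\<Sum>i=1..<N. ((v i)\<^sup>2 + (v (Suc i))\<^sup>2) * (diffN N v i)\<^sup>2)))" (is "_ \<le> pi * (2 * ?Q)") .
  have Q: "0 \<le> ?Q" using h by (intro mult_nonneg_nonneg sum_nonneg) auto
  have "(sobN 0 N v)\<^sup>2 \<le> (pi * T)\<^sup>2" using n0 by (intro power_mono sobN_nonneg)
  also have "\<dots> = pi\<^sup>2 * T\<^sup>2" by (simp add: power_mult_distrib)
  also have "\<dots> \<le> pi\<^sup>2 * (pi * (2 * ?Q))" using T2 by (intro mult_left_mono) auto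
  also have "\<dots> = 2 * pi ^ 3 * ?Q" by (simp add: power2_eq_square power3_eq_cube)
  \<comment> \<open>The constant is \<open>2 * 4 ^ 3\<close>, from \<open>pi < 4\<close>.\<close>
  also have "\<dots> \<le> 128 * ?Q"
  proof (intro mult_right_mono Q)
    have "pi ^ 3 \<le> 4 ^ 3" using pi_less_4 by (intro power_mono) auto
    then show "2 * pi ^ 3 \<le> 128" by simp
  qed
  finally show ?thesis .
qed

section \<open>Two-sided control of the difference quotients of the cubic\<close>

definition cubic_like :: "(real \<Rightarrow> real) \<Rightarrow> real \<Rightarrow> real \<Rightarrow> bool" where
  "cubic_like f c C \<longleftrightarrow> 0 < c \<and> 0 \<le> C \<and> (\<forall>x y. \<exists>g. f y - f x = g * (y - x) \<and>
      c * (1 + x\<^sup>2 + y\<^sup>2) - C \<le> g \<and> \<bar>g\<bar> \<le> C * (1 + x\<^sup>2 + y\<^sup>2))"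

text \<open>The difference quotient \<open>g\<close> is coercive from below, for dissipation, and of
  quadratic growth from above, for the error terms. Its existential form also covers
  \<open>x = y\<close> without division.\<close>

lemma cubic_like_poly:
  fixes a0 a1 a2 a3 :: real
  assumes "a0 > 0"
  shows "\<exists>c C. cubic_like (\<lambda>x. a0 * x ^ 3 + a1 * x\<^sup>2 + a2 * x + a3) c C"
proof -
  \<comment> \<open>The form \<open>x\<^sup>2 + x * y + y\<^sup>2\<close> dominates half of
    \<open>x\<^sup>2 + y\<^sup>2\<close>, which gives \<open>a0 / 2\<close>. Half of this absorbs
    \<open>a1 * (x + y)\<close> by completing the square, at the cost of
    \<open>2 * a1\<^sup>2 / a0\<close> in \<open>C\<close>.\<close>
  define c where "c = a0 / 4"
  define C where "C = 2 * a0 + \<bar>a1\<bar> + \<bar>a2\<bar> + 2 * a1\<^sup>2 / a0"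
  have c: "0 < c" using assms by (simp add: c_def)
  have q: "0 \<le> a1\<^sup>2 / a0" using assms by simp
  have "\<exists>g. (a0 * y ^ 3 + a1 * y\<^sup>2 + a2 * y + a3) - (a0 * x ^ 3 + a1 * x\<^sup>2 + a2 * x + a3) = g * (y - x) \<and>
      c * (1 + x\<^sup>2 + y\<^sup>2) - C \<le> g \<and> \<bar>g\<bar> \<le> C * (1 + x\<^sup>2 + y\<^sup>2)" for x y :: real
  proof (intro exI conjI)
    let ?g = "a0 * (x\<^sup>2 + x * y + y\<^sup>2) + a1 * (x + y) + a2"
    have ab: "\<bar>x * y\<bar> \<le> (x\<^sup>2 + y\<^sup>2) / 2"
      using sum_squares_bound[of "\<bar>x\<bar>" "\<bar>y\<bar>"] by (simp add: abs_mult)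
    have xy: "(x + y)\<^sup>2 \<le> 2 * (x\<^sup>2 + y\<^sup>2)" using sum_squares_bound[of x y] by (simp add: power2_sum)
    show "(a0 * y ^ 3 + a1 * y\<^sup>2 + a2 * y + a3) - (a0 * x ^ 3 + a1 * x\<^sup>2 + a2 * x + a3) = ?g * (y - x)"
      by (simp add: power2_eq_square power3_eq_cube algebra_simps)
    have "a0 * ((x\<^sup>2 + y\<^sup>2) / 2) \<le> a0 * (x\<^sup>2 + x * y + y\<^sup>2)"
      using ab assms by (intro mult_left_mono) (auto simp: abs_le_iff field_simps)
    moreover have "- (a0 / 4 * (x\<^sup>2 + y\<^sup>2)) - 2 * a1\<^sup>2 / a0 \<le> a1 * (x + y)"
    proof -
      have "0 \<le> a0 / 8 * ((x + y) + 4 * a1 / a0)\<^sup>2" using assms by simp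
      also have "\<dots> = a0 / 8 * (x + y)\<^sup>2 + a1 * (x + y) + 2 * a1\<^sup>2 / a0"
        using assms by (simp add: power2_eq_square field_simps)
      finally have "0 \<le> a0 / 8 * (x + y)\<^sup>2 + a1 * (x + y) + 2 * a1\<^sup>2 / a0" .
      moreover have "a0 / 8 * (x + y)\<^sup>2 \<le> a0 / 8 * (2 * (x\<^sup>2 + y\<^sup>2))"
        using xy assms by (intro mult_left_mono) auto
      ultimately show ?thesis by linarith
    qed
    ultimately show "c * (1 + x\<^sup>2 + y\<^sup>2) - C \<le> ?g"
      using assms by (simp add: c_def C_def algebra_simps) 
    have "\<bar>a0 * (x\<^sup>2 + x * y + y\<^sup>2)\<bar> \<le> a0 * (2 * (x\<^sup>2 + y\<^sup>2))"
    proof -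
      have "\<bar>x\<^sup>2 + x * y + y\<^sup>2\<bar> \<le> 2 * (x\<^sup>2 + y\<^sup>2)"
        using ab zero_le_power2[of x] zero_le_power2[of y] unfolding abs_le_iff by (simp add: field_simps)
      with assms show ?thesis by (simp add: abs_mult)
    qed
    moreover have "\<bar>a1 * (x + y)\<bar> \<le> \<bar>a1\<bar> * (1 + x\<^sup>2 + y\<^sup>2)"
    proof -
      have "0 \<le> (\<bar>x\<bar> - 1/2)\<^sup>2 + (\<bar>y\<bar> - 1/2)\<^sup>2" by simp
      hence "\<bar>x + y\<bar> \<le> 1 + x\<^sup>2 + y\<^sup>2" by (simp add: power2_diff power_divide)
      then show ?thesis by (simp add: abs_mult mult_left_mono)
    qed
    moreover have "\<bar>a2\<bar> \<le> \<bar>a2\<bar> * (1 + x\<^sup>2 + y\<^sup>2)" by (simp add: algebra_simps)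
    ultimately have "\<bar>?g\<bar> \<le> a0 * (2 * (x\<^sup>2 + y\<^sup>2)) + \<bar>a1\<bar> * (1 + x\<^sup>2 + y\<^sup>2) + \<bar>a2\<bar> * (1 + x\<^sup>2 + y\<^sup>2)"
      by (intro order_trans[OF abs_triangle_ineq] add_mono)
    also have "\<dots> \<le> (2 * a0) * (1 + x\<^sup>2 + y\<^sup>2) + \<bar>a1\<bar> * (1 + x\<^sup>2 + y\<^sup>2) + \<bar>a2\<bar> * (1 + x\<^sup>2 + y\<^sup>2)
        + 2 * (a1\<^sup>2 / a0) * (1 + x\<^sup>2 + y\<^sup>2)"
    proof -
      have "0 \<le> 2 * (a1\<^sup>2 / a0) * (1 + x\<^sup>2 + y\<^sup>2)" using q by (intro mult_nonneg_nonneg) auto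
      moreover have "a0 * (2 * (x\<^sup>2 + y\<^sup>2)) \<le> (2 * a0) * (1 + x\<^sup>2 + y\<^sup>2)" using assms by (simp add: algebra_simps)
      ultimately show ?thesis by linarith
    qed
    also have "\<dots> = C * (1 + x\<^sup>2 + y\<^sup>2)"
      unfolding C_def by (simp only: distrib_right times_divide_eq_right)
    finally show "\<bar>?g\<bar> \<le> C * (1 + x\<^sup>2 + y\<^sup>2)" .
  qed
  moreover have "0 \<le> C" using q assms by (simp add: C_def)
  ultimately show ?thesis using c unfolding cubic_like_def by blast
qed

section \<open>One step of the drift recursion\<close>

text \<open>Parabolic smoothing, used with \<open>x = sqrt \<tau> * l\<close>: one semigroup factor
  pays for one power of \<open>sqrt \<tau> * l\<close>.\<close>

lemma exp_smoothing_sq: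
  assumes "0 \<le> (x::real)" shows "x * exp (- x\<^sup>2) \<le> 1"
proof -
  have "x \<le> 1 + x\<^sup>2" using sum_squares_bound[of x 1] assms by simp
  also have "\<dots> \<le> exp (x\<^sup>2)" by (rule exp_ge_add_one_self)
  finally show ?thesis by (simp add: exp_minus field_simps)
qed

text \<open>With \<open>x = sqrt \<tau> * l\<close> this is the squared error of replacing the
  semigroup factor by 1. Keeping only the first power of \<open>x\<close> costs a single eigenvalue,
  hence only the gradient of the nonlinearity.\<close>

lemma one_minus_exp_sq_le:
  assumes "0 \<le> (x::real)" shows "(1 - exp (- x\<^sup>2))\<^sup>2 \<le> x"
proof -
  let ?d = "1 - exp (- x\<^sup>2)"
  have d: "0 \<le> ?d" "?d \<le> 1" "?d \<le> x\<^sup>2"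
    using exp_ge_add_one_self[of "- x\<^sup>2"] by auto
  show ?thesis
  proof (cases "x \<le> 1")
    case True
    have "?d\<^sup>2 \<le> x\<^sup>2 * 1" unfolding power2_eq_square[of ?d] using d by (intro mult_mono) auto
    also have "\<dots> \<le> x" using True assms mult_left_mono[of x 1 x] by (simp add: power2_eq_square)
    finally show ?thesis .
  next
    case False
    then show ?thesis using d power_le_one[of ?d 2] by linarith
  qed
qed

text \<open>One of the two exponentials absorbs \<open>1 + \<tau> * l\<^sup>2\<close>. The new value
  thereby also controls a higher norm with weight \<open>\<tau>\<close>, as in an implicit Euler
  step.\<close>

lemma exp_sq_decay:
  fixes l \<tau> :: real
  assumes "0 \<le> \<tau>"
  shows "(1 + \<tau> * l\<^sup>2) * (exp (- \<tau> * l\<^sup>2))\<^sup>2 \<le> exp (- \<tau> * l\<^sup>2)"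
proof -
  have "(1 + \<tau> * l\<^sup>2) * (exp (- \<tau> * l\<^sup>2) * exp (- \<tau> * l\<^sup>2)) \<le> exp (\<tau> * l\<^sup>2) * (exp (- \<tau> * l\<^sup>2) * exp (- \<tau> * l\<^sup>2))"
    by (intro mult_right_mono exp_ge_add_one_self) auto
  also have "\<dots> = exp (- \<tau> * l\<^sup>2)" by (simp flip: exp_add)
  finally show ?thesis by (simp add: power2_eq_square)
qed

lemma young_quarter: "2 * a * b \<le> a\<^sup>2 / 4 + 4 * b\<^sup>2" for a b :: real
proof -
  have "0 \<le> (a / 2 - 2 * b)\<^sup>2" by simp
  then show ?thesis by (simp add: power2_eq_square algebra_simps)
qed

text \<open>The contribution \<open>5 * \<tau> * sqrt \<tau> * (l * g\<^sup>2)\<close> carries exactly the half power of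
  \<open>\<tau>\<close> that the taming with exponent 12 can compensate.\<close>

lemma mode_step_l2:
  fixes l \<tau> y g :: real
  assumes l: "0 \<le> l" and \<tau>: "0 < \<tau>"
  shows "exp (- \<tau> * l\<^sup>2) * (y - \<tau> * l * g)\<^sup>2
      \<le> y\<^sup>2 - 2 * \<tau> * (l * y * g) + \<tau> * (l\<^sup>2 * y\<^sup>2) / 4 + 5 * \<tau> * sqrt \<tau> * (l * g\<^sup>2)"
proof -
  define e where "e = exp (- \<tau> * l\<^sup>2)"
  define s where "s = sqrt \<tau>"
  have s: "0 \<le> s" "s * s = \<tau>" using \<tau> by (auto simp: s_def)
  have ee: "e = exp (- (s * l)\<^sup>2)" unfolding e_def s_def using \<tau> by (simp add: power_mult_distrib)
  have e1: "0 < e" "e \<le> 1" using \<tau> by (auto simp: e_def)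
  have 1: "s * l * e \<le> 1" unfolding ee using exp_smoothing_sq[of "s * l"] s l by simp
  have 2: "(1 - e)\<^sup>2 \<le> s * l" unfolding ee using one_minus_exp_sq_le[of "s * l"] s l by simp
  \<comment> \<open>Writing \<open>e = 1 - (1 - e)\<close> in the cross term isolates the exact
    dissipative term from a commutation error. Young's inequality contributes 4 to the final factor
    5, the smoothed quadratic term contributes 1.\<close>
  have "e * (y - \<tau> * l * g)\<^sup>2 = e * y\<^sup>2 - 2 * \<tau> * (l * y * g) + \<tau> * (2 * (l * y) * ((1 - e) * g)) + \<tau> * s * (l * g\<^sup>2) * (s * l * e)"
    unfolding s(2)[symmetric] by (simp add: power2_eq_square algebra_simps)
  also have "\<dots> \<le> y\<^sup>2 - 2 * \<tau> * (l * y * g) + \<tau> * ((l * y)\<^sup>2 / 4 + 4 * ((1 - e)\<^sup>2 * g\<^sup>2)) + \<tau> * s * (l * g\<^sup>2) * 1"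
  proof (intro add_mono diff_mono order_refl)
    show "e * y\<^sup>2 \<le> y\<^sup>2" using e1 by (intro mult_left_le_one_le) auto
    show "\<tau> * (2 * (l * y) * ((1 - e) * g)) \<le> \<tau> * ((l * y)\<^sup>2 / 4 + 4 * ((1 - e)\<^sup>2 * g\<^sup>2))"
      using \<tau> young_quarter[of "l * y" "(1 - e) * g"] by (simp add: power_mult_distrib)
    show "\<tau> * s * (l * g\<^sup>2) * (s * l * e) \<le> \<tau> * s * (l * g\<^sup>2) * 1"
      using 1 \<tau> s l by (intro mult_left_mono) auto
  qed
  also have "\<dots> \<le> y\<^sup>2 - 2 * \<tau> * (l * y * g) + \<tau> * ((l * y)\<^sup>2 / 4 + 4 * ((s * l) * g\<^sup>2)) + \<tau> * s * (l * g\<^sup>2) * 1"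
    using 2 \<tau> by (intro add_mono diff_mono mult_left_mono mult_right_mono order_refl) auto
  finally show ?thesis unfolding e_def s_def by (simp add: power_mult_distrib algebra_simps)
qed

text \<open>Here the sign of the cross term is not exploited: Young's inequality moves it into a
  quarter of \<open>\<tau> * l ^ 3 * y\<^sup>2\<close>, and
  \<open>\<tau> * l\<^sup>2 * e \<le> 1\<close> handles the quadratic term.\<close>

lemma mode_step_h1:
  fixes l \<tau> y g :: real
  assumes l: "0 \<le> l" and \<tau>: "0 < \<tau>"
  shows "l * (exp (- \<tau> * l\<^sup>2) * (y - \<tau> * l * g)\<^sup>2)
      \<le> l * y\<^sup>2 + \<tau> * (l ^ 3 * y\<^sup>2) / 4 + 5 * \<tau> * (l * g\<^sup>2)"
proof -
  define e where "e = exp (- \<tau> * l\<^sup>2)"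
  have e1: "0 < e" "e \<le> 1" using \<tau> by (auto simp: e_def)
  have 1: "\<tau> * l\<^sup>2 * e \<le> 1"
  proof -
    have "\<tau> * l\<^sup>2 \<le> exp (\<tau> * l\<^sup>2)" using exp_ge_add_one_self[of "\<tau> * l\<^sup>2"] by linarith
    then show ?thesis unfolding e_def by (simp add: exp_minus field_simps)
  qed
  have y: "2 * (l * y) * (- e * g) \<le> (l * y)\<^sup>2 / 4 + 4 * g\<^sup>2"
  proof -
    have "(- e * g)\<^sup>2 \<le> g\<^sup>2" using e1 by (simp add: power_mult_distrib mult_left_le_one_le power_le_one)
    with young_quarter[of "l * y" "- e * g"] show ?thesis by linarith
  qed
  have "l * (e * (y - \<tau> * l * g)\<^sup>2) = e * (l * y\<^sup>2) + \<tau> * (l * (2 * (l * y) * (- e * g))) + \<tau> * (l * g\<^sup>2) * (\<tau> * l\<^sup>2 * e)"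
    by (simp add: power2_eq_square algebra_simps)
  also have "\<dots> \<le> l * y\<^sup>2 + \<tau> * (l * ((l * y)\<^sup>2 / 4 + 4 * g\<^sup>2)) + \<tau> * (l * g\<^sup>2) * 1"
  proof (intro add_mono)
    show "e * (l * y\<^sup>2) \<le> l * y\<^sup>2" using e1 l by (intro mult_left_le_one_le) auto
    show "\<tau> * (l * (2 * (l * y) * (- e * g))) \<le> \<tau> * (l * ((l * y)\<^sup>2 / 4 + 4 * g\<^sup>2))"
      using \<tau> l y by (intro mult_left_mono) auto
    show "\<tau> * (l * g\<^sup>2) * (\<tau> * l\<^sup>2 * e) \<le> \<tau> * (l * g\<^sup>2) * 1"
      using 1 \<tau> l by (intro mult_left_mono) auto
  qed
  finally show ?thesis unfolding e_def by (simp add: power_mult_distrib power2_eq_square power3_eq_cube algebra_simps)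
qed

text \<open>A relation between coefficients, so that it applies to \<open>Y = U - Z\<close> whatever
  the values of these vectors outside the grid indices.\<close>

definition drift_step :: "real \<Rightarrow> nat \<Rightarrow> (nat \<Rightarrow> real) \<Rightarrow> (nat \<Rightarrow> real) \<Rightarrow> (nat \<Rightarrow> real) \<Rightarrow> bool" where
  "drift_step \<tau> N Y F Y' \<longleftrightarrow>
     (\<forall>j<N. coefN N Y' j = exp (- \<tau> * (lamN N j)\<^sup>2) * (coefN N Y j - \<tau> * lamN N j * coefN N F j))"

lemma mode_square:
  assumes "drift_step \<tau> N Y F Y'" "j < N" "0 < \<tau>"
  shows "(1 + \<tau> * (lamN N j)\<^sup>2) * (coefN N Y' j)\<^sup>2
     \<le> exp (- \<tau> * (lamN N j)\<^sup>2) * (coefN N Y j - \<tau> * lamN N j * coefN N F j)\<^sup>2"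
proof -
  let ?e = "exp (- \<tau> * (lamN N j)\<^sup>2)" and ?z = "coefN N Y j - \<tau> * lamN N j * coefN N F j"
  have "(1 + \<tau> * (lamN N j)\<^sup>2) * (coefN N Y' j)\<^sup>2 = ((1 + \<tau> * (lamN N j)\<^sup>2) * ?e\<^sup>2) * ?z\<^sup>2"
    using assms by (simp add: drift_step_def power_mult_distrib)
  also have "\<dots> \<le> ?e * ?z\<^sup>2" using assms by (intro mult_right_mono exp_sq_decay) auto
  finally show ?thesis .
qed

lemma drift_step_l2:
  assumes st: "drift_step \<tau> N Y F Y'" and \<tau>: "0 < \<tau>"
  shows "sobN 0 N Y' + \<tau> * sobN 2 N Y' \<le> sobN 0 N Y - 2 * \<tau> * (\<Sum>j<N. lamN N j * coefN N Y j * coefN N F j)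
     + \<tau> * sobN 2 N Y / 4 + 5 * \<tau> * sqrt \<tau> * sobN 1 N F"
proof -
  have "sobN 0 N Y' + \<tau> * sobN 2 N Y' = (\<Sum>j<N. (1 + \<tau> * (lamN N j)\<^sup>2) * (coefN N Y' j)\<^sup>2)"
    by (simp add: sobN_def sum_distrib_left sum.distrib[symmetric] algebra_simps)
  also have "\<dots> \<le> (\<Sum>j<N. (coefN N Y j)\<^sup>2 - 2 * \<tau> * (lamN N j * coefN N Y j * coefN N F j)
      + \<tau> * ((lamN N j)\<^sup>2 * (coefN N Y j)\<^sup>2) / 4 + 5 * \<tau> * sqrt \<tau> * (lamN N j * (coefN N F j)\<^sup>2))"
    by (intro sum_mono order_trans[OF mode_square[OF st _ \<tau>] mode_step_l2[OF lamN_nonneg \<tau>]]) simp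
  also have "\<dots> = sobN 0 N Y - 2 * \<tau> * (\<Sum>j<N. lamN N j * coefN N Y j * coefN N F j)
     + \<tau> * sobN 2 N Y / 4 + 5 * \<tau> * sqrt \<tau> * sobN 1 N F"
    by (simp add: sobN_def sum_distrib_left sum.distrib sum_subtractf sum_divide_distrib)
  finally show ?thesis .
qed

lemma drift_step_h1:
  assumes st: "drift_step \<tau> N Y F Y'" and \<tau>: "0 < \<tau>"
  shows "sobN 1 N Y' + \<tau> * sobN 3 N Y' \<le> sobN 1 N Y + \<tau> * sobN 3 N Y / 4 + 5 * \<tau> * sobN 1 N F"
proof -
  have "sobN 1 N Y' + \<tau> * sobN 3 N Y' = (\<Sum>j<N. lamN N j * ((1 + \<tau> * (lamN N j)\<^sup>2) * (coefN N Y' j)\<^sup>2))"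
    by (simp add: sobN_def sum_distrib_left sum.distrib[symmetric] algebra_simps power2_eq_square power3_eq_cube)
  also have "\<dots> \<le> (\<Sum>j<N. lamN N j * (coefN N Y j)\<^sup>2 + \<tau> * (lamN N j ^ 3 * (coefN N Y j)\<^sup>2) / 4 + 5 * \<tau> * (lamN N j * (coefN N F j)\<^sup>2))"
  proof (rule sum_mono)
    fix j assume "j \<in> {..<N}"
    hence "lamN N j * ((1 + \<tau> * (lamN N j)\<^sup>2) * (coefN N Y' j)\<^sup>2)
       \<le> lamN N j * (exp (- \<tau> * (lamN N j)\<^sup>2) * (coefN N Y j - \<tau> * lamN N j * coefN N F j)\<^sup>2)"
      using mode_square[OF st _ \<tau>] by (intro mult_left_mono) (auto simp: lamN_nonneg)
    also note mode_step_h1[OF lamN_nonneg \<tau>]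
    finally show "lamN N j * ((1 + \<tau> * (lamN N j)\<^sup>2) * (coefN N Y' j)\<^sup>2)
       \<le> lamN N j * (coefN N Y j)\<^sup>2 + \<tau> * (lamN N j ^ 3 * (coefN N Y j)\<^sup>2) / 4 + 5 * \<tau> * (lamN N j * (coefN N F j)\<^sup>2)" .
  qed
  also have "\<dots> = sobN 1 N Y + \<tau> * sobN 3 N Y / 4 + 5 * \<tau> * sobN 1 N F"
    by (simp add: sobN_def sum_distrib_left sum.distrib sum_divide_distrib)
  finally show ?thesis .
qed

section \<open>Gradient bound and dissipation of the cubic\<close>

lemma cubic_grad_bound:
  assumes f: "cubic_like f c C" and N: "2 \<le> N" and B: "\<And>i. i \<in> {1..N} \<Longrightarrow> (U i)\<^sup>2 \<le> B"
  shows "sobN 1 N (\<lambda>i. f (U i)) \<le> C\<^sup>2 * (1 + 2 * B)\<^sup>2 * sobN 1 N U"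
proof -
  have h: "0 < hN N" using N by (simp add: hN_pos)
  have C: "0 \<le> C" using f by (simp add: cubic_like_def)
  have "(diffN N (\<lambda>i. f (U i)) i)\<^sup>2 \<le> (C * (1 + 2 * B))\<^sup>2 * (diffN N U i)\<^sup>2" if i: "i \<in> {1..<N}" for i
  proof -
    obtain g where g: "f (U (Suc i)) - f (U i) = g * (U (Suc i) - U i)" "\<bar>g\<bar> \<le> C * (1 + (U i)\<^sup>2 + (U (Suc i))\<^sup>2)"
      using f unfolding cubic_like_def by metis
    have "C * (1 + (U i)\<^sup>2 + (U (Suc i))\<^sup>2) \<le> C * (1 + 2 * B)"
      using B[of i] B[of "Suc i"] i C by (intro mult_left_mono) auto
    with g(2) have "\<bar>g\<bar> \<le> C * (1 + 2 * B)" by linarith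
    hence "g\<^sup>2 \<le> (C * (1 + 2 * B))\<^sup>2" by (intro abs_le_square_iff[THEN iffD1]) linarith
    hence "g\<^sup>2 * (diffN N U i)\<^sup>2 \<le> (C * (1 + 2 * B))\<^sup>2 * (diffN N U i)\<^sup>2" by (rule mult_right_mono) simp
    moreover have "diffN N (\<lambda>i. f (U i)) i = g * diffN N U i" by (simp add: diffN_def g(1))
    ultimately show ?thesis by (simp add: power_mult_distrib)
  qed
  hence "(\<Sum>i=1..<N. (diffN N (\<lambda>i. f (U i)) i)\<^sup>2) \<le> (C * (1 + 2 * B))\<^sup>2 * (\<Sum>i=1..<N. (diffN N U i)\<^sup>2)"
    unfolding sum_distrib_left by (rule sum_mono)
  hence "hN N * (\<Sum>i=1..<N. (diffN N (\<lambda>i. f (U i)) i)\<^sup>2) \<le> hN N * ((C * (1 + 2 * B))\<^sup>2 * (\<Sum>i=1..<N. (diffN N U i)\<^sup>2))"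
    using h by (intro mult_left_mono) auto
  then show ?thesis unfolding sobN_1[OF N] by (simp add: power_mult_distrib mult_ac)
qed

text \<open>A single grid edge: \<open>y1\<close>, \<open>y2\<close> and \<open>o1\<close>,
  \<open>o2\<close> are the end values of \<open>Y\<close> and \<open>Z\<close>, while
  \<open>dy\<close> and \<open>d0\<close> are their difference quotients. The lower bound on
  \<open>g\<close> supplies the dissipation and the upper bound controls the cross term
  \<open>g * dy * d0\<close>.\<close>

lemma dissipation_pointwise:
  fixes c C y1 y2 o1 o2 g dy d0 :: real
  assumes c: "0 < c" and C: "0 \<le> C"
    and g1: "c * (1 + (y1 + o1)\<^sup>2 + (y2 + o2)\<^sup>2) - C \<le> g" and g2: "\<bar>g\<bar> \<le> C * (1 + (y1 + o1)\<^sup>2 + (y2 + o2)\<^sup>2)"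
    and R: "o1\<^sup>2 + o2\<^sup>2 \<le> R" and P: "y1\<^sup>2 + y2\<^sup>2 \<le> P"
  shows "c / 4 * ((y1\<^sup>2 + y2\<^sup>2) * dy\<^sup>2) - (c / 2 * R + C) * dy\<^sup>2 - C\<^sup>2 / (2 * c) * (1 + 2 * P + 2 * R) * d0\<^sup>2
     \<le> g * dy * (dy + d0)"
proof -
  define S where "S = 1 + (y1 + o1)\<^sup>2 + (y2 + o2)\<^sup>2"
  have S0: "0 \<le> S" by (simp add: S_def)
  have half: "y\<^sup>2 / 2 - x\<^sup>2 \<le> (y + x)\<^sup>2" for x y :: real
  proof -
    have "0 \<le> (y + 2 * x)\<^sup>2 / 2" by simp
    then show ?thesis by (simp add: power2_eq_square algebra_simps)
  qed
  have dbl: "(y + x)\<^sup>2 \<le> 2 * y\<^sup>2 + 2 * x\<^sup>2" for x y :: real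
    using sum_squares_bound[of y x] by (simp add: power2_sum)
  have S1: "(y1\<^sup>2 + y2\<^sup>2) / 2 - R \<le> S"
    using half[of y1 o1] half[of y2 o2] R unfolding S_def by argo
  have S2: "S \<le> 1 + 2 * P + 2 * R"
    using dbl[of y1 o1] dbl[of y2 o2] R P by (simp add: S_def)
  \<comment> \<open>Young's inequality with the common weight \<open>S\<close>: the factor
    \<open>c / 2\<close> spends half of the coercivity on the cross term and leaves the other
    half.\<close>
  have "C * S * (\<bar>dy\<bar> * \<bar>d0\<bar>) \<le> c / 2 * S * dy\<^sup>2 + C\<^sup>2 / (2 * c) * S * d0\<^sup>2"
  proof -
    have "0 \<le> S / (2 * c) * (c * \<bar>dy\<bar> - C * \<bar>d0\<bar>)\<^sup>2" using c S0 by simp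
    also have "\<dots> = c / 2 * S * dy\<^sup>2 + C\<^sup>2 / (2 * c) * S * d0\<^sup>2 - C * S * (\<bar>dy\<bar> * \<bar>d0\<bar>)"
      using c by (simp add: power2_diff power_mult_distrib field_simps) (simp add: power2_eq_square)
    finally show ?thesis by simp
  qed
  moreover have "\<bar>g * (dy * d0)\<bar> \<le> C * S * (\<bar>dy\<bar> * \<bar>d0\<bar>)"
    using g2 unfolding S_def abs_mult by (intro mult_mono) auto
  hence "- (C * S * (\<bar>dy\<bar> * \<bar>d0\<bar>)) \<le> g * (dy * d0)" unfolding abs_le_iff by linarith
  moreover have "(c * S - C) * dy\<^sup>2 \<le> g * dy\<^sup>2" using g1 by (intro mult_right_mono) (auto simp: S_def)
  ultimately have "c / 2 * S * dy\<^sup>2 - C * dy\<^sup>2 - C\<^sup>2 / (2 * c) * S * d0\<^sup>2 \<le> g * dy\<^sup>2 + g * (dy * d0)"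
    by argo
  moreover have "c / 2 * ((y1\<^sup>2 + y2\<^sup>2) / 2 - R) * dy\<^sup>2 \<le> c / 2 * S * dy\<^sup>2"
    using S1 c by (intro mult_right_mono mult_left_mono) auto
  moreover have "C\<^sup>2 / (2 * c) * S * d0\<^sup>2 \<le> C\<^sup>2 / (2 * c) * (1 + 2 * P + 2 * R) * d0\<^sup>2"
    using S2 c by (intro mult_right_mono mult_left_mono) auto
  ultimately have "c / 2 * ((y1\<^sup>2 + y2\<^sup>2) / 2 - R) * dy\<^sup>2 - C * dy\<^sup>2 - C\<^sup>2 / (2 * c) * (1 + 2 * P + 2 * R) * d0\<^sup>2
     \<le> g * dy\<^sup>2 + g * (dy * d0)" by linarith
  then show ?thesis by (simp add: algebra_simps power2_eq_square)
qed

text \<open>The edge inequality is summed with \<open>R = 4 * G\<close> and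
  \<open>P = 20 * n1\<close>, and \<open>quartic_poincare\<close> turns the weighted gradient sum
  into the square of \<open>sobN 0 N Y\<close>; the constant 512 is \<open>4 * 128\<close>.\<close>

lemma dirichlet_dissipation:
  assumes f: "cubic_like f c C" and N: "2 \<le> N" and U: "U = (\<lambda>i. Y i + Z i)"
    and mean: "coefN N Y 0 = 0" and G: "1 + sobN 0 N Z + sobN 1 N Z \<le> G"
  shows "c / 512 * (sobN 0 N Y)\<^sup>2 - (2 * c + C + 20 * C\<^sup>2 / c) * (G * sobN 1 N Y + G\<^sup>2)
     \<le> (\<Sum>j<N. lamN N j * coefN N Y j * coefN N (\<lambda>i. f (U i)) j)"
proof -
  let ?h = "hN N"
  have h: "0 < ?h" using N by (simp add: hN_pos)
  have c: "0 < c" and C: "0 \<le> C" using f by (auto simp: cubic_like_def)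
  have G1: "1 \<le> G" using G sobN_nonneg[of 0 N Z] sobN_nonneg[of 1 N Z] by linarith
  have Zb: "(Z i)\<^sup>2 \<le> 2 * G" if "i \<in> {1..N}" for i
    using grid_sup_le_w12[OF N that, of Z] G by argo
  define n1 where "n1 = sobN 1 N Y"
  have n10: "0 \<le> n1" by (simp add: n1_def sobN_nonneg)
  \<comment> \<open>The constant is \<open>2 * (4 + 1)\<close>, since mean zero gives
    \<open>sobN 0 N Y \<le> 4 * n1\<close>.\<close>
  have Yb: "(Y i)\<^sup>2 \<le> 10 * n1" if "i \<in> {1..N}" for i
    using grid_sup_le_w12[OF N that, of Y] sobN_poincare[OF mean, of 0] by (simp add: n1_def)
  define a b where "a = c / 2 * (4 * G) + C" and "b = C\<^sup>2 / (2 * c) * (1 + 2 * (20 * n1) + 2 * (4 * G))"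
  have b0: "0 \<le> b" unfolding b_def using c n10 G1 by simp
  have pt: "c / 4 * (((Y i)\<^sup>2 + (Y (Suc i))\<^sup>2) * (diffN N Y i)\<^sup>2) - a * (diffN N Y i)\<^sup>2 - b * (diffN N Z i)\<^sup>2
      \<le> diffN N Y i * diffN N (\<lambda>i. f (U i)) i" if i: "i \<in> {1..<N}" for i
  proof -
    obtain g where g: "f (U (Suc i)) - f (U i) = g * (U (Suc i) - U i)"
      "c * (1 + (U i)\<^sup>2 + (U (Suc i))\<^sup>2) - C \<le> g" "\<bar>g\<bar> \<le> C * (1 + (U i)\<^sup>2 + (U (Suc i))\<^sup>2)"
      using f unfolding cubic_like_def by metis
    have d: "diffN N (\<lambda>i. f (U i)) i = g * (diffN N Y i + diffN N Z i)"
      by (simp add: diffN_def g(1)) (simp add: U add_divide_distrib diff_divide_distrib algebra_simps)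
    have "c / 4 * (((Y i)\<^sup>2 + (Y (Suc i))\<^sup>2) * (diffN N Y i)\<^sup>2) - a * (diffN N Y i)\<^sup>2 - b * (diffN N Z i)\<^sup>2
      \<le> g * diffN N Y i * (diffN N Y i + diffN N Z i)"
      unfolding a_def b_def
    proof (rule dissipation_pointwise[OF c C])
      show "(Z i)\<^sup>2 + (Z (Suc i))\<^sup>2 \<le> 4 * G" using Zb[of i] Zb[of "Suc i"] i by simp
      show "(Y i)\<^sup>2 + (Y (Suc i))\<^sup>2 \<le> 20 * n1" using Yb[of i] Yb[of "Suc i"] i by simp
    qed (use g(2,3) in \<open>simp_all add: U\<close>)
    then show ?thesis unfolding d by (simp add: mult_ac)
  qed
  let ?Q = "?h * (\<Sum>i=1..<N. ((Y i)\<^sup>2 + (Y (Suc i))\<^sup>2) * (diffN N Y i)\<^sup>2)"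
  have "c / 4 * ?Q - a * n1 - b * sobN 1 N Z
    = ?h * (\<Sum>i=1..<N. c / 4 * (((Y i)\<^sup>2 + (Y (Suc i))\<^sup>2) * (diffN N Y i)\<^sup>2) - a * (diffN N Y i)\<^sup>2 - b * (diffN N Z i)\<^sup>2)"
    unfolding n1_def sobN_1[OF N] sum_subtractf sum_distrib_left[symmetric] by (simp add: algebra_simps)
  also have "\<dots> \<le> ?h * (\<Sum>i=1..<N. diffN N Y i * diffN N (\<lambda>i. f (U i)) i)"
    using h pt by (intro mult_left_mono sum_mono) auto
  also have "\<dots> = (\<Sum>j<N. lamN N j * coefN N Y j * coefN N (\<lambda>i. f (U i)) j)" (is "_ = ?D")
    by (simp only: dirichlet_form[OF N])
  finally have 1: "c / 4 * ?Q - a * n1 - b * sobN 1 N Z \<le> ?D" .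
  have "c / 4 * (sobN 0 N Y)\<^sup>2 \<le> c / 4 * (128 * ?Q)"
    using quartic_poincare[OF N mean] c by (intro mult_left_mono) auto
  hence 2: "c / 512 * (sobN 0 N Y)\<^sup>2 \<le> c / 4 * ?Q" by simp
  have "b * sobN 1 N Z \<le> b * G"
    using G sobN_nonneg[of 0 N Z] b0 by (intro mult_left_mono) auto
  also have "\<dots> \<le> C\<^sup>2 / (2 * c) * (9 * G + 40 * n1) * G"
    unfolding b_def using c G1 by (intro mult_right_mono mult_left_mono) auto
  finally have 3: "b * sobN 1 N Z \<le> C\<^sup>2 / c * (9 / 2 * G\<^sup>2 + 20 * (G * n1))"
    using c by (simp add: field_simps power2_eq_square)
  have 4: "a * n1 \<le> (2 * c + C) * (G * n1)"
  proof -
    have "C * n1 \<le> C * (G * n1)" using C n10 G1 mult_right_mono[of 1 G n1] by (intro mult_left_mono) auto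
    then show ?thesis unfolding a_def by (simp add: algebra_simps)
  qed
  define q where "q = C\<^sup>2 / c"
  have q: "0 \<le> q" using c by (simp add: q_def)
  have "q * (9 / 2 * G\<^sup>2 + 20 * (G * n1)) + (2 * c + C) * (G * n1) \<le> (2 * c + C + 20 * q) * (G * n1 + G\<^sup>2)"
  proof -
    have "0 \<le> (2 * c + C + 31 / 2 * q) * G\<^sup>2" using c C q by (intro mult_nonneg_nonneg) auto
    then show ?thesis by (simp add: algebra_simps)
  qed
  with 1 2 3 4 have "c / 512 * (sobN 0 N Y)\<^sup>2 - (2 * c + C + 20 * q) * (G * n1 + G\<^sup>2) \<le> ?D"
    unfolding q_def[symmetric] by linarith
  then show ?thesis unfolding n1_def q_def by simp
qed

section \<open>Taming and the one-step contractions\<close>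

lemma FtildeN_scale: "FtildeN f \<tau> N U = (\<lambda>i. (1 / (1 + \<tau> * norm_w12N N U ^ 12)) * f (U i))"
  by (simp add: FtildeN_def)

lemma sobN_scale: "sobN k N (\<lambda>i. c * v i) = c\<^sup>2 * sobN k N v"
  by (simp add: sobN_def coefN_linear power_mult_distrib sum_distrib_left mult_ac)

text \<open>With \<open>r2\<close> the squared norm, the left side grows like
  \<open>sqrt \<tau> * r2 ^ 3\<close>, whose square is \<open>\<tau> * r2 ^ 6\<close>, exactly the
  taming term of order 12 in the norm.\<close>

lemma taming_bound:
  fixes r2 \<tau> :: real
  assumes r: "0 \<le> r2" and \<tau>: "0 < \<tau>" "\<tau> < 1"
  shows "sqrt \<tau> * ((1 + 4 * r2)\<^sup>2 * r2) \<le> 50 * (1 + \<tau> * r2 ^ 6)"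
proof -
  have s: "0 \<le> sqrt \<tau>" "sqrt \<tau> \<le> 1" using \<tau> by auto
  have "(1 + 4 * r2)\<^sup>2 * r2 \<le> 25 * (1 + r2 ^ 3)"
  proof (cases "r2 \<le> 1")
    case True
    have "(1 + 4 * r2)\<^sup>2 * r2 \<le> 5\<^sup>2 * 1" using True r by (intro mult_mono power_mono) auto
    hence "(1 + 4 * r2)\<^sup>2 * r2 \<le> 25" by simp
    moreover have "0 \<le> r2 ^ 3" using r by (rule zero_le_power)
    ultimately show ?thesis by argo
  next
    case False
    have "(1 + 4 * r2)\<^sup>2 * r2 \<le> (5 * r2)\<^sup>2 * r2" using False by (intro mult_mono power_mono) auto
    also have "\<dots> = 25 * r2 ^ 3" by (simp add: power2_eq_square power3_eq_cube)
    finally show ?thesis by simp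
  qed
  hence "sqrt \<tau> * ((1 + 4 * r2)\<^sup>2 * r2) \<le> sqrt \<tau> * (25 * (1 + r2 ^ 3))" using s by (intro mult_left_mono)
  also have "\<dots> = 25 * sqrt \<tau> + 25 * (sqrt \<tau> * r2 ^ 3)" by (simp add: algebra_simps)
  also have "sqrt \<tau> * r2 ^ 3 \<le> 1 + \<tau> * r2 ^ 6"
  proof -
    have "0 \<le> sqrt \<tau> * r2 ^ 3" using r s by simp
    hence "sqrt \<tau> * r2 ^ 3 \<le> 1 + (sqrt \<tau> * r2 ^ 3)\<^sup>2"
      using sum_squares_bound[of "sqrt \<tau> * r2 ^ 3" 1] by simp
    also have "(sqrt \<tau> * r2 ^ 3)\<^sup>2 = \<tau> * r2 ^ 6" using \<tau> by (simp add: power_mult_distrib power_mult[symmetric])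
    finally show ?thesis .
  qed
  finally have "sqrt \<tau> * ((1 + 4 * r2)\<^sup>2 * r2) \<le> 25 * sqrt \<tau> + 25 * (1 + \<tau> * r2 ^ 6)" by simp
  moreover have "0 \<le> \<tau> * r2 ^ 6" using \<tau> r by simp
  moreover have "25 * sqrt \<tau> \<le> 25" using s by simp
  ultimately show ?thesis unfolding distrib_left by linarith
qed

text \<open>Giving up half of \<open>\<tau> * b\<close> buys a fixed contraction rate, because
  \<open>17 / 64\<close> is at most \<open>1 / 2\<close>. The factor 16 comes from two Poincare
  inequalities.\<close>

lemma contraction_absorb:
  fixes a b \<tau> :: real
  assumes "0 < \<tau>" "\<tau> < 1" "a \<le> 16 * b" "0 \<le> b"
  shows "a + \<tau> * b / 2 \<le> (1 - \<tau> / 64) * (a + \<tau> * b)"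
proof -
  have "\<tau> / 64 * (a + \<tau> * b) \<le> \<tau> / 64 * (17 * b)"
  proof -
    have "\<tau> * b \<le> 1 * b" using assms by (intro mult_right_mono) auto
    with assms show ?thesis by (intro mult_left_mono) auto
  qed
  also have "\<dots> \<le> \<tau> * b / 2" using assms by simp
  finally show ?thesis by argo
qed

text \<open>Interpolation bounds \<open>G * n1\<close> through \<open>sqrt (n0 * n2)\<close>. A
  first Young inequality moves it to \<open>n2 / 4\<close> and a multiple of
  \<open>G\<^sup>2 * n0\<close>; a second one absorbs the latter into the dissipated
  \<open>n0\<^sup>2\<close>, leaving \<open>G ^ 4\<close>.\<close>

lemma drift_absorb:
  fixes n0 n1 n2 G D K c d :: real
  assumes D: "c / 512 * n0\<^sup>2 - K * (G * n1 + G\<^sup>2) \<le> D"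
    and n: "0 \<le> n0" "0 \<le> n1" "0 \<le> n2" "n1\<^sup>2 \<le> n0 * n2" and c: "0 < c" "0 \<le> K" "1 \<le> G" and d: "1 \<le> d"
  shows "- 2 * (D / d) \<le> n2 / 4 + (2 * K + 1024 * K ^ 4 / c) * G ^ 4"
proof -
  let ?R = "n2 / 4 + (2 * K + 1024 * K ^ 4 / c) * G ^ 4"
  have R: "0 \<le> ?R" using n c by simp
  have n1: "n1 \<le> sqrt n0 * sqrt n2"
    using n(4) by (metis real_le_rsqrt real_sqrt_mult)
  have "2 * (K * (G * n1)) \<le> 2 * (K * (G * (sqrt n0 * sqrt n2)))"
    using n1 c by (intro mult_left_mono) auto
  also have "\<dots> = 2 * sqrt n2 * (K * G * sqrt n0)" by (simp add: mult_ac)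
  also have "\<dots> \<le> (sqrt n2)\<^sup>2 / 4 + 4 * (K * G * sqrt n0)\<^sup>2" by (rule young_quarter)
  also have "\<dots> = n2 / 4 + 4 * (K * G)\<^sup>2 * n0" using n by (simp add: power_mult_distrib)
  also have "4 * (K * G)\<^sup>2 * n0 \<le> c / 256 * n0\<^sup>2 + 1024 * K ^ 4 / c * G ^ 4"
  proof -
    have "0 \<le> (c / 16 * n0 - 32 * (K * G)\<^sup>2)\<^sup>2 / c" using c by simp
    also have "\<dots> = c / 256 * n0\<^sup>2 - 4 * (K * G)\<^sup>2 * n0 + 1024 * K ^ 4 / c * G ^ 4"
      using c by (simp add: power2_eq_square power4_eq_xxxx field_simps)
    finally show ?thesis by linarith
  qed
  finally have 1: "2 * (K * (G * n1)) \<le> n2 / 4 + (c / 256 * n0\<^sup>2 + 1024 * K ^ 4 / c * G ^ 4)" by simp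
  have "G\<^sup>2 \<le> G ^ 4" using c by (intro power_increasing) auto
  hence 2: "2 * (K * G\<^sup>2) \<le> 2 * K * G ^ 4" using c mult_left_mono[of "G\<^sup>2" "G ^ 4" "2 * K"] by simp
  have 3: "- 2 * D \<le> ?R"
    using D 1 2 by (simp add: distrib_left distrib_right) 
  \<comment> \<open>The bound \<open>?R\<close> is nonnegative, so division by the taming factor
    \<open>d \<ge> 1\<close> preserves it whatever the sign of \<open>D\<close>.\<close>
  have "- 2 * (D / d) = (- 2 * D) / d" by simp
  also have "\<dots> \<le> ?R / d" using 3 d by (intro divide_right_mono) auto
  also have "\<dots> \<le> ?R" using R d by (simp add: divide_le_eq mult_le_cancel_left1)
  finally show ?thesis .
qed

text \<open>The commutation error and the absorbed products each cost a quarter of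
  \<open>\<tau> * sobN 2 N Y\<close>. The remaining half is what \<open>contraction_absorb\<close>
  converts into decay.\<close>

lemma l2_step:
  assumes f: "cubic_like f c C" and N: "2 \<le> N" and \<tau>: "0 < \<tau>" "\<tau> < 1" and U: "U = (\<lambda>i. Y i + Z i)"
    and mean: "coefN N Y 0 = 0" and G: "1 + sobN 0 N Z + sobN 1 N Z \<le> G"
    and st: "drift_step \<tau> N Y (FtildeN f \<tau> N U) Y'"
    and K: "K = 2 * c + C + 20 * C\<^sup>2 / c"
  shows "sobN 0 N Y' + \<tau> * sobN 2 N Y' \<le> (1 - \<tau> / 64) * (sobN 0 N Y + \<tau> * sobN 2 N Y)
     + \<tau> * ((2 * K + 1024 * K ^ 4 / c + 250 * C\<^sup>2) * G ^ 4)"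
proof -
  let ?d = "1 + \<tau> * norm_w12N N U ^ 12" and ?F = "\<lambda>i. f (U i)"
  define r2 where "r2 = (norm_w12N N U)\<^sup>2"
  have r2: "0 \<le> r2" "r2 = sobN 0 N U + sobN 1 N U" by (simp_all add: r2_def norm_w12N_sobN sobN_nonneg)
  have d: "?d = 1 + \<tau> * r2 ^ 6" by (simp add: r2_def power_mult[symmetric])
  have d1: "1 \<le> ?d" using \<tau> r2 by (simp add: d)
  have c: "0 < c" and C: "0 \<le> C" using f by (auto simp: cubic_like_def)
  have K0: "0 \<le> K" using c C K by simp
  have G1: "1 \<le> G" using G sobN_nonneg[of 0 N Z] sobN_nonneg[of 1 N Z] by linarith
  have D: "(\<Sum>j<N. lamN N j * coefN N Y j * coefN N (FtildeN f \<tau> N U) j) = (\<Sum>j<N. lamN N j * coefN N Y j * coefN N ?F j) / ?d"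
    unfolding FtildeN_scale coefN_linear by (simp add: sum_divide_distrib)
  have b1: "- 2 * ((\<Sum>j<N. lamN N j * coefN N Y j * coefN N ?F j) / ?d)
      \<le> sobN 2 N Y / 4 + (2 * K + 1024 * K ^ 4 / c) * G ^ 4"
  proof (rule drift_absorb[OF _ _ _ _ _ c K0 G1 d1])
    show "c / 512 * (sobN 0 N Y)\<^sup>2 - K * (G * sobN 1 N Y + G\<^sup>2) \<le> (\<Sum>j<N. lamN N j * coefN N Y j * coefN N ?F j)"
      unfolding K by (rule dirichlet_dissipation[OF f N U mean G])
    show "(sobN 1 N Y)\<^sup>2 \<le> sobN 0 N Y * sobN 2 N Y"
      using sobN_interpolation[of 0 N Y] by (simp add: numeral_2_eq_2)
  qed (auto simp: sobN_nonneg)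
  \<comment> \<open>Taming enters here quantitatively: of the two factors \<open>?d\<close> in the
    denominator, one compensates the growth of the cubic and the other is discarded.\<close>
  have b2: "sqrt \<tau> * sobN 1 N (FtildeN f \<tau> N U) \<le> 50 * C\<^sup>2"
  proof -
    have "sobN 1 N ?F \<le> C\<^sup>2 * (1 + 2 * (2 * r2))\<^sup>2 * sobN 1 N U"
      using grid_sup_le_w12[OF N, of _ U] by (intro cubic_grad_bound[OF f N]) (simp add: r2)
    also have "\<dots> \<le> C\<^sup>2 * (1 + 2 * (2 * r2))\<^sup>2 * r2"
      by (intro mult_left_mono) (auto simp: r2 sobN_nonneg)
    finally have 1: "sobN 1 N ?F \<le> C\<^sup>2 * ((1 + 4 * r2)\<^sup>2 * r2)" by simp
    have "sqrt \<tau> * sobN 1 N (FtildeN f \<tau> N U) = sqrt \<tau> * sobN 1 N ?F / ?d\<^sup>2"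
      unfolding FtildeN_scale sobN_scale by (simp add: power_divide)
    also have "\<dots> \<le> sqrt \<tau> * (C\<^sup>2 * ((1 + 4 * r2)\<^sup>2 * r2)) / ?d\<^sup>2"
      using 1 \<tau> by (intro divide_right_mono mult_left_mono) auto
    also have "\<dots> = C\<^sup>2 * (sqrt \<tau> * ((1 + 4 * r2)\<^sup>2 * r2)) / ?d\<^sup>2" by (simp add: mult_ac)
    also have "\<dots> \<le> C\<^sup>2 * (50 * ?d) / ?d\<^sup>2"
      unfolding d using taming_bound[OF r2(1) \<tau>] by (intro divide_right_mono mult_left_mono) auto
    also have "\<dots> = 50 * C\<^sup>2 / ?d" 
    proof -
      have "C\<^sup>2 * (50 * e) / e\<^sup>2 = 50 * C\<^sup>2 / e" if "1 \<le> e" for e :: real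
        using that by (simp add: power2_eq_square)
      then show ?thesis using d1 .
    qed
    also have "\<dots> \<le> 50 * C\<^sup>2" using d1 by (simp add: divide_le_eq mult_le_cancel_left1)
    finally show ?thesis .
  qed
  have "sobN 0 N Y' + \<tau> * sobN 2 N Y' \<le> sobN 0 N Y
     + \<tau> * (- 2 * ((\<Sum>j<N. lamN N j * coefN N Y j * coefN N ?F j) / ?d)) + \<tau> * sobN 2 N Y / 4
     + 5 * \<tau> * (sqrt \<tau> * sobN 1 N (FtildeN f \<tau> N U))"
    using drift_step_l2[OF st \<tau>(1)] unfolding D by (simp add: mult_ac)
  also have "\<dots> \<le> sobN 0 N Y + \<tau> * (sobN 2 N Y / 4 + (2 * K + 1024 * K ^ 4 / c) * G ^ 4) + \<tau> * sobN 2 N Y / 4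
     + 5 * \<tau> * (50 * C\<^sup>2)"
    using \<tau> b1 b2 by (intro add_mono mult_left_mono order_refl) auto
  also have "\<dots> = (sobN 0 N Y + \<tau> * sobN 2 N Y / 2) + \<tau> * ((2 * K + 1024 * K ^ 4 / c) * G ^ 4 + 250 * C\<^sup>2 * 1)"
    by (simp add: algebra_simps)
  also have "\<dots> \<le> (1 - \<tau> / 64) * (sobN 0 N Y + \<tau> * sobN 2 N Y)
      + \<tau> * ((2 * K + 1024 * K ^ 4 / c) * G ^ 4 + 250 * C\<^sup>2 * G ^ 4)"
  proof (intro add_mono contraction_absorb \<tau> mult_left_mono order_refl)
    show "sobN 0 N Y \<le> 16 * sobN 2 N Y"
      using sobN_poincare[OF mean, of 0] sobN_poincare[OF mean, of 1] by (simp add: numeral_2_eq_2)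
  qed (use \<tau> G1 K0 c in \<open>auto simp: sobN_nonneg one_le_power\<close>)
  finally show ?thesis by (simp add: distrib_right)
qed

text \<open>Below the threshold \<open>4 * K * P ^ 3\<close> the quadratic term is a polynomial in
  \<open>P\<close>. Above it, the term is dominated by the cubic power of \<open>n1\<close>, which
  interpolation bounds by \<open>P\<^sup>2 * n3\<close>.\<close>

lemma h1_absorb:
  fixes n0 n1 n3 P K :: real
  assumes "0 \<le> n1" "0 \<le> n3" "n1 ^ 3 \<le> n0\<^sup>2 * n3" "0 \<le> n0" "n0 \<le> P" "1 \<le> P" "0 \<le> K"
  shows "K * P * (n1\<^sup>2 + P\<^sup>2) \<le> n3 / 4 + (16 * K ^ 3 + K) * P ^ 7"
proof -
  have "K * P * n1\<^sup>2 \<le> n3 / 4 + 16 * K ^ 3 * P ^ 7"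
  proof (cases "n1 \<le> 4 * K * P ^ 3")
    case True
    have "K * P * n1\<^sup>2 \<le> K * P * (4 * K * P ^ 3)\<^sup>2" using True assms by (intro mult_left_mono power_mono) auto
    also have "\<dots> = 16 * K ^ 3 * P ^ 7" by (simp add: power2_eq_square power3_eq_cube eval_nat_numeral)
    finally show ?thesis using assms by simp
  next
    case False
    have "4 * K * P ^ 3 * n1\<^sup>2 \<le> n1 * n1\<^sup>2" using False by (intro mult_right_mono) auto
    also have "\<dots> = n1 ^ 3" by (simp add: power2_eq_square power3_eq_cube)
    also have "\<dots> \<le> n0\<^sup>2 * n3" by fact
    also have "\<dots> \<le> P\<^sup>2 * n3" using assms by (intro mult_right_mono power_mono) auto
    finally have "P\<^sup>2 * (4 * (K * P * n1\<^sup>2)) \<le> P\<^sup>2 * n3" by (simp add: power2_eq_square power3_eq_cube mult_ac)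
    hence "4 * (K * P * n1\<^sup>2) \<le> n3" using assms by (simp add: mult_le_cancel_left)
    moreover have "0 \<le> 16 * K ^ 3 * P ^ 7" using assms by simp
    ultimately show ?thesis by linarith
  qed
  moreover have "K * P * P\<^sup>2 \<le> K * P ^ 7"
  proof -
    have "P ^ 3 \<le> P ^ 7" using assms by (intro power_increasing) auto
    then show ?thesis using assms by (simp add: mult.assoc mult_left_mono power2_eq_square power3_eq_cube)
  qed
  ultimately show ?thesis by (simp add: distrib_left distrib_right)
qed

lemma sobN_add: "sobN k N (\<lambda>i. u i + v i) \<le> 2 * sobN k N u + 2 * sobN k N v"
  unfolding sobN_def coefN_linear sum_distrib_left sum.distrib[symmetric]
proof (rule sum_mono)
  fix j
  have "(coefN N u j + coefN N v j)\<^sup>2 \<le> 2 * (coefN N u j)\<^sup>2 + 2 * (coefN N v j)\<^sup>2"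
    using sum_squares_bound[of "coefN N u j" "coefN N v j"] by (simp add: power2_sum)
  hence "lamN N j ^ k * (coefN N u j + coefN N v j)\<^sup>2 \<le> lamN N j ^ k * (2 * (coefN N u j)\<^sup>2 + 2 * (coefN N v j)\<^sup>2)"
    by (intro mult_left_mono) (auto simp: lamN_nonneg)
  then show "lamN N j ^ k * (coefN N u j + coefN N v j)\<^sup>2 \<le> 2 * (lamN N j ^ k * (coefN N u j)\<^sup>2) + 2 * (lamN N j ^ k * (coefN N v j)\<^sup>2)"
    by (simp add: algebra_simps)
qed

text \<open>The mean-zero Agmon bound makes the squared Lipschitz factor of the cubic linear in
  \<open>n1\<close>, so the gradient of the nonlinearity is quadratic in \<open>n1\<close>. This is
  absorbed by \<open>n3\<close> at the price of powers of \<open>P = G + n0\<close>, which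
  \<open>l2_step\<close> already controls.\<close>

lemma h1_step:
  assumes f: "cubic_like f c C" and N: "2 \<le> N" and \<tau>: "0 < \<tau>" "\<tau> < 1" and U: "U = (\<lambda>i. Y i + Z i)"
    and mean: "coefN N Y 0 = 0" and G: "1 + sobN 0 N Z + sobN 1 N Z \<le> G"
    and st: "drift_step \<tau> N Y (FtildeN f \<tau> N U) Y'"
    and K: "K = 10240 * C\<^sup>2"
  shows "sobN 1 N Y' + \<tau> * sobN 3 N Y' \<le> (1 - \<tau> / 64) * (sobN 1 N Y + \<tau> * sobN 3 N Y)
     + \<tau> * ((16 * K ^ 3 + K) * (G + sobN 0 N Y) ^ 7)"
proof -
  let ?d = "1 + \<tau> * norm_w12N N U ^ 12" and ?F = "\<lambda>i. f (U i)"
  define n0 n1 n3 where "n0 = sobN 0 N Y" and "n1 = sobN 1 N Y" and "n3 = sobN 3 N Y"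
  have n: "0 \<le> n0" "0 \<le> n1" "0 \<le> n3" by (simp_all add: n0_def n1_def n3_def sobN_nonneg)
  have d1: "1 \<le> ?d" using \<tau> zero_le_even_power[of 12 "norm_w12N N U"] by simp
  have G1: "1 \<le> G" using G sobN_nonneg[of 0 N Z] sobN_nonneg[of 1 N Z] by linarith
  define P where "P = G + n0"
  have P: "1 \<le> P" "n0 \<le> P" "G \<le> P" using n G1 by (auto simp: P_def)
  \<comment> \<open>The middle norm \<open>sobN 2\<close> is eliminated between two interpolation
    inequalities, and one factor \<open>n1\<close> is cancelled; hence the case distinction.\<close>
  have n13: "n1 ^ 3 \<le> n0\<^sup>2 * n3"
  proof (cases "n1 = 0")
    case False
    let ?n2 = "sobN 2 N Y"
    have 1: "n1\<^sup>2 \<le> n0 * ?n2" using sobN_interpolation[of 0 N Y] by (simp add: n0_def n1_def numeral_2_eq_2)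
    have 2: "?n2\<^sup>2 \<le> n1 * n3" using sobN_interpolation[of 1 N Y] by (simp add: n1_def n3_def numeral_2_eq_2 numeral_3_eq_3)
    have "n1 * n1 ^ 3 = (n1\<^sup>2)\<^sup>2" by (simp add: power2_eq_square power3_eq_cube)
    also have "\<dots> \<le> (n0 * ?n2)\<^sup>2" using 1 by (intro power_mono) auto
    also have "\<dots> \<le> n0\<^sup>2 * (n1 * n3)" unfolding power_mult_distrib using 2 by (intro mult_left_mono) auto
    finally have "n1 * n1 ^ 3 \<le> n1 * (n0\<^sup>2 * n3)" by (simp add: mult_ac)
    then show ?thesis using n False by (simp add: mult_le_cancel_left)
  qed (use n in simp)
  define w where "w = sqrt (n0 * n1)"
  have w: "0 \<le> w" "w\<^sup>2 = n0 * n1" using n by (auto simp: w_def)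
  have Ub: "(U i)\<^sup>2 \<le> 8 * w + 4 * G" if "i \<in> {1..N}" for i
  proof -
    have "(U i)\<^sup>2 \<le> 2 * (Y i)\<^sup>2 + 2 * (Z i)\<^sup>2"
      unfolding U using sum_squares_bound[of "Y i" "Z i"] by (simp add: power2_sum)
    moreover have "(Y i)\<^sup>2 \<le> 4 * w" unfolding w_def n0_def n1_def by (rule grid_sup_mean_zero[OF N that mean])
    moreover have "(Z i)\<^sup>2 \<le> 2 * G" using grid_sup_le_w12[OF N that, of Z] G by argo
    ultimately show ?thesis by linarith
  qed
  have b: "(1 + 2 * (8 * w + 4 * G))\<^sup>2 \<le> 512 * (P * (n1 + P))"
  proof -
    have "(1 + 2 * (8 * w + 4 * G))\<^sup>2 \<le> (16 * w + 9 * G)\<^sup>2" using w G1 by (intro power_mono) auto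
    also have "\<dots> \<le> 2 * (16 * w)\<^sup>2 + 2 * (9 * G)\<^sup>2"
      using sum_squares_bound[of "16 * w" "9 * G"] by (simp add: power2_sum)
    also have "\<dots> = 512 * (n0 * n1) + 162 * G\<^sup>2" by (simp add: power_mult_distrib w(2))
    also have "\<dots> \<le> 512 * (P * n1) + 512 * (P * P)"
    proof -
      have "n0 * n1 \<le> P * n1" using P n by (intro mult_right_mono) auto
      moreover have "G\<^sup>2 \<le> P * P" unfolding power2_eq_square using P G1 by (intro mult_mono) auto
      moreover have "0 \<le> G\<^sup>2" by simp
      ultimately show ?thesis by linarith
    qed
    finally show ?thesis by (simp add: distrib_left)
  qed
  have gU: "sobN 1 N U \<le> 2 * (n1 + P)"
    using sobN_add[of 1 N Y Z] G P sobN_nonneg[of 0 N Z] unfolding U n1_def by argo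
  have "sobN 1 N ?F \<le> C\<^sup>2 * (1 + 2 * (8 * w + 4 * G))\<^sup>2 * sobN 1 N U"
    by (rule cubic_grad_bound[OF f N Ub])
  also have "\<dots> \<le> C\<^sup>2 * (512 * (P * (n1 + P))) * (2 * (n1 + P))"
    using b gU n P by (intro mult_mono mult_left_mono) (auto simp: sobN_nonneg)
  also have "\<dots> = C\<^sup>2 * (1024 * P) * (n1 + P)\<^sup>2" by (simp add: power2_eq_square)
  also have "\<dots> \<le> C\<^sup>2 * (1024 * P) * (2 * (n1\<^sup>2 + P\<^sup>2))"
    using P sum_squares_bound[of n1 P] by (intro mult_left_mono) (auto simp: power2_sum)
  \<comment> \<open>The constant 10240 is \<open>5 * 1024 * 2\<close>: the factor in
    \<open>drift_step_h1\<close>, the product \<open>512 * 2\<close> of the two preceding bounds,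
    and the doubling in the square of \<open>n1 + P\<close>.\<close>
  finally have F1: "5 * sobN 1 N ?F \<le> K * P * (n1\<^sup>2 + P\<^sup>2)" unfolding K by (simp add: algebra_simps)
  have "sobN 1 N (FtildeN f \<tau> N U) = sobN 1 N ?F / ?d\<^sup>2"
    unfolding FtildeN_scale sobN_scale by (simp add: power_divide)
  also have "\<dots> \<le> sobN 1 N ?F"
    using d1 one_le_power[OF d1, of 2] sobN_nonneg[of 1 N ?F] by (simp add: divide_le_eq mult_le_cancel_left1)
  finally have "5 * sobN 1 N (FtildeN f \<tau> N U) \<le> 5 * sobN 1 N ?F" by simp
  also note F1
  also have "K * P * (n1\<^sup>2 + P\<^sup>2) \<le> n3 / 4 + (16 * K ^ 3 + K) * P ^ 7"
    by (rule h1_absorb[OF n(2,3) n13 n(1) P(2,1)]) (simp add: K)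
  finally have F2: "5 * sobN 1 N (FtildeN f \<tau> N U) \<le> n3 / 4 + (16 * K ^ 3 + K) * P ^ 7" .
  have "sobN 1 N Y' + \<tau> * sobN 3 N Y' \<le> n1 + \<tau> * n3 / 4 + \<tau> * (5 * sobN 1 N (FtildeN f \<tau> N U))"
    using drift_step_h1[OF st \<tau>(1)] by (simp add: n1_def n3_def mult_ac)
  also have "\<dots> \<le> n1 + \<tau> * n3 / 4 + \<tau> * (n3 / 4 + (16 * K ^ 3 + K) * P ^ 7)"
    using F2 \<tau> by (intro add_mono mult_left_mono order_refl) auto
  also have "\<dots> = (n1 + \<tau> * n3 / 2) + \<tau> * ((16 * K ^ 3 + K) * P ^ 7)" by (simp add: algebra_simps)
  also have "n1 + \<tau> * n3 / 2 \<le> (1 - \<tau> / 64) * (n1 + \<tau> * n3)"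
  proof (intro contraction_absorb \<tau>)
    show "n1 \<le> 16 * n3" unfolding n1_def n3_def
      using sobN_poincare[OF mean, of 1] sobN_poincare[OF mean, of 2] by (simp add: numeral_2_eq_2 numeral_3_eq_3)
  qed (rule n)
  finally show ?thesis by (simp add: n0_def n1_def n3_def P_def)
qed

section \<open>Moments of the stochastic convolution\<close>

text \<open>Mode \<open>j\<close> of the discrete stochastic convolution, without
  \<open>\<sigma>\<close>. The exponent \<open>m - k\<close> is at least 1 because an increment is
  damped already in the step in which it enters.\<close>

definition noise :: "(nat \<Rightarrow> real \<Rightarrow> 'a \<Rightarrow> real) \<Rightarrow> real \<Rightarrow> nat \<Rightarrow> nat \<Rightarrow> nat \<Rightarrow> 'a \<Rightarrow> real" where
  "noise \<beta> \<tau> N j m \<omega> = (\<Sum>k<m. exp (- \<tau> * (lamN N j)\<^sup>2) ^ (m - k) *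
     (\<beta> j (real (Suc k) * \<tau>) \<omega> - \<beta> j (real k * \<tau>) \<omega>))"

lemma noise_0: "noise \<beta> \<tau> N j 0 \<omega> = 0"
  by (simp add: noise_def)

lemma noise_Suc:
  "noise \<beta> \<tau> N j (Suc m) \<omega> = exp (- \<tau> * (lamN N j)\<^sup>2) *
     (noise \<beta> \<tau> N j m \<omega> + (\<beta> j (real (Suc m) * \<tau>) \<omega> - \<beta> j (real m * \<tau>) \<omega>))"
proof -
  let ?e = "exp (- \<tau> * (lamN N j)\<^sup>2)" and ?d = "\<lambda>k. \<beta> j (real (Suc k) * \<tau>) \<omega> - \<beta> j (real k * \<tau>) \<omega>"
  have "(\<Sum>k<m. ?e ^ (Suc m - k) * ?d k) = (\<Sum>k<m. ?e * (?e ^ (m - k) * ?d k))"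
    by (intro sum.cong refl) (simp add: Suc_diff_le del: of_nat_Suc)
  then show ?thesis
    unfolding noise_def by (simp add: sum_distrib_left distrib_left del: of_nat_Suc)
qed

lemma noise_measurable:
  assumes "indep_std_BMs M \<beta>" "0 < \<tau>" "1 \<le> j"
  shows "noise \<beta> \<tau> N j m \<in> borel_measurable M"
proof -
  have [measurable]: "\<beta> j (real k * \<tau>) \<in> borel_measurable M" for k
    using assms by (simp add: indep_std_BMs_def)
  show ?thesis unfolding noise_def[abs_def] by measurable
qed

text \<open>The variance obeys \<open>V' = e\<^sup>2 * (V + \<tau>)\<close>. By
  \<open>exp_sq_decay\<close> the bound 1 on \<open>l\<^sup>2 * V\<close> reproduces itself,
  uniformly in the step size and the number of steps.\<close>

lemma noise_variance:
  fixes l \<tau> :: real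
  assumes "0 < \<tau>"
  shows "l\<^sup>2 * (\<Sum>k<m. (exp (- \<tau> * l\<^sup>2) ^ (m - k) * sqrt \<tau>)\<^sup>2) \<le> 1"
proof (induction m)
  case (Suc m)
  let ?e = "exp (- \<tau> * l\<^sup>2)"
  let ?V = "\<lambda>m. \<Sum>k<m. (?e ^ (m - k) * sqrt \<tau>)\<^sup>2"
  have "(\<Sum>k<m. (?e ^ (Suc m - k) * sqrt \<tau>)\<^sup>2) = (\<Sum>k<m. ?e\<^sup>2 * (?e ^ (m - k) * sqrt \<tau>)\<^sup>2)"
    by (intro sum.cong refl) (simp only: Suc_diff_le less_imp_le lessThan_iff power_Suc power_mult_distrib mult.assoc)
  hence "?V (Suc m) = ?e\<^sup>2 * (?V m + \<tau>)"
    using assms by (simp add: sum_distrib_left distrib_left power_mult_distrib)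
  hence "l\<^sup>2 * ?V (Suc m) = ?e\<^sup>2 * (l\<^sup>2 * ?V m + \<tau> * l\<^sup>2)" by (simp add: algebra_simps)
  also have "\<dots> \<le> ?e\<^sup>2 * (1 + \<tau> * l\<^sup>2)" using Suc.IH by (intro mult_left_mono add_right_mono) auto
  also have "\<dots> \<le> ?e" using exp_sq_decay[of \<tau> l] assms by (simp add: mult.commute)
  also have "\<dots> \<le> 1" using assms by simp
  finally show ?case .
qed simp

text \<open>A weighted sum of independent Gaussian increments of one Brownian motion. For
  \<open>m > 0\<close> the variance is positive, so a density exists.\<close>

lemma noise_distributed:
  assumes BM: "indep_std_BMs M \<beta>" and \<tau>: "0 < \<tau>" and j: "1 \<le> j" and m: "0 < m"
  shows "distributed M lborel (noise \<beta> \<tau> N j m)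
     (normal_density 0 (sqrt (\<Sum>k<m. (exp (- \<tau> * (lamN N j)\<^sup>2) ^ (m - k) * sqrt \<tau>)\<^sup>2)))"
proof -
  interpret prob_space M using BM by (simp add: indep_std_BMs_def)
  let ?e = "exp (- \<tau> * (lamN N j)\<^sup>2)"
  let ?s = "\<lambda>i. real i * \<tau>"
  let ?X = "\<lambda>(j, i) \<omega>. \<beta> j (?s (Suc i)) \<omega> - \<beta> j (?s i) \<omega>"
  let ?I = "{j} \<times> {..<m}"
  \<comment> \<open>The increment clause is instantiated with the single mode \<open>j\<close> and
    the time grid \<open>?s\<close>.\<close>
  have BM': "indep_vars (\<lambda>_. borel) ?X ?I \<and>
      (\<forall>j\<in>{j}. \<forall>i<m. distributed M lborel (\<lambda>\<omega>. \<beta> j (?s (Suc i)) \<omega> - \<beta> j (?s i) \<omega>)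
             (\<lambda>x. ennreal (normal_density 0 (sqrt (?s (Suc i) - ?s i)) x)))"
    using BM[unfolded indep_std_BMs_def, THEN conjunct2, THEN conjunct2, THEN conjunct2, THEN conjunct2,
        rule_format, of "{j}" ?s m] \<tau> j by auto
  have "indep_vars (\<lambda>_. borel) (\<lambda>p \<omega>. (\<lambda>x. ?e ^ (m - snd p) * x) (?X p \<omega>)) ?I"
    by (rule indep_vars_compose2[OF conjunct1[OF BM']]) simp
  moreover have "distributed M lborel (\<lambda>\<omega>. ?e ^ (m - snd p) * ?X p \<omega>) (normal_density 0 (?e ^ (m - snd p) * sqrt \<tau>))"
    if pI: "p \<in> ?I" for p
  proof -
    obtain i where p: "p = (j, i)" "i < m" using pI by auto
    have "distributed M lborel (\<lambda>\<omega>. \<beta> j (?s (Suc i)) \<omega> - \<beta> j (?s i) \<omega>) (normal_density 0 (sqrt \<tau>))"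
      using conjunct2[OF BM'] p by (simp add: distrib_right)
    from normal_density_affine[OF this, of "?e ^ (m - i)" 0] \<tau> show ?thesis by (simp add: p)
  qed
  ultimately have "distributed M lborel (\<lambda>\<omega>. \<Sum>p\<in>?I. ?e ^ (m - snd p) * ?X p \<omega>)
      (normal_density (\<Sum>p\<in>?I. 0) (sqrt (\<Sum>p\<in>?I. (?e ^ (m - snd p) * sqrt \<tau>)\<^sup>2)))"
    using \<tau> m by (intro sum_indep_normal) auto
  moreover have "(\<Sum>p\<in>?I. h p) = (\<Sum>k<m. h (j, k))" for h :: "nat \<times> nat \<Rightarrow> real"
    by (simp add: sum.cartesian_product')
  ultimately show ?thesis by (simp add: noise_def[abs_def])
qed

text \<open>After scaling by the eigenvalue the mode is Gaussian with variance at most 1, and its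
  even moments are at most \<open>fact (2 * q) / (2 ^ q * fact q)\<close>. The degenerate time
  \<open>m = 0\<close> is treated separately.\<close>

lemma noise_moment:
  assumes BM: "indep_std_BMs M \<beta>" and \<tau>: "0 < \<tau>" and j: "1 \<le> j"
  shows "(\<integral>\<^sup>+ \<omega>. ennreal ((lamN N j * noise \<beta> \<tau> N j m \<omega>) ^ (2 * q)) \<partial>M) \<le> ennreal (fact (2 * q))"
proof -
  interpret prob_space M using BM by (simp add: indep_std_BMs_def)
  let ?l = "lamN N j"
  show ?thesis
  proof (cases "m = 0")
    case True
    have "(\<integral>\<^sup>+ \<omega>. ennreal ((?l * noise \<beta> \<tau> N j m \<omega>) ^ (2 * q)) \<partial>M) \<le> (\<integral>\<^sup>+ \<omega>. 1 \<partial>M)"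
      by (rule nn_integral_mono) (simp add: True noise_0 power_0_left)
    also have "\<dots> = ennreal 1" by (simp add: emeasure_space_1)
    also have "\<dots> \<le> ennreal (fact (2 * q))" by (intro ennreal_leI) (rule fact_ge_1)
    finally show ?thesis .
  next
    case False
    define V where "V = (\<Sum>k<m. (exp (- \<tau> * ?l\<^sup>2) ^ (m - k) * sqrt \<tau>)\<^sup>2)"
    have V: "0 < V" unfolding V_def using False \<tau> by (intro sum_pos) auto
    have lV: "?l\<^sup>2 * V \<le> 1" unfolding V_def by (rule noise_variance[OF \<tau>])
    have D: "distributed M lborel (noise \<beta> \<tau> N j m) (normal_density 0 (sqrt V))"
      unfolding V_def using noise_distributed[OF BM \<tau> j] False by simp
    have "(\<integral>\<^sup>+ \<omega>. ennreal ((?l * noise \<beta> \<tau> N j m \<omega>) ^ (2 * q)) \<partial>M)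
        = (\<integral>\<^sup>+ x. ennreal (normal_density 0 (sqrt V) x) * ennreal ((?l * x) ^ (2 * q)) \<partial>lborel)"
      by (rule distributed_nn_integral[OF D, symmetric]) simp
    also have "\<dots> = (\<integral>\<^sup>+ x. ennreal (?l ^ (2 * q)) * ennreal (normal_density 0 (sqrt V) x * (x - 0) ^ (2 * q)) \<partial>lborel)"
      by (intro nn_integral_cong)
        (simp add: ennreal_mult'[symmetric] normal_density_nonneg power_mult_distrib mult_ac lamN_nonneg)
    also have "\<dots> = ennreal (?l ^ (2 * q)) * (\<integral>\<^sup>+ x. ennreal (normal_density 0 (sqrt V) x * (x - 0) ^ (2 * q)) \<partial>lborel)"
      by (rule nn_integral_cmult) simp
    also have "(\<integral>\<^sup>+ x. ennreal (normal_density 0 (sqrt V) x * (x - 0) ^ (2 * q)) \<partial>lborel)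
        = ennreal (fact (2 * q) / ((2 / (sqrt V)\<^sup>2) ^ q * fact q))"
      using normal_moment_even[of "sqrt V" 0 q] V
      by (intro nn_integral_eq_integral[THEN trans])
        (auto simp: has_bochner_integral_iff normal_density_nonneg intro!: AE_I2 mult_nonneg_nonneg)
    also have "ennreal (?l ^ (2 * q)) * \<dots> = ennreal (?l ^ (2 * q) * (fact (2 * q) / ((2 / (sqrt V)\<^sup>2) ^ q * fact q)))"
      by (rule ennreal_mult'[symmetric]) (simp add: lamN_nonneg)
    also have "?l ^ (2 * q) * (fact (2 * q) / ((2 / (sqrt V)\<^sup>2) ^ q * fact q))
        = (?l\<^sup>2 * V) ^ q * (fact (2 * q) / (2 ^ q * fact q))"
      using V by (simp add: power_mult power_mult_distrib power_divide)
    also have "\<dots> \<le> 1 * fact (2 * q)"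
    proof (intro mult_mono)
      show "(?l\<^sup>2 * V) ^ q \<le> 1" using lV V by (intro power_le_one) auto
      have "1 * 1 \<le> 2 ^ q * (fact q :: real)" by (intro mult_mono) (auto simp: fact_ge_1)
      then show "fact (2 * q) / (2 ^ q * fact q) \<le> (fact (2 * q) :: real)"
        by (simp add: divide_le_eq mult_le_cancel_left1)
    qed auto
    finally show ?thesis by (simp add: ennreal_leI)
  qed
qed

section \<open>Moments of the noise energy, uniform in the dimension\<close>

definition noise_energy :: "(nat \<Rightarrow> real \<Rightarrow> 'a \<Rightarrow> real) \<Rightarrow> real \<Rightarrow> nat \<Rightarrow> nat \<Rightarrow> 'a \<Rightarrow> real" where
  "noise_energy \<beta> \<tau> N m \<omega> = (\<Sum>j=1..N-1. (1 + lamN N j) * (noise \<beta> \<tau> N j m \<omega>)\<^sup>2)"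

lemma noise_energy_nonneg: "0 \<le> noise_energy \<beta> \<tau> N m \<omega>"
  unfolding noise_energy_def by (intro sum_nonneg mult_nonneg_nonneg) (auto simp: lamN_nonneg)

lemma convex_on_power: "convex_on {0::real..} (\<lambda>x. x ^ q)"
  by (cases "even q") (auto intro: convex_on_subset[OF convex_power_even] convex_power_odd)

text \<open>The Sobolev weight of a mode times the variance bound is summable like
  \<open>1 / (j * (j + 1))\<close>. The constant is \<open>8 * 5\<close>, from
  \<open>j * (j + 1) \<le> 8 * lamN N j\<close> and
  \<open>1 + lamN N j \<le> 5 * lamN N j\<close>.\<close>

lemma lamN_weight: assumes "1 \<le> j" "j < N" shows "real j * (real j + 1) * (1 + lamN N j) \<le> 40 * (lamN N j)\<^sup>2"
proof -
  have l: "1/4 \<le> lamN N j" using lamN_ge_quarter[of j N] assms by simp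
  have "pi\<^sup>2 \<le> 4\<^sup>2" using pi_less_4 by (intro power_mono) auto
  hence "1/4 \<le> 4 / pi\<^sup>2" by (simp add: field_simps)
  hence "1/4 * (real j)\<^sup>2 \<le> 4 / pi\<^sup>2 * (real j)\<^sup>2" by (intro mult_right_mono) auto
  with lamN_ge[OF assms(2)] have j2: "(real j)\<^sup>2 \<le> 4 * lamN N j" by linarith
  have "real j * (real j + 1) \<le> real j * (2 * real j)" using assms by (intro mult_left_mono) auto
  also have "\<dots> \<le> 8 * lamN N j" using j2 by (simp add: power2_eq_square)
  finally have "real j * (real j + 1) * (1 + lamN N j) \<le> 8 * lamN N j * (5 * lamN N j)"
    using l by (intro mult_mono[of "real j * (real j + 1)"]) auto
  then show ?thesis by (simp add: power2_eq_square)
qed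

lemma telescoping_weights:
  assumes "0 < N"
  shows "(\<Sum>j<N. if j = 0 then 1 / real N else 1 / (real j * (real j + 1))) = 1"
proof -
  have s: "(\<Sum>j=1..<N. 1 / (real j * (real j + 1))) = 1 - 1 / real N"
    using assms
  proof (induction N rule: nat_induct_non_zero)
    case (Suc n)
    have "1 / (real n * (real n + 1)) = 1 / real n - 1 / real (Suc n)" using Suc.hyps by (simp add: field_simps)
    with Suc show ?case by simp
  qed simp
  have e: "{..<N} = insert 0 {1..<N}" using assms by auto
  show ?thesis unfolding e using s by simp
qed

text \<open>The energy is dominated by a convex combination of the scaled squares
  \<open>y j\<close>, so Jensen's inequality over the modes reduces every moment to that of a single
  mode, independently of \<open>N\<close>.\<close>

lemma noise_energy_moment:
  assumes BM: "indep_std_BMs M \<beta>" and \<tau>: "0 < \<tau>" and N: "2 \<le> N"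
  shows "(\<integral>\<^sup>+ \<omega>. ennreal (noise_energy \<beta> \<tau> N m \<omega> ^ q) \<partial>M) \<le> ennreal (40 ^ q * fact (2 * q))"
proof -
  interpret prob_space M using BM by (simp add: indep_std_BMs_def)
  \<comment> \<open>The spare mode 0 makes the weights sum to exactly 1, as needed for Jensen.\<close>
  define p where "p = (\<lambda>j. if j = 0 then 1 / real N else 1 / (real j * (real j + 1)))"
  define y where "y = (\<lambda>j \<omega>. if j = 0 then 0 else 40 * (lamN N j * noise \<beta> \<tau> N j m \<omega>)\<^sup>2)"
  have p: "0 \<le> p j" "(\<Sum>j<N. p j) = 1" for j using telescoping_weights[of N] N by (auto simp: p_def)
  have y: "0 \<le> y j \<omega>" for j \<omega> by (simp add: y_def)
  have ym [measurable]: "y j \<in> borel_measurable M" for j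
  proof (cases "j = 0")
    case False
    then have [measurable]: "noise \<beta> \<tau> N j m \<in> borel_measurable M" using noise_measurable[OF BM \<tau>, of j N m] by simp
    show ?thesis unfolding y_def using False by simp
  qed (simp add: y_def)
  have "noise_energy \<beta> \<tau> N m \<omega> \<le> (\<Sum>j<N. p j *\<^sub>R y j \<omega>)" for \<omega>
  proof -
    have e: "{..<N} = insert 0 {1..N-1}" using N by auto
    have "(1 + lamN N j) * (noise \<beta> \<tau> N j m \<omega>)\<^sup>2 \<le> p j * y j \<omega>" if j: "j \<in> {1..N-1}" for j
    proof -
      have jN: "1 \<le> j" "j < N" using j N by auto
      have j0: "0 < real j * (real j + 1)" using jN by simp
      have "1 + lamN N j \<le> 40 * (lamN N j)\<^sup>2 / (real j * (real j + 1))"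
        using lamN_weight[OF jN] j0 by (simp add: pos_le_divide_eq mult.commute)
      hence "(1 + lamN N j) * (noise \<beta> \<tau> N j m \<omega>)\<^sup>2 \<le> 40 * (lamN N j)\<^sup>2 / (real j * (real j + 1)) * (noise \<beta> \<tau> N j m \<omega>)\<^sup>2"
        by (rule mult_right_mono) simp
      then show ?thesis using jN by (simp add: p_def y_def power_mult_distrib)
    qed
    hence "noise_energy \<beta> \<tau> N m \<omega> \<le> (\<Sum>j=1..N-1. p j * y j \<omega>)" unfolding noise_energy_def by (rule sum_mono)
    then show ?thesis unfolding e by (simp add: y_def)
  qed
  hence "noise_energy \<beta> \<tau> N m \<omega> ^ q \<le> (\<Sum>j<N. p j *\<^sub>R y j \<omega>) ^ q" for \<omega>
    using noise_energy_nonneg by (rule power_mono)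
  moreover have "(\<Sum>j<N. p j *\<^sub>R y j \<omega>) ^ q \<le> (\<Sum>j<N. p j * y j \<omega> ^ q)" for \<omega>
    using N p y by (intro convex_on_sum[OF _ _ convex_on_power]) auto
  ultimately have "(\<integral>\<^sup>+ \<omega>. ennreal (noise_energy \<beta> \<tau> N m \<omega> ^ q) \<partial>M) \<le> (\<integral>\<^sup>+ \<omega>. ennreal (\<Sum>j<N. p j * y j \<omega> ^ q) \<partial>M)"
    by (intro nn_integral_mono ennreal_leI) (rule order_trans)
  also have "\<dots> = (\<integral>\<^sup>+ \<omega>. (\<Sum>j<N. ennreal (p j) * ennreal (y j \<omega> ^ q)) \<partial>M)"
    using p y by (intro nn_integral_cong) (simp add: ennreal_mult'[symmetric])
  also have "\<dots> = (\<Sum>j<N. ennreal (p j) * (\<integral>\<^sup>+ \<omega>. ennreal (y j \<omega> ^ q) \<partial>M))"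
    by (subst nn_integral_sum) (simp_all add: nn_integral_cmult)
  also have "\<dots> \<le> (\<Sum>j<N. ennreal (p j) * ennreal (40 ^ q * fact (2 * q)))"
  proof (intro sum_mono mult_left_mono)
    fix j
    show "(\<integral>\<^sup>+ \<omega>. ennreal (y j \<omega> ^ q) \<partial>M) \<le> ennreal (40 ^ q * fact (2 * q))"
    proof (cases "j = 0")
      case True
      have "1 * 1 \<le> (40 ^ q * fact (2 * q) :: real)" by (intro mult_mono) (auto simp: fact_ge_1)
      hence "(\<integral>\<^sup>+ \<omega>. ennreal (y j \<omega> ^ q) \<partial>M) \<le> (\<integral>\<^sup>+ \<omega>. ennreal (40 ^ q * fact (2 * q)) \<partial>M)"
        by (intro nn_integral_mono ennreal_leI) (auto simp: True y_def power_0_left)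
      then show ?thesis by (simp add: emeasure_space_1)
    next
      case False
      have [measurable]: "noise \<beta> \<tau> N j m \<in> borel_measurable M" using False noise_measurable[OF BM \<tau>, of j N m] by simp
      have "(\<integral>\<^sup>+ \<omega>. ennreal (y j \<omega> ^ q) \<partial>M) = (\<integral>\<^sup>+ \<omega>. ennreal (40 ^ q) * ennreal ((lamN N j * noise \<beta> \<tau> N j m \<omega>) ^ (2 * q)) \<partial>M)"
        using False by (intro nn_integral_cong) (simp add: y_def power_mult_distrib power_mult ennreal_mult'[symmetric])
      also have "\<dots> = ennreal (40 ^ q) * (\<integral>\<^sup>+ \<omega>. ennreal ((lamN N j * noise \<beta> \<tau> N j m \<omega>) ^ (2 * q)) \<partial>M)"
        by (rule nn_integral_cmult) measurable
      also have "\<dots> \<le> ennreal (40 ^ q) * ennreal (fact (2 * q))"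
        using False by (intro mult_left_mono noise_moment[OF BM \<tau>]) auto
      finally show ?thesis by (simp add: ennreal_mult')
    qed
  qed simp
  also have "\<dots> = (\<Sum>j<N. ennreal (p j)) * ennreal (40 ^ q * fact (2 * q))"
    by (simp add: sum_distrib_right)
  also have "(\<Sum>j<N. ennreal (p j)) = 1" using p by simp
  finally show ?thesis by simp
qed

lemma noise_energy_measurable:
  assumes "indep_std_BMs M \<beta>" "0 < \<tau>"
  shows "noise_energy \<beta> \<tau> N m \<in> borel_measurable M"
  unfolding noise_energy_def[abs_def]
  using noise_measurable[OF assms] by (intro borel_measurable_sum borel_measurable_times borel_measurable_const borel_measurable_power) auto

section \<open>Families with moments bounded uniformly in step size, dimension and time\<close>

definition unif_moments :: "'a measure \<Rightarrow> (real \<Rightarrow> nat \<Rightarrow> nat \<Rightarrow> 'a \<Rightarrow> real) \<Rightarrow> bool" where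
  "unif_moments M X \<longleftrightarrow>
     (\<forall>\<tau> N m. 0 < \<tau> \<longrightarrow> \<tau> < 1 \<longrightarrow> 2 \<le> N \<longrightarrow> X \<tau> N m \<in> borel_measurable M \<and> (\<forall>\<omega>. 0 \<le> X \<tau> N m \<omega>)) \<and>
     (\<forall>q. \<exists>B\<ge>0. \<forall>\<tau> N m. 0 < \<tau> \<longrightarrow> \<tau> < 1 \<longrightarrow> 2 \<le> N \<longrightarrow>
        (\<integral>\<^sup>+ \<omega>. ennreal (X \<tau> N m \<omega> ^ q) \<partial>M) \<le> ennreal B)"

lemma unif_moments_const:
  assumes "prob_space M" "0 \<le> c"
  shows "unif_moments M (\<lambda>_ _ _ _. c)"
  unfolding unif_moments_def using assms
  by (auto simp: prob_space.emeasure_space_1 intro!: exI[of _ "c ^ _"])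

lemma unif_moments_noise_energy:
  assumes "indep_std_BMs M \<beta>"
  shows "unif_moments M (noise_energy \<beta>)"
  unfolding unif_moments_def
proof (intro conjI allI impI)
  fix q
  show "\<exists>B\<ge>0. \<forall>\<tau> N m. 0 < \<tau> \<longrightarrow> \<tau> < 1 \<longrightarrow> 2 \<le> N \<longrightarrow>
        (\<integral>\<^sup>+ \<omega>. ennreal (noise_energy \<beta> \<tau> N m \<omega> ^ q) \<partial>M) \<le> ennreal B"
    using noise_energy_moment[OF assms] by (intro exI[of _ "40 ^ q * fact (2 * q)"]) auto
qed (auto intro: noise_energy_nonneg noise_energy_measurable[OF assms])

lemma add_power_le:
  assumes "0 \<le> (x::real)" "0 \<le> y" shows "(x + y) ^ q \<le> 2 ^ q * (x ^ q + y ^ q)"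
proof -
  have "(x + y) ^ q \<le> (2 * max x y) ^ q" using assms by (intro power_mono) auto
  also have "\<dots> = 2 ^ q * max x y ^ q" by (simp add: power_mult_distrib)
  also have "max x y ^ q \<le> x ^ q + y ^ q" using assms by (auto simp: max_def)
  finally show ?thesis by simp
qed

lemma unif_moments_add:
  assumes X: "unif_moments M X" and Y: "unif_moments M Y"
  shows "unif_moments M (\<lambda>\<tau> N m \<omega>. X \<tau> N m \<omega> + Y \<tau> N m \<omega>)"
  unfolding unif_moments_def
proof (intro conjI allI impI)
  fix q
  obtain B where B: "0 \<le> B" "\<And>\<tau> N m. 0 < \<tau> \<Longrightarrow> \<tau> < 1 \<Longrightarrow> 2 \<le> N \<Longrightarrow> (\<integral>\<^sup>+ \<omega>. ennreal (X \<tau> N m \<omega> ^ q) \<partial>M) \<le> ennreal B"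
    using X unfolding unif_moments_def by meson
  obtain D where D: "0 \<le> D" "\<And>\<tau> N m. 0 < \<tau> \<Longrightarrow> \<tau> < 1 \<Longrightarrow> 2 \<le> N \<Longrightarrow> (\<integral>\<^sup>+ \<omega>. ennreal (Y \<tau> N m \<omega> ^ q) \<partial>M) \<le> ennreal D"
    using Y unfolding unif_moments_def by meson
  show "\<exists>B\<ge>0. \<forall>\<tau> N m. 0 < \<tau> \<longrightarrow> \<tau> < 1 \<longrightarrow> 2 \<le> N \<longrightarrow>
        (\<integral>\<^sup>+ \<omega>. ennreal ((X \<tau> N m \<omega> + Y \<tau> N m \<omega>) ^ q) \<partial>M) \<le> ennreal B"
  proof (intro exI[of _ "2 ^ q * (B + D)"] conjI allI impI)
    fix \<tau> :: real and N m :: nat assume v: "0 < \<tau>" "\<tau> < 1" "2 \<le> N"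
    have [measurable]: "X \<tau> N m \<in> borel_measurable M" "Y \<tau> N m \<in> borel_measurable M"
      and nn: "\<And>\<omega>. 0 \<le> X \<tau> N m \<omega>" "\<And>\<omega>. 0 \<le> Y \<tau> N m \<omega>"
      using X Y v unfolding unif_moments_def by auto
    have "(\<integral>\<^sup>+ \<omega>. ennreal ((X \<tau> N m \<omega> + Y \<tau> N m \<omega>) ^ q) \<partial>M)
        \<le> (\<integral>\<^sup>+ \<omega>. ennreal (2 ^ q) * (ennreal (X \<tau> N m \<omega> ^ q) + ennreal (Y \<tau> N m \<omega> ^ q)) \<partial>M)"
      using add_power_le[OF nn] nn
      by (intro nn_integral_mono) (simp add: ennreal_mult'[symmetric] ennreal_plus[symmetric] ennreal_leI del: ennreal_plus)
    also have "\<dots> = ennreal (2 ^ q) * ((\<integral>\<^sup>+ \<omega>. ennreal (X \<tau> N m \<omega> ^ q) \<partial>M) + (\<integral>\<^sup>+ \<omega>. ennreal (Y \<tau> N m \<omega> ^ q) \<partial>M))"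
      by (subst nn_integral_cmult) (simp_all add: nn_integral_add)
    also have "\<dots> \<le> ennreal (2 ^ q) * (ennreal B + ennreal D)"
      using B(2)[OF v] D(2)[OF v] by (intro mult_left_mono add_mono) auto
    also have "\<dots> = ennreal (2 ^ q * (B + D))" using B D by (simp add: ennreal_mult')
    finally show "(\<integral>\<^sup>+ \<omega>. ennreal ((X \<tau> N m \<omega> + Y \<tau> N m \<omega>) ^ q) \<partial>M) \<le> ennreal (2 ^ q * (B + D))" .
  qed (use B D in simp)
qed (use X Y in \<open>auto simp: unif_moments_def intro!: borel_measurable_add\<close>)

lemma unif_moments_cmult:
  assumes X: "unif_moments M X" and c: "0 \<le> c"
  shows "unif_moments M (\<lambda>\<tau> N m \<omega>. c * X \<tau> N m \<omega>)"
  unfolding unif_moments_def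
proof (intro conjI allI impI)
  fix q
  obtain B where B: "0 \<le> B" "\<And>\<tau> N m. 0 < \<tau> \<Longrightarrow> \<tau> < 1 \<Longrightarrow> 2 \<le> N \<Longrightarrow> (\<integral>\<^sup>+ \<omega>. ennreal (X \<tau> N m \<omega> ^ q) \<partial>M) \<le> ennreal B"
    using X unfolding unif_moments_def by meson
  show "\<exists>B\<ge>0. \<forall>\<tau> N m. 0 < \<tau> \<longrightarrow> \<tau> < 1 \<longrightarrow> 2 \<le> N \<longrightarrow>
        (\<integral>\<^sup>+ \<omega>. ennreal ((c * X \<tau> N m \<omega>) ^ q) \<partial>M) \<le> ennreal B"
  proof (intro exI[of _ "c ^ q * B"] conjI allI impI)
    fix \<tau> :: real and N m :: nat assume v: "0 < \<tau>" "\<tau> < 1" "2 \<le> N"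
    have [measurable]: "X \<tau> N m \<in> borel_measurable M" using X v unfolding unif_moments_def by auto
    have "(\<integral>\<^sup>+ \<omega>. ennreal ((c * X \<tau> N m \<omega>) ^ q) \<partial>M) = ennreal (c ^ q) * (\<integral>\<^sup>+ \<omega>. ennreal (X \<tau> N m \<omega> ^ q) \<partial>M)"
      using c by (subst nn_integral_cmult[symmetric]) (simp_all add: power_mult_distrib ennreal_mult')
    also have "\<dots> \<le> ennreal (c ^ q) * ennreal B" using B(2)[OF v] by (intro mult_left_mono) auto
    finally show "(\<integral>\<^sup>+ \<omega>. ennreal ((c * X \<tau> N m \<omega>) ^ q) \<partial>M) \<le> ennreal (c ^ q * B)"
      using c by (simp add: ennreal_mult')
  qed (use B c in simp)
qed (use X c in \<open>auto simp: unif_moments_def intro!: borel_measurable_times\<close>)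

text \<open>The moment of order \<open>q\<close> of a \<open>k\<close>-th power is a moment of order
  \<open>k * q\<close>; this is why all orders are bounded at once in
  \<open>unif_moments\<close>.\<close>

lemma unif_moments_power:
  assumes X: "unif_moments M X"
  shows "unif_moments M (\<lambda>\<tau> N m \<omega>. X \<tau> N m \<omega> ^ k)"
  unfolding unif_moments_def
proof (intro conjI allI impI)
  fix q
  show "\<exists>B\<ge>0. \<forall>\<tau> N m. 0 < \<tau> \<longrightarrow> \<tau> < 1 \<longrightarrow> 2 \<le> N \<longrightarrow>
        (\<integral>\<^sup>+ \<omega>. ennreal ((X \<tau> N m \<omega> ^ k) ^ q) \<partial>M) \<le> ennreal B"
    using X unfolding unif_moments_def power_mult[symmetric] by blast
qed (use X in \<open>auto simp: unif_moments_def intro!: borel_measurable_power\<close>)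

text \<open>Majorants are propagated instead of the scheme itself, so measurability is only ever
  needed for the Gaussian convolution.\<close>

fun relaxation :: "real \<Rightarrow> (nat \<Rightarrow> real) \<Rightarrow> nat \<Rightarrow> real" where
  "relaxation \<tau> a 0 = 0"
| "relaxation \<tau> a (Suc m) = (1 - \<tau> / 64) * relaxation \<tau> a m + \<tau> * a m"

lemma relaxation_nonneg:
  assumes "0 < \<tau>" "\<tau> < 1" "\<And>m. 0 \<le> a m"
  shows "0 \<le> relaxation \<tau> a m"
  using assms by (induction m) auto

lemma relaxation_bound:
  assumes "0 < \<tau>" "\<tau> < 1" "x 0 \<le> 0" "\<And>m. x (Suc m) \<le> (1 - \<tau> / 64) * x m + \<tau> * a m"
  shows "x m \<le> relaxation \<tau> a m"
proof (induction m)
  case (Suc m)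
  have "(1 - \<tau> / 64) * x m \<le> (1 - \<tau> / 64) * relaxation \<tau> a m"
    using Suc assms by (intro mult_left_mono) auto
  with assms(4)[of m] show ?case by simp
qed (use assms in simp)

text \<open>One step is a convex combination of the old value and \<open>64 * X\<close>, with
  weights \<open>1 - \<tau> / 64\<close> and \<open>\<tau> / 64\<close>. By convexity of the power a
  common moment bound passes from step to step without growth.\<close>

lemma unif_moments_relaxation:
  assumes M: "prob_space M" and X: "unif_moments M X"
  shows "unif_moments M (\<lambda>\<tau> N m \<omega>. relaxation \<tau> (\<lambda>k. X \<tau> N k \<omega>) m)"
proof -
  have XX: "X \<tau> N m \<in> borel_measurable M" "0 \<le> X \<tau> N m \<omega>" if "0 < \<tau>" "\<tau> < 1" "2 \<le> N" for \<tau> N m \<omega>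
    using X that unfolding unif_moments_def by auto
  have meas: "(\<lambda>\<omega>. relaxation \<tau> (\<lambda>k. X \<tau> N k \<omega>) m) \<in> borel_measurable M" if v: "0 < \<tau>" "\<tau> < 1" "2 \<le> N" for \<tau> N m
  proof (induction m)
    case (Suc m)
    note [measurable] = Suc XX(1)[OF v]
    show ?case by simp
  qed simp
  have nn: "0 \<le> relaxation \<tau> (\<lambda>k. X \<tau> N k \<omega>) m" if v: "0 < \<tau>" "\<tau> < 1" "2 \<le> N" for \<tau> N m \<omega>
    using v by (intro relaxation_nonneg XX) auto
  show ?thesis
    unfolding unif_moments_def
  proof (intro conjI allI impI)
    fix q
    obtain B0 where B0: "0 \<le> B0" "\<And>\<tau> N m. 0 < \<tau> \<Longrightarrow> \<tau> < 1 \<Longrightarrow> 2 \<le> N \<Longrightarrow> (\<integral>\<^sup>+ \<omega>. ennreal ((64 * X \<tau> N m \<omega>) ^ q) \<partial>M) \<le> ennreal B0"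
      using unif_moments_cmult[OF X, of 64] unfolding unif_moments_def by (meson zero_le_numeral)
    \<comment> \<open>The maximum with 1 covers \<open>q = 0\<close> at time 0, where
      \<open>0 ^ 0 = 1\<close>.\<close>
    define B where "B = max B0 1"
    have B: "0 \<le> B" "ennreal B0 \<le> ennreal B" "1 \<le> ennreal B" using B0 by (auto simp: B_def ennreal_leI)
    show "\<exists>B\<ge>0. \<forall>\<tau> N m. 0 < \<tau> \<longrightarrow> \<tau> < 1 \<longrightarrow> 2 \<le> N \<longrightarrow>
        (\<integral>\<^sup>+ \<omega>. ennreal (relaxation \<tau> (\<lambda>k. X \<tau> N k \<omega>) m ^ q) \<partial>M) \<le> ennreal B"
    proof (intro exI[of _ B] conjI allI impI B(1))
      fix \<tau> :: real and N m :: nat assume v: "0 < \<tau>" "\<tau> < 1" "2 \<le> N"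
      show "(\<integral>\<^sup>+ \<omega>. ennreal (relaxation \<tau> (\<lambda>k. X \<tau> N k \<omega>) m ^ q) \<partial>M) \<le> ennreal B"
      proof (induction m)
        case 0
        show ?case using B(3) by (cases q) (auto simp: prob_space.emeasure_space_1[OF M])
      next
        case (Suc m)
        let ?R = "\<lambda>\<omega>. relaxation \<tau> (\<lambda>k. X \<tau> N k \<omega>) m"
        let ?t = "\<tau> / 64"
        note [measurable] = XX(1)[OF v] meas[OF v]
        have t: "0 \<le> ?t" "0 \<le> 1 - ?t" using v by auto
        have "((1 - ?t) * ?R \<omega> + \<tau> * X \<tau> N m \<omega>) ^ q \<le> (1 - ?t) * ?R \<omega> ^ q + ?t * (64 * X \<tau> N m \<omega>) ^ q" for \<omega>
          using convex_onD[OF convex_on_power, of ?t "?R \<omega>" "64 * X \<tau> N m \<omega>" q] t nn[OF v] XX(2)[OF v] by simp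
        hence "(\<integral>\<^sup>+ \<omega>. ennreal (relaxation \<tau> (\<lambda>k. X \<tau> N k \<omega>) (Suc m) ^ q) \<partial>M)
          \<le> (\<integral>\<^sup>+ \<omega>. ennreal (1 - ?t) * ennreal (?R \<omega> ^ q) + ennreal ?t * ennreal ((64 * X \<tau> N m \<omega>) ^ q) \<partial>M)"
          using t nn[OF v] XX(2)[OF v]
          by (intro nn_integral_mono) (simp add: ennreal_mult'[symmetric] ennreal_plus[symmetric] ennreal_leI del: ennreal_plus)
        also have "\<dots> = ennreal (1 - ?t) * (\<integral>\<^sup>+ \<omega>. ennreal (?R \<omega> ^ q) \<partial>M) + ennreal ?t * (\<integral>\<^sup>+ \<omega>. ennreal ((64 * X \<tau> N m \<omega>) ^ q) \<partial>M)"
          by (subst nn_integral_add) (simp_all add: nn_integral_cmult)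
        also have "\<dots> \<le> ennreal (1 - ?t) * ennreal B + ennreal ?t * ennreal B"
          using Suc B0(2)[OF v, of m] B(2) by (intro add_mono mult_left_mono) auto
        also have "\<dots> = ennreal B"
        proof -
          have "ennreal (1 - ?t) * ennreal B + ennreal ?t * ennreal B = ennreal ((1 - ?t) * B + ?t * B)"
            using t B(1) by (simp add: ennreal_mult'[symmetric] ennreal_plus[symmetric] del: ennreal_plus)
          also have "(1 - ?t) * B + ?t * B = B" by (simp add: left_diff_distrib)
          finally show ?thesis .
        qed
        finally show ?case .
      qed
    qed
  qed (use meas nn in auto)
qed

section \<open>Pathwise bound and conclusion\<close>

lemma integral_cauchy_schwarz:
  fixes g :: "real \<Rightarrow> real"
  assumes ab: "a \<le> b" and g: "g integrable_on {a..b}" and g2: "(\<lambda>x. (g x)\<^sup>2) integrable_on {a..b}"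
  shows "(integral {a..b} g)\<^sup>2 \<le> (b - a) * integral {a..b} (\<lambda>x. (g x)\<^sup>2)"
proof (cases "a = b")
  case False
  hence ba: "0 < b - a" using ab by simp
  let ?I = "integral {a..b} g" and ?J = "integral {a..b} (\<lambda>x. (g x)\<^sup>2)"
  \<comment> \<open>The mean value of \<open>g\<close>: integrating the nonnegative function
    \<open>(g x - c)\<^sup>2\<close> gives the claim.\<close>
  define c where "c = ?I / (b - a)"
  have "((\<lambda>x. (g x)\<^sup>2 - 2 * c * g x + c\<^sup>2) has_integral ?J - 2 * c * ?I + c\<^sup>2 * (b - a)) {a..b}"
    using has_integral_const_real[of "c\<^sup>2" a b] ab
    by (intro has_integral_add has_integral_diff has_integral_mult_right integrable_integral g g2) (auto simp: mult.commute)
  hence "0 \<le> ?J - 2 * c * ?I + c\<^sup>2 * (b - a)"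
  proof (rule has_integral_nonneg)
    fix x
    have "(g x)\<^sup>2 - 2 * c * g x + c\<^sup>2 = (g x - c)\<^sup>2" by (simp add: power2_diff)
    then show "0 \<le> (g x)\<^sup>2 - 2 * c * g x + c\<^sup>2" by simp
  qed
  also have "\<dots> = ?J - ?I\<^sup>2 / (b - a)" using ba by (simp add: c_def power2_eq_square)
  finally show ?thesis using ba by (simp add: field_simps)
qed simp

lemma xN_bounds: assumes "i \<in> {1..N}" shows "0 \<le> xN N i" "xN N i \<le> pi"
proof -
  have N: "0 < N" using assms by simp
  show "0 \<le> xN N i" unfolding xN_def using assms hN_pos[OF N] by (intro mult_nonneg_nonneg) auto
  have "xN N i \<le> real N * hN N" unfolding xN_def using assms hN_pos[OF N] by (intro mult_right_mono) auto
  then show "xN N i \<le> pi" using N by (simp add: hN_def)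
qed

text \<open>By Cauchy-Schwarz a squared grid increment of \<open>u0\<close> is at most the mesh
  width times an increment of the running energy \<open>?W\<close>. The discrete gradient energy
  then telescopes to at most \<open>?W pi\<close>, independently of \<open>N\<close>.\<close>

lemma H1_grid_bound:
  assumes "H1_interval u0"
  shows "\<exists>B. \<forall>N\<ge>2. sobN 0 N (\<lambda>i. u0 (xN N i)) + sobN 1 N (\<lambda>i. u0 (xN N i)) \<le> B"
proof -
  obtain g where g: "g integrable_on {0..pi}" "(\<lambda>x. (g x)\<^sup>2) integrable_on {0..pi}"
    and u: "\<And>x. x \<in> {0..pi} \<Longrightarrow> u0 x = u0 0 + integral {0..x} g"
    using assms unfolding H1_interval_def by blast
  let ?W = "\<lambda>x. integral {0..x} (\<lambda>x. (g x)\<^sup>2)"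
  have inc: "(u0 b - u0 a)\<^sup>2 \<le> (b - a) * (?W b - ?W a) \<and> 0 \<le> ?W b - ?W a" if ab: "0 \<le> a" "a \<le> b" "b \<le> pi" for a b
  proof -
    have i: "h integrable_on {0..b}" "h integrable_on {a..b}" if "h integrable_on {0..pi}" for h :: "real \<Rightarrow> real"
      using that ab by (auto elim: integrable_on_subinterval)
    have c: "integral {0..b} h - integral {0..a} h = integral {a..b} h" if "h integrable_on {0..pi}" for h :: "real \<Rightarrow> real"
      using Henstock_Kurzweil_Integration.integral_combine[OF ab(1,2) i(1)[OF that]] by simp
    have "u0 b - u0 a = integral {a..b} g" using u[of a] u[of b] ab c[OF g(1)] by simp
    moreover have "0 \<le> integral {a..b} (\<lambda>x. (g x)\<^sup>2)" by (rule integral_nonneg[OF i(2)[OF g(2)]]) simp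
    ultimately show ?thesis
      using integral_cauchy_schwarz[OF ab(2) i(2)[OF g(1)] i(2)[OF g(2)]] c[OF g(2)] by simp
  qed
  define I where "I = ?W pi"
  have W0: "?W 0 = 0" by simp
  define S where "S = 2 * (u0 0)\<^sup>2 + 2 * (pi * I)"
  have I0: "0 \<le> I" using inc[of 0 pi] W0 by (simp add: I_def)
  have ub: "(u0 x)\<^sup>2 \<le> S" if x: "0 \<le> x" "x \<le> pi" for x
  proof -
    have "(u0 x - u0 0)\<^sup>2 \<le> x * ?W x" using inc[of 0 x] x by simp
    also have "\<dots> \<le> pi * I" unfolding I_def using inc[of x pi] inc[of 0 x] x by (intro mult_mono) auto
    finally have "(u0 x - u0 0)\<^sup>2 \<le> pi * I" .
    moreover have "(u0 x)\<^sup>2 \<le> 2 * (u0 0)\<^sup>2 + 2 * (u0 x - u0 0)\<^sup>2"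
      using zero_le_power2[of "u0 x - 2 * u0 0"] by (simp add: power2_eq_square algebra_simps)
    ultimately show ?thesis unfolding S_def by linarith
  qed
  have "sobN 0 N (\<lambda>i. u0 (xN N i)) + sobN 1 N (\<lambda>i. u0 (xN N i)) \<le> pi * S + I" if N: "2 \<le> N" for N
  proof (rule add_mono)
    have h: "0 < hN N" using N by (simp add: hN_pos)
    have "hN N * (\<Sum>i=1..N. (u0 (xN N i))\<^sup>2) \<le> hN N * (\<Sum>i=1..N. S)"
      using h xN_bounds ub by (intro mult_left_mono sum_mono) auto
    then show "sobN 0 N (\<lambda>i. u0 (xN N i)) \<le> pi * S"
      using N by (simp only: sobN_0 hN_sum_const)
    have xs: "xN N (Suc i) - xN N i = hN N" for i by (simp add: xN_def algebra_simps)
    have "hN N * (\<Sum>i=1..<N. (diffN N (\<lambda>i. u0 (xN N i)) i)\<^sup>2) \<le> (\<Sum>i=1..<N. ?W (xN N (Suc i)) - ?W (xN N i))"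
      unfolding sum_distrib_left
    proof (rule sum_mono)
      fix i assume i: "i \<in> {1..<N}"
      have "(u0 (xN N (Suc i)) - u0 (xN N i))\<^sup>2 \<le> hN N * (?W (xN N (Suc i)) - ?W (xN N i))"
        using inc[of "xN N i" "xN N (Suc i)"] xs[of i] h xN_bounds[of i N] xN_bounds[of "Suc i" N] i by auto
      then show "hN N * (diffN N (\<lambda>i. u0 (xN N i)) i)\<^sup>2 \<le> ?W (xN N (Suc i)) - ?W (xN N i)"
        using h by (simp add: diffN_def power_divide power2_eq_square[of "hN N"] pos_divide_le_eq mult.commute)
    qed
    also have "\<dots> = ?W (xN N N) - ?W (xN N 1)" using N by (intro sum_Suc_diff') simp
    also have "\<dots> \<le> I"
      unfolding I_def using inc[of "xN N N" pi] inc[of 0 "xN N 1"] xN_bounds[of N N] xN_bounds[of 1 N] N by simp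
    finally show "sobN 1 N (\<lambda>i. u0 (xN N i)) \<le> I" unfolding sobN_1[OF N] .
  qed
  then show ?thesis by blast
qed

section \<open>From the grid maximum to the interpolant\<close>

lemma PN_bound:
  assumes N: "2 \<le> N" and v: "\<And>i. i \<in> {1..N} \<Longrightarrow> \<bar>v i\<bar> \<le> B"
  shows "\<bar>PN N v x\<bar> \<le> B"
proof -
  have h: "0 < hN N" using N by (simp add: hN_pos)
  consider "x \<le> xN N 1" | "\<not> x \<le> xN N 1" "x \<ge> xN N N" | "xN N 1 < x" "x < xN N N" by linarith
  then show ?thesis
  proof cases
    case 3
    \<comment> \<open>The fractional grid index: \<open>x = xN N i\<close> exactly when
      \<open>z = i\<close>. Between the extreme grid points it lies strictly between 1 and
      \<open>N\<close>, so its floor and the successor are valid indices.\<close>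
    define z where "z = x / hN N + 1/2"
    define i where "i = nat \<lfloor>z\<rfloor>"
    have z: "1 < z" "z < real N" using 3 h by (auto simp: z_def xN_def field_simps)
    have iz: "real i \<le> z" "z < real i + 1" unfolding i_def using z(1) by linarith+
    have iN: "i \<in> {1..N}" "Suc i \<in> {1..N}" using iz z by auto
    define t where "t = z - real i"
    have t: "0 \<le> t" "t \<le> 1" using iz by (auto simp: t_def)
    have "(x - xN N i) / hN N = t" using h by (simp add: t_def z_def xN_def field_simps)
    hence "PN N v x = v i + t * (v (Suc i) - v i)"
      using 3 by (simp add: PN_def Let_def i_def[unfolded z_def, symmetric] del: times_divide_eq_left)
    also have "\<dots> = (1 - t) * v i + t * v (Suc i)" by (simp add: algebra_simps)
    finally have "\<bar>PN N v x\<bar> = \<bar>(1 - t) * v i + t * v (Suc i)\<bar>" by simp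
    also have "\<bar>(1 - t) * v i + t * v (Suc i)\<bar> \<le> (1 - t) * \<bar>v i\<bar> + t * \<bar>v (Suc i)\<bar>"
      using abs_triangle_ineq[of "(1 - t) * v i" "t * v (Suc i)"] t by (simp add: abs_mult)
    also have "\<dots> \<le> (1 - t) * B + t * B" using t v[OF iN(1)] v[OF iN(2)] by (intro add_mono mult_left_mono) auto
    finally show ?thesis by (simp add: algebra_simps)
  qed (use v N in \<open>auto simp: PN_def\<close>)
qed

lemma Linf_norm_PN:
  assumes N: "2 \<le> N"
  shows "0 \<le> Linf_norm (PN N v)" "(Linf_norm (PN N v))\<^sup>2 \<le> 2 * (norm_w12N N v)\<^sup>2"
proof -
  define B where "B = sqrt (2 * (norm_w12N N v)\<^sup>2)"
  have B: "\<bar>PN N v x\<bar> \<le> B" for x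
    using grid_sup_le_w12[OF N, of _ v] by (intro PN_bound[OF N]) (simp add: B_def norm_w12N_sobN real_le_rsqrt)
  have "\<bar>PN N v 0\<bar> \<le> Linf_norm (PN N v)"
    unfolding Linf_norm_def using B by (intro cSUP_upper bdd_aboveI2[of _ _ B]) auto
  then show 0: "0 \<le> Linf_norm (PN N v)" by linarith
  have "Linf_norm (PN N v) \<le> B" unfolding Linf_norm_def using B by (intro cSUP_least) auto
  hence "(Linf_norm (PN N v))\<^sup>2 \<le> B\<^sup>2" using 0 by (rule power_mono)
  then show "(Linf_norm (PN N v))\<^sup>2 \<le> 2 * (norm_w12N N v)\<^sup>2" by (simp add: B_def)
qed

section \<open>Deterministic majorants for a fixed path\<close>

lemma scheme_path_bound:
  fixes A0 \<sigma> \<tau> :: real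
  assumes f: "cubic_like f c C" and N: "2 \<le> N" and \<tau>: "0 < \<tau>" "\<tau> < 1"
    and A0: "1 + 2 * (sobN 0 N (\<lambda>i. u0 (xN N i)) + sobN 1 N (\<lambda>i. u0 (xN N i))) \<le> A0"
    and K: "K = 2 * c + C + 20 * C\<^sup>2 / c" and L: "L = 10240 * C\<^sup>2"
    and G: "\<And>m. G m = A0 + 2 * \<sigma>\<^sup>2 * noise_energy \<beta> \<tau> N m \<omega>"
    and R: "R = relaxation \<tau> (\<lambda>k. (2 * K + 1024 * K ^ 4 / c + 250 * C\<^sup>2) * G k ^ 4)"
    and S: "S = relaxation \<tau> (\<lambda>k. (16 * L ^ 3 + L) * (G k + R k) ^ 7)"
  shows "(norm_w12N N (Uscheme f \<sigma> \<beta> u0 \<tau> N m \<omega>))\<^sup>2 \<le> 2 * (R m + S m) + 2 * G m"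
proof -
  define U where "U = (\<lambda>m. Uscheme f \<sigma> \<beta> u0 \<tau> N m \<omega>)"
  define e where "e = (\<lambda>j. exp (- \<tau> * (lamN N j)\<^sup>2))"
  \<comment> \<open>The explicit solution of the linear recursion containing the initial value and
    the noise; subtracting it leaves a pure drift step.\<close>
  define z where "z = (\<lambda>m j. e j ^ m * coefN N (\<lambda>i. u0 (xN N i)) j + \<sigma> * (if 1 \<le> j then noise \<beta> \<tau> N j m \<omega> else 0))"
  define Z where "Z = (\<lambda>m i. \<Sum>j<N. z m j * phiN N j i)"
  define Y where "Y = (\<lambda>m i. U m i - Z m i)"
  have UYZ: "U m = (\<lambda>i. Y m i + Z m i)" for m by (simp add: Y_def)
  have cfZ: "coefN N (Z m) j = z m j" if "j < N" for m j
    unfolding Z_def using that by (subst coefN_synth) auto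
  have cfY: "coefN N (Y m) j = coefN N (U m) j - z m j" if "j < N" for m j
    using that by (simp add: Y_def coefN_linear cfZ)
  have Y0: "coefN N (Y 0) j = 0" if "j < N" for j
    using that by (simp add: cfY z_def noise_0 U_def)
  have st: "drift_step \<tau> N (Y m) (FtildeN f \<tau> N (U m)) (Y (Suc m))" for m
    unfolding drift_step_def
  proof (intro allI impI)
    fix j assume j: "j < N"
    show "coefN N (Y (Suc m)) j = exp (- \<tau> * (lamN N j)\<^sup>2) * (coefN N (Y m) j - \<tau> * lamN N j * coefN N (FtildeN f \<tau> N (U m)) j)"
      unfolding cfY[OF j] U_def coefN_Uscheme_Suc[OF N j] z_def noise_Suc e_def
      by (simp add: algebra_simps del: of_nat_Suc)
  qed
  \<comment> \<open>The eigenvalue of mode 0 is zero, so the drift leaves this mode alone and the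
    whole mean of the scheme sits in \<open>Z\<close>.\<close>
  have mean: "coefN N (Y m) 0 = 0" for m
  proof (induction m)
    case 0 show ?case using N by (intro Y0) auto
  next
    case (Suc m)
    have "lamN N 0 = 0" by (simp add: lamN_def)
    with st[of m] N Suc show ?case by (simp add: drift_step_def)
  qed
  \<comment> \<open>The damping factors are at most 1. The factors 2 in \<open>A0\<close> and before
    \<open>\<sigma>\<^sup>2\<close> come from squaring the two-term sum
    \<open>z m j\<close>.\<close>
  have GZ: "1 + sobN 0 N (Z m) + sobN 1 N (Z m) \<le> G m" for m
  proof -
    let ?u = "\<lambda>j. coefN N (\<lambda>i. u0 (xN N i)) j" and ?n = "\<lambda>j. if 1 \<le> j then noise \<beta> \<tau> N j m \<omega> else 0"
    have "sobN 0 N (Z m) + sobN 1 N (Z m) = (\<Sum>j<N. (1 + lamN N j) * (z m j)\<^sup>2)"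
      by (simp add: sobN_def cfZ sum.distrib[symmetric] algebra_simps)
    also have "\<dots> \<le> (\<Sum>j<N. (1 + lamN N j) * (2 * (?u j)\<^sup>2 + 2 * \<sigma>\<^sup>2 * (?n j)\<^sup>2))"
    proof (intro sum_mono mult_left_mono)
      fix j
      have e1: "0 \<le> e j ^ m" "e j ^ m \<le> 1" unfolding e_def using \<tau> by (auto intro!: power_le_one)
      have "(z m j)\<^sup>2 \<le> 2 * (e j ^ m * ?u j)\<^sup>2 + 2 * (\<sigma> * ?n j)\<^sup>2"
        unfolding z_def using sum_squares_bound[of "e j ^ m * ?u j" "\<sigma> * ?n j"] by (simp only: power2_sum)
      also have "(e j ^ m * ?u j)\<^sup>2 \<le> (?u j)\<^sup>2"
        unfolding power_mult_distrib using power_le_one[OF e1, of 2] by (intro mult_left_le_one_le) auto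
      finally show "(z m j)\<^sup>2 \<le> 2 * (?u j)\<^sup>2 + 2 * \<sigma>\<^sup>2 * (?n j)\<^sup>2" by (simp add: power_mult_distrib)
    qed (simp add: lamN_nonneg)
    also have "\<dots> = 2 * (\<Sum>j<N. (1 + lamN N j) * (?u j)\<^sup>2) + 2 * \<sigma>\<^sup>2 * (\<Sum>j<N. (1 + lamN N j) * (?n j)\<^sup>2)"
      unfolding sum_distrib_left sum.distrib[symmetric] by (intro sum.cong refl) algebra
    also have "(\<Sum>j<N. (1 + lamN N j) * (?u j)\<^sup>2) = sobN 0 N (\<lambda>i. u0 (xN N i)) + sobN 1 N (\<lambda>i. u0 (xN N i))"
      by (simp add: sobN_def sum.distrib[symmetric] algebra_simps)
    also have "(\<Sum>j<N. (1 + lamN N j) * (?n j)\<^sup>2) = noise_energy \<beta> \<tau> N m \<omega>"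
    proof -
      have "{..<N} = insert 0 {1..N-1}" using N by auto
      then show ?thesis by (simp add: noise_energy_def)
    qed
    finally show ?thesis unfolding G using A0 by linarith
  qed
  have z0: "sobN k N (Y 0) = 0" for k by (simp add: sobN_def Y0)
  have Rm: "sobN 0 N (Y m) + \<tau> * sobN 2 N (Y m) \<le> R m" for m
    unfolding R using l2_step[OF f N \<tau> UYZ mean GZ st K]
    by (intro relaxation_bound \<tau>) (simp_all add: z0)
  have G0: "0 \<le> G m" for m using GZ[of m] sobN_nonneg[of 0 N "Z m"] sobN_nonneg[of 1 N "Z m"] by linarith
  have n0R: "sobN 0 N (Y m) \<le> R m" for m
  proof -
    have "0 \<le> \<tau> * sobN 2 N (Y m)" using \<tau> sobN_nonneg[of 2 N "Y m"] by simp
    with Rm[of m] show ?thesis by linarith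
  qed
  have Sm: "sobN 1 N (Y m) + \<tau> * sobN 3 N (Y m) \<le> S m" for m
    unfolding S
  proof (rule relaxation_bound[OF \<tau>])
    fix m
    have "sobN 1 N (Y (Suc m)) + \<tau> * sobN 3 N (Y (Suc m)) \<le> (1 - \<tau> / 64) * (sobN 1 N (Y m) + \<tau> * sobN 3 N (Y m))
     + \<tau> * ((16 * L ^ 3 + L) * (G m + sobN 0 N (Y m)) ^ 7)"
      by (rule h1_step[OF f N \<tau> UYZ mean GZ st L])
    \<comment> \<open>The first majorant feeds the second: \<open>sobN 0\<close> is replaced by
      \<open>R\<close>, so that the forcing depends on the noise alone.\<close>
    also have "\<tau> * ((16 * L ^ 3 + L) * (G m + sobN 0 N (Y m)) ^ 7) \<le> \<tau> * ((16 * L ^ 3 + L) * (G m + R m) ^ 7)"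
      using \<tau> n0R[of m] G0[of m] sobN_nonneg[of 0 N "Y m"] L by (intro mult_left_mono power_mono) auto
    finally show "sobN 1 N (Y (Suc m)) + \<tau> * sobN 3 N (Y (Suc m)) \<le> (1 - \<tau> / 64) * (sobN 1 N (Y m) + \<tau> * sobN 3 N (Y m))
     + \<tau> * ((16 * L ^ 3 + L) * (G m + R m) ^ 7)" by simp
  qed (simp add: z0)
  have n1S: "sobN 1 N (Y m) \<le> S m"
  proof -
    have "0 \<le> \<tau> * sobN 3 N (Y m)" using \<tau> sobN_nonneg[of 3 N "Y m"] by simp
    with Sm[of m] show ?thesis by linarith
  qed
  have "(norm_w12N N (U m))\<^sup>2 \<le> (2 * sobN 0 N (Y m) + 2 * sobN 0 N (Z m)) + (2 * sobN 1 N (Y m) + 2 * sobN 1 N (Z m))"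
    unfolding norm_w12N_sobN UYZ by (intro add_mono sobN_add)
  also have "\<dots> \<le> 2 * (R m + S m) + 2 * G m" using n0R[of m] n1S GZ[of m] by (simp add: distrib_left)
  finally show ?thesis by (simp add: U_def)
qed

section \<open>From natural moments of the majorant to real moments of the norms\<close>

lemma powr_le_one_plus_power:
  fixes y X p :: real
  assumes "0 \<le> y" "y\<^sup>2 \<le> X" "0 \<le> p" "p \<le> 2 * real q"
  shows "y powr p \<le> 1 + X ^ q"
proof -
  have X: "0 \<le> X ^ q" "(y\<^sup>2) ^ q \<le> X ^ q"
    using assms order_trans[OF zero_le_power2 assms(2)] by (auto intro: power_mono)
  show ?thesis
  proof (cases "y \<le> 1")
    case True
    have "y powr p \<le> 1 powr p" using True assms by (intro powr_mono2) auto
    with X show ?thesis by simp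
  next
    case False
    have "y powr p \<le> y powr (real (2 * q))" using False assms by (intro powr_mono) auto
    also have "\<dots> = (y\<^sup>2) ^ q" using False by (simp only: powr_realpow power_mult)
    finally show ?thesis using X by linarith
  qed
qed

lemma unif_moments_SUP_finite:
  fixes Y :: "real \<Rightarrow> nat \<Rightarrow> nat \<Rightarrow> 'a \<Rightarrow> real" and p :: real
  assumes M: "prob_space M" and X: "unif_moments M X" and p: "0 \<le> p"
    and Y: "\<And>\<tau> N m \<omega>. 0 < \<tau> \<Longrightarrow> \<tau> < 1 \<Longrightarrow> 2 \<le> N \<Longrightarrow> 0 \<le> Y \<tau> N m \<omega> \<and> (Y \<tau> N m \<omega>)\<^sup>2 \<le> X \<tau> N m \<omega>"
  shows "(SUP (\<tau>, N, m) \<in> {(\<tau>, N, m). 0 < \<tau> \<and> \<tau> < 1 \<and> 2 \<le> N}. \<integral>\<^sup>+ \<omega>. ennreal (Y \<tau> N m \<omega> powr p) \<partial>M) < \<top>"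
proof -
  interpret prob_space M by (rule M)
  \<comment> \<open>From \<open>p \<le> q\<close> follows \<open>p \<le> 2 * q\<close>, as needed
    because \<open>X\<close> dominates the square of \<open>Y\<close>.\<close>
  obtain q :: nat where q: "p \<le> real q" using real_arch_simple by blast
  obtain B where B: "0 \<le> B" "\<And>\<tau> N m. 0 < \<tau> \<Longrightarrow> \<tau> < 1 \<Longrightarrow> 2 \<le> N \<Longrightarrow> (\<integral>\<^sup>+ \<omega>. ennreal (X \<tau> N m \<omega> ^ q) \<partial>M) \<le> ennreal B"
    using X unfolding unif_moments_def by meson
  have "(\<integral>\<^sup>+ \<omega>. ennreal (Y \<tau> N m \<omega> powr p) \<partial>M) \<le> ennreal (1 + B)" if v: "0 < \<tau>" "\<tau> < 1" "2 \<le> N" for \<tau> N m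
  proof -
    have [measurable]: "X \<tau> N m \<in> borel_measurable M" and nn: "\<And>\<omega>. 0 \<le> X \<tau> N m \<omega>"
      using X v unfolding unif_moments_def by auto
    have "Y \<tau> N m \<omega> powr p \<le> 1 + X \<tau> N m \<omega> ^ q" for \<omega>
      using Y[OF v, of m \<omega>] p q by (intro powr_le_one_plus_power) auto
    hence "(\<integral>\<^sup>+ \<omega>. ennreal (Y \<tau> N m \<omega> powr p) \<partial>M) \<le> (\<integral>\<^sup>+ \<omega>. 1 + ennreal (X \<tau> N m \<omega> ^ q) \<partial>M)"
      using nn by (intro nn_integral_mono) (simp add: ennreal_leI flip: ennreal_1 ennreal_plus)
    also have "\<dots> = 1 + (\<integral>\<^sup>+ \<omega>. ennreal (X \<tau> N m \<omega> ^ q) \<partial>M)"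
      by (subst nn_integral_add) (simp_all add: emeasure_space_1)
    also have "\<dots> \<le> 1 + ennreal B" using B(2)[OF v] by (rule add_left_mono)
    finally show ?thesis using B(1) by simp
  qed
  hence "(SUP (\<tau>, N, m) \<in> {(\<tau>, N, m). 0 < \<tau> \<and> \<tau> < 1 \<and> 2 \<le> N}. \<integral>\<^sup>+ \<omega>. ennreal (Y \<tau> N m \<omega> powr p) \<partial>M) \<le> ennreal (1 + B)"
    by (intro SUP_least) auto
  also have "\<dots> < \<top>" by simp
  finally show ?thesis .
qed

theorem theorem4p1:
  fixes a0 a1 a2 a3 \<sigma> p :: real and f u0 :: "real \<Rightarrow> real"
    and M :: "'a measure" and \<beta> :: "nat \<Rightarrow> real \<Rightarrow> 'a \<Rightarrow> real"
  assumes f_def: "f = (\<lambda>x. a0 * x ^ 3 + a1 * x\<^sup>2 + a2 * x + a3)"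
    and a0_pos: "a0 > 0"
    and f_diss: "bdd_above (range (\<lambda>x. - deriv f x))" "(SUP x. - deriv f x) < 1"
    and BM: "indep_std_BMs M \<beta>"
    and u0: "H1_interval u0"
    and p: "p \<ge> 2"
  shows "(SUP (\<tau>, N, m) \<in> {(\<tau>, N, m). 0 < \<tau> \<and> \<tau> < 1 \<and> 2 \<le> N}.
            \<integral>\<^sup>+ \<omega>. ennreal (Linf_norm (PN N (Uscheme f \<sigma> \<beta> u0 \<tau> N m \<omega>)) powr p) \<partial>M) < \<top>
       \<and> (SUP (\<tau>, N, m) \<in> {(\<tau>, N, m). 0 < \<tau> \<and> \<tau> < 1 \<and> 2 \<le> N}.
            \<integral>\<^sup>+ \<omega>. ennreal (norm_w12N N (Uscheme f \<sigma> \<beta> u0 \<tau> N m \<omega>) powr p) \<partial>M) < \<top>"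
proof -
  have M: "prob_space M" using BM by (simp add: indep_std_BMs_def)
  obtain c C where f: "cubic_like f c C" using cubic_like_poly[OF a0_pos] unfolding f_def by blast
  have cC: "0 < c" "0 \<le> C" using f by (auto simp: cubic_like_def)
  obtain B where B: "\<And>N. 2 \<le> N \<Longrightarrow> sobN 0 N (\<lambda>i. u0 (xN N i)) + sobN 1 N (\<lambda>i. u0 (xN N i)) \<le> B"
    using H1_grid_bound[OF u0] by blast
  have B0: "0 \<le> B" using B[of 2] sobN_nonneg[of 0 2 "\<lambda>i. u0 (xN 2 i)"] sobN_nonneg[of 1 2 "\<lambda>i. u0 (xN 2 i)"] by simp
  define K where "K = 2 * c + C + 20 * C\<^sup>2 / c"
  define L where "L = 10240 * C\<^sup>2"
  \<comment> \<open>The path majorants with \<open>A0 = 1 + 2 * B\<close>, a constant that serves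
    every \<open>N\<close> at once.\<close>
  define G where "G = (\<lambda>\<tau> N m \<omega>. (1 + 2 * B) + 2 * \<sigma>\<^sup>2 * noise_energy \<beta> \<tau> N m \<omega>)"
  define R where "R = (\<lambda>\<tau> N m \<omega>. relaxation \<tau> (\<lambda>k. (2 * K + 1024 * K ^ 4 / c + 250 * C\<^sup>2) * G \<tau> N k \<omega> ^ 4) m)"
  define S where "S = (\<lambda>\<tau> N m \<omega>. relaxation \<tau> (\<lambda>k. (16 * L ^ 3 + L) * (G \<tau> N k \<omega> + R \<tau> N k \<omega>) ^ 7) m)"
  define X where "X = (\<lambda>\<tau> N m \<omega>. 2 * (R \<tau> N m \<omega> + S \<tau> N m \<omega>) + 2 * G \<tau> N m \<omega>)"
  have K0: "0 \<le> 2 * K + 1024 * K ^ 4 / c + 250 * C\<^sup>2" and L0: "0 \<le> 16 * L ^ 3 + L"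
    using cC by (auto simp: K_def L_def intro!: add_nonneg_nonneg)
  have G: "unif_moments M G"
    unfolding G_def using B0
    by (intro unif_moments_add unif_moments_const[OF M] unif_moments_cmult unif_moments_noise_energy[OF BM]) auto
  have R: "unif_moments M R"
    unfolding R_def by (intro unif_moments_relaxation[OF M] unif_moments_cmult unif_moments_power G K0)
  have S: "unif_moments M S"
    unfolding S_def by (intro unif_moments_relaxation[OF M] unif_moments_cmult unif_moments_power unif_moments_add G R L0)
  have X: "unif_moments M X"
    unfolding X_def by (intro unif_moments_add unif_moments_cmult G R S) auto
  have bound: "(norm_w12N N (Uscheme f \<sigma> \<beta> u0 \<tau> N m \<omega>))\<^sup>2 \<le> X \<tau> N m \<omega>" if v: "0 < \<tau>" "\<tau> < 1" "2 \<le> N" for \<tau> N m \<omega>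
    unfolding X_def R_def S_def
    by (rule scheme_path_bound[OF f v(3,1,2) _ K_def L_def]) (use B[OF v(3)] in \<open>simp_all add: G_def\<close>)
  have w12: "0 \<le> norm_w12N N v" for N v by (simp add: norm_w12N_def)
  have "(SUP (\<tau>, N, m) \<in> {(\<tau>, N, m). 0 < \<tau> \<and> \<tau> < 1 \<and> 2 \<le> N}.
            \<integral>\<^sup>+ \<omega>. ennreal (Linf_norm (PN N (Uscheme f \<sigma> \<beta> u0 \<tau> N m \<omega>)) powr p) \<partial>M) < \<top>"
  proof (rule unif_moments_SUP_finite[OF M])
    show "unif_moments M (\<lambda>\<tau> N m \<omega>. 2 * X \<tau> N m \<omega>)" by (rule unif_moments_cmult[OF X]) simp
    fix \<tau> :: real and N m :: nat and \<omega> :: 'a assume v: "0 < \<tau>" "\<tau> < 1" "2 \<le> N"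
    show "0 \<le> Linf_norm (PN N (Uscheme f \<sigma> \<beta> u0 \<tau> N m \<omega>)) \<and>
        (Linf_norm (PN N (Uscheme f \<sigma> \<beta> u0 \<tau> N m \<omega>)))\<^sup>2 \<le> 2 * X \<tau> N m \<omega>"
      using Linf_norm_PN[OF v(3), of "Uscheme f \<sigma> \<beta> u0 \<tau> N m \<omega>"] bound[OF v, of m \<omega>] by linarith
  qed (use p in simp)
  moreover have "(SUP (\<tau>, N, m) \<in> {(\<tau>, N, m). 0 < \<tau> \<and> \<tau> < 1 \<and> 2 \<le> N}.
            \<integral>\<^sup>+ \<omega>. ennreal (norm_w12N N (Uscheme f \<sigma> \<beta> u0 \<tau> N m \<omega>) powr p) \<partial>M) < \<top>"
    using p bound w12 by (intro unif_moments_SUP_finite[OF M X]) auto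
  ultimately show ?thesis by simp
qed

end
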